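(* Let $S=\begin{pmatrix}2 & 1/2\\ 1/2 & 3\end{pmatrix}$ (the binary quadratic form $2x^2+xy+3y^2$ of discriminant $-23$) and let \[ \vartheta_{[2,1,3]}^{(2)}(Z)=\sum_{X\in M_2(\mathbb{Z})}\exp\bigl(2\pi i\,\mathrm{tr}({}^t\!XSX\,Z)\bigr),\qquad Z\in\mathbb{H}_2 . \] Let $\mathcal{L}$ be the Leech lattice with Gram matrix $L$ (a positive definite even unimodular symmetric $24\times24$ integral matrix) and let $\vartheta_{\mathcal{L}}^{(2)}(Z)=\sum_{X\in M_{24,2}(\mathbb{Z})}\exp(\pi i\,\mathrm{tr}({}^t\!XLX\,Z))$. Then \[ \vartheta_{[2,1,3]}^{(2)}\equiv \vartheta_{\mathcal{L}}^{(2)}\pmod{23}, \] and consequently $\varTheta(\vartheta_{\mathcal{L}}^{(2)})\equiv 0\pmod{23}$.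
   Context: $\mathbb{H}_2$ is the Siegel upper half space of degree 2. $Sym_2^*(\mathbb{Z})$ denotes the set of symmetric rational $2\times 2$ matrices $T=(t_{lj})$ with $t_{ll}\in\mathbb{Z}$, $2t_{lj}\in\mathbb{Z}$; the notation $[m,r,n]$ stands for $\begin{pmatrix}m& r/2\\ r/2& n\end{pmatrix}$. Both theta series have Fourier expansions $\sum_{0\le T\in Sym_2^*(\mathbb{Z})}a(F;T)\exp(2\pi i\,\mathrm{tr}(TZ))$ with integral coefficients; for $\vartheta_{[2,1,3]}^{(2)}$, $a(T)$ is the number of $X\in M_2(\mathbb{Z})$ with ${}^t\!XSX=T$. The Leech lattice is the unique even unimodular lattice of rank 24 with no vectors of norm 2. The theta operator is $\varTheta(F):=\sum_T a(F;T)\det(T)q^T$ (a formal power series). For formal Fourier series with coefficients in $\mathbb{Z}_{(p)}$, $F_1\equiv F_2\pmod p$ means $a(F_1;T)\equiv a(F_2;T)\pmod p$ for all $T$. *)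

theory Defs
  imports "HOL-Analysis.Analysis" "HOL-Library.Numeral_Type"
begin

definition ratmat :: "int ^'m ^'n \<Rightarrow> rat ^'m ^'n" where
  "ratmat X = (\<chi> i j. of_int (X $ i $ j))"

definition S_213 :: "rat ^2 ^2" where
  "S_213 = vector [vector [2, 1/2], vector [1/2, 3]]"

text \<open>Fourier coefficient of theta^{(2)}_S(Z) = sum_X exp(2 pi i tr(X^t S X Z)), X in M_{n,2}(Z):
  the number of X with X^t S X = T.\<close>
definition theta_coeff :: "rat ^'n ^'n \<Rightarrow> rat ^2 ^2 \<Rightarrow> nat" where
  "theta_coeff Q T = card {X :: int ^2 ^'n. transpose (ratmat X) ** Q ** ratmat X = T}"

text \<open>Fourier coefficient of the lattice theta series
  sum_X exp(pi i tr(X^t L X Z)) = sum_X exp(2 pi i tr((1/2) X^t L X Z)).\<close>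
definition lattice_theta_coeff :: "int ^'n ^'n \<Rightarrow> rat ^2 ^2 \<Rightarrow> nat" where
  "lattice_theta_coeff L T = theta_coeff (\<chi> i j. (1/2) * of_int (L $ i $ j)) T"

definition half_integral_psd :: "rat ^2 ^2 \<Rightarrow> bool" where
  "half_integral_psd T \<longleftrightarrow> transpose T = T
     \<and> (\<forall>i. T $ i $ i \<in> \<int>) \<and> (\<forall>i j. 2 * T $ i $ j \<in> \<int>)
     \<and> (\<forall>v :: rat ^2. 0 \<le> (\<Sum>i\<in>UNIV. \<Sum>j\<in>UNIV. v $ i * T $ i $ j * v $ j))"

definition cong_Zp :: "int \<Rightarrow> rat \<Rightarrow> rat \<Rightarrow> bool" where
  "cong_Zp p x y \<longleftrightarrow> (\<exists>a b. x - y = of_int a / of_int b \<and> \<not> p dvd b \<and> p dvd a)"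

definition qform :: "int ^'n ^'n \<Rightarrow> int ^'n \<Rightarrow> int" where
  "qform L x = (\<Sum>i\<in>UNIV. \<Sum>j\<in>UNIV. x $ i * L $ i $ j * x $ j)"

definition leech_gram :: "int ^24 ^24 \<Rightarrow> bool" where
  "leech_gram L \<longleftrightarrow> transpose L = L
     \<and> (\<forall>x. x \<noteq> 0 \<longrightarrow> qform L x > 0)
     \<and> (\<forall>i. even (L $ i $ i))
     \<and> det L = 1
     \<and> (\<forall>x. qform L x \<noteq> 2)"

end

theory Submission
  imports Defs "HOL-Probability.Probability" "HOL-Complex_Analysis.Complex_Analysis"
    "HOL-Number_Theory.Cong" "HOL-Library.Multiset"
begin

no_notation fps_nth (infixl "$" 75)

text \<open>The Leech lattice has an automorphism \<open>\<sigma>\<close> of order 23 whose fixed lattice has Gram matrix \<open>2S\<close>. Then \<open>\<sigma>\<close> acts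
  on the representations of \<open>T\<close> by \<open>L\<close> with orbits of length 1 and 23, and the orbits of length 1 are the
  representations of \<open>T\<close> by \<open>S\<close>; this gives the congruence.

  For an arbitrary Gram matrix \<open>L\<close> as in the hypothesis, \<open>\<sigma>\<close> comes from Conway's characterisation of the lattice. Poisson
  summation makes the theta series of \<open>L\<close> a modular form of weight 12, which is thereby known and yields the numbers of vectors
  of norm 4, 6 and 8. Counting classes modulo \<open>2L\<close> then gives 24 pairwise orthogonal vectors of norm 8 in one class. In the
  coordinates of this frame, the even vectors reduce to a binary code of length 24 which is the Golay code, and the
  lattice is determined by it. The Golay code is invariant under a 23-cycle.\<close>

section \<open>Poisson summation for positive definite forms\<close>

text \<open>The hypothesis describes \<open>L\<close> by properties only, so there are no
  coordinates in which an automorphism could be written down; most of the proof serves to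
  manufacture them. The frame is forced because the shells fill the classes without slack:
  \<open>1 + 196560/2 + 16773120/2 + 398034000/48 = 2 ^ 24\<close>. The modular input is small. A
  power series in \<open>q\<close> is invariant under translation of \<tau> by construction, so the
  single inversion \<open>t\<close> to \<open>1/t\<close> on the imaginary axis is all that has to
  be proved. The comparison series is a polynomial in theta constants, whose inversion is Poisson
  summation in one variable: half the sum of the 24th powers is the theta series of the even
  unimodular lattice \<open>D24+\<close>, and the eighth power of the product is 256 times the
  discriminant form. The prime 23 enters as the order of a permutation with one fixed coordinate. In
  the frame, with norm one eighth of the sum of squares, the fixed vectors are spanned by
  \<open>(-3, 1, ..., 1)\<close> and \<open>(5, 1, ..., 1)\<close>, of norms 4 and 6 and inner
  product 1. Their Gram determinant is again 23, which is why the theta operator kills the series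
  modulo 23.\<close>

lemma trig_kernel_orthogonal:
  fixes D :: "real \<Rightarrow> complex"
  assumes cont: "continuous_on {0..1} D"
    and coeff: "\<And>m::int. integral {0..1} (\<lambda>x. D x * cis (2 * pi * of_int m * x)) = 0"
  shows "integral {0..1} (\<lambda>x. D x * cis (2 * pi * of_int m * x) *
           complex_of_real (((1 + cos (2 * pi * (x - c))) / 2) ^ N)) = 0"
proof (induction N arbitrary: m)
  case 0
  show ?case using coeff[of m] by simp
next
  case (Suc N)
  let ?g = "\<lambda>m x. D x * cis (2 * pi * of_int m * x) *
           complex_of_real (((1 + cos (2 * pi * (x - c))) / 2) ^ N)"
  have int: "?g m integrable_on {0..1}" for m :: int
    by (intro integrable_continuous_interval continuous_intros cont) auto
  \<comment> \<open>One kernel factor is a trigonometric polynomial with frequencies -1, 0 and 1, so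
    it only mixes neighbouring coefficients; hence \<open>m\<close> is arbitrary in the
    induction.\<close>
  have step: "complex_of_real ((1 + cos (2 * pi * (x - c))) / 2) = 1/2 + cis (2*pi*x) * cis(-2*pi*c) / 4
      + cis (-2*pi*x) * cis (2*pi*c) / 4" for x
    by (simp add: complex_eq_iff cos_diff sin_diff cos_add sin_add diff_divide_distrib add_divide_distrib algebra_simps)
  have eq: "?g m x * complex_of_real ((1 + cos (2 * pi * (x - c))) / 2)
     = (1/2) * ?g m x + (cis(-2*pi*c)/4) * ?g (m+1) x + (cis(2*pi*c)/4) * ?g (m-1) x" for x
    unfolding step
    by (simp add: algebra_simps add_divide_distrib flip: cis_mult) (simp add: cis_mult algebra_simps diff_divide_distrib add_divide_distrib)
  have "integral {0..1} (\<lambda>x. (1/2) * ?g m x + (cis(-2*pi*c)/4) * ?g (m+1) x + (cis(2*pi*c)/4) * ?g (m-1) x)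
     = (1/2) * integral {0..1} (?g m) + (cis(-2*pi*c)/4) * integral {0..1} (?g (m+1)) + (cis(2*pi*c)/4) * integral {0..1} (?g (m-1))"
    by (subst integral_add integral_mult_right; (intro integrable_add integrable_on_mult_right int)?)+ simp
  also have "\<dots> = 0" by (simp only: Suc.IH mult_zero_right add_0)
  finally show ?case unfolding eq[symmetric] by (simp add: mult_ac)
qed

text \<open>The powers \<open>k x ^ N\<close> concentrate at \<open>x0\<close> and are orthogonal to
  \<open>D\<close> by the previous lemma. If \<open>D x0\<close> were nonzero, the part of the
  integral of \<open>r x * k x ^ N\<close> near \<open>x0\<close> would be at least of order
  \<open>\<sigma> ^ N\<close> and the rest at most of order \<open>\<rho> ^ N\<close> with
  \<open>\<rho> < \<sigma>\<close>, so the integral could not vanish for large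
  \<open>N\<close>.\<close>

lemma continuous_eq_0_if_trig_coeffs_0:
  fixes D :: "real \<Rightarrow> complex"
  assumes cont: "continuous_on {0..1} D"
    and coeff: "\<And>m::int. integral {0..1} (\<lambda>x. D x * cis (2 * pi * of_int m * x)) = 0"
    and x0: "0 < x0" "x0 < 1"
  shows "D x0 = 0"
proof (rule ccontr)
  assume nz: "D x0 \<noteq> 0"
  define r where "r = (\<lambda>x. Re (D x * cnj (D x0)))"
  define k where "k = (\<lambda>x. (1 + cos (2 * pi * (x - x0))) / 2)"
  have contr: "continuous_on {0..1} r" unfolding r_def by (intro continuous_intros cont)
  have contk: "continuous_on {0..1} k" unfolding k_def by (intro continuous_intros) auto
  have int0: "integral {0..1} (\<lambda>x. r x * k x ^ N) = 0" for N
  proof -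
    have *: "(\<lambda>x. D x * complex_of_real (k x ^ N)) integrable_on {0..1}"
      by (intro integrable_continuous_interval continuous_intros cont contk)
    have "integral {0..1} (\<lambda>x. D x * complex_of_real (k x ^ N)) = 0"
      using trig_kernel_orthogonal[OF cont coeff, of 0 x0 N] by (simp add: k_def)
    hence "integral {0..1} (\<lambda>x. (D x * complex_of_real (k x ^ N)) * cnj (D x0)) = 0"
      by (simp only: integral_mult_left mult_zero_left)
    hence "Re (integral {0..1} (\<lambda>x. (D x * complex_of_real (k x ^ N)) * cnj (D x0))) = 0" by (simp only: zero_complex.sel)
    also have "Re (integral {0..1} (\<lambda>x. (D x * complex_of_real (k x ^ N)) * cnj (D x0)))
       = integral {0..1} (\<lambda>x. Re ((D x * complex_of_real (k x ^ N)) * cnj (D x0)))"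
      by (rule integral_linear[OF integrable_on_mult_left[OF *] bounded_linear_Re, unfolded o_def, symmetric])
    also have "\<dots> = integral {0..1} (\<lambda>x. r x * k x ^ N)"
      by (rule integral_cong) (simp add: r_def algebra_simps)
    finally show ?thesis .
  qed
  define c where "c = r x0 / 2"
  have "r x0 = (cmod (D x0))\<^sup>2" unfolding r_def cmod_power2 by (simp add: power2_eq_square)
  hence c0: "c > 0" using nz by (simp add: c_def)
  obtain d1 where d1: "d1 > 0" "\<And>x. x \<in> {0..1} \<Longrightarrow> \<bar>x - x0\<bar> < d1 \<Longrightarrow> \<bar>r x - r x0\<bar> < c"
    using contr x0 c0 unfolding continuous_on_iff dist_real_def by (metis atLeastAtMost_iff less_eq_real_def)
  \<comment> \<open>The bounds by \<open>x0\<close> and \<open>1 - x0\<close> keep the peak inside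
    the interval. As the kernel has period 1, they also keep all of \<open>[0, 1]\<close> at
    distance at least \<open>d\<close> from the neighbouring peaks \<open>x0 - 1\<close> and
    \<open>x0 + 1\<close>.\<close>
  define d where "d = Min {d1/2, x0, 1 - x0}"
  have d: "d > 0" using d1(1) x0 by (auto simp: d_def)
  have d': "d \<le> d1/2" "d \<le> x0" "d \<le> 1 - x0" unfolding d_def by (rule Min_le; simp)+
  note d = d d'
  have dhalf: "d \<le> 1/2" using d by linarith
  have rc: "r x \<ge> c" if "\<bar>x - x0\<bar> \<le> d" for x
  proof -
    have "x \<in> {0..1}" using that d by auto
    from d1(2)[OF this] that d d1(1) have "\<bar>r x - r x0\<bar> < c" by linarith
    thus ?thesis by (simp add: c_def abs_if field_simps split: if_splits)
  qed
  obtain M where M: "\<And>x. x \<in> {0..1} \<Longrightarrow> \<bar>r x\<bar> \<le> M"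
  proof -
    have "compact (r ` {0..1})" by (intro compact_continuous_image contr) simp
    hence "bounded (r ` {0..1})" by (rule compact_imp_bounded)
    then obtain M where "\<forall>y\<in>r ` {0..1}. norm y \<le> M" unfolding bounded_iff by blast
    hence "\<bar>r x\<bar> \<le> M" if "x \<in> {0..1}" for x using that by (simp add: Ball_def)
    thus ?thesis by (rule that)
  qed
  have M0: "M \<ge> 0" using M[of 0] by simp
  \<comment> \<open>The kernel at distance \<open>d\<close> bounds it from above outside, the kernel
    at distance \<open>d / 2\<close> bounds it from below inside; the two radii create the strict
    gap.\<close>
  define \<rho> where "\<rho> = (1 + cos (2 * pi * d)) / 2"
  define \<sigma> where "\<sigma> = (1 + cos (pi * d)) / 2"
  have rs: "0 \<le> \<rho>" "\<rho> < \<sigma>"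
  proof -
    show "0 \<le> \<rho>" unfolding \<rho>_def using add_left_mono[OF cos_ge_minus_one[of "2*pi*d"], of 1] by simp
    have "cos (2*pi*d) < cos (pi*d)" by (rule cos_monotone_0_pi) (use d dhalf in auto)
    thus "\<rho> < \<sigma>" by (simp add: \<rho>_def \<sigma>_def)
  qed
  have k0: "k x \<ge> 0" for x unfolding k_def using add_left_mono[OF cos_ge_minus_one[of "2 * pi * (x - x0)"], of 1] by simp
  have kin: "k x \<ge> \<sigma>" if "\<bar>x - x0\<bar> \<le> d/2" for x
  proof -
    have "cos (pi * d) \<le> cos \<bar>2 * pi * (x - x0)\<bar>"
    proof (rule cos_monotone_0_pi_le)
      have "2 * pi * \<bar>x - x0\<bar> \<le> 2 * pi * (d / 2)" using that by (intro mult_left_mono) auto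
      thus "\<bar>2 * pi * (x - x0)\<bar> \<le> pi * d" unfolding abs_mult by simp
      show "pi * d \<le> pi" using dhalf by simp
    qed simp
    thus ?thesis by (simp add: k_def \<sigma>_def del: abs_mult)
  qed
  have kout: "k x \<le> \<rho>" if "\<bar>x - x0\<bar> \<ge> d" "x \<in> {0..1}" for x
  proof -
    have le: "\<bar>x - x0\<bar> \<le> 1 - d" using that d by auto
    have "cos (2 * pi * \<bar>x - x0\<bar>) \<le> cos (2*pi*d)"
    proof (cases "\<bar>x - x0\<bar> \<le> 1/2")
      case True
      show ?thesis by (rule cos_monotone_0_pi_le) (use that d True in auto)
    next
      case False
      have "cos (2 * pi * \<bar>x - x0\<bar>) = cos (2 * pi * (1 - \<bar>x - x0\<bar>))"
        by (simp add: right_diff_distrib cos_diff)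
      also have "\<dots> \<le> cos (2*pi*d)"
        by (rule cos_monotone_0_pi_le) (use le d False in auto)
      finally show ?thesis .
    qed
    moreover have "cos (2 * pi * \<bar>x - x0\<bar>) = cos (2 * pi * (x - x0))"
    proof -
      have "2 * pi * \<bar>x - x0\<bar> = \<bar>2 * pi * (x - x0)\<bar>" by (simp add: abs_mult)
      thus ?thesis by (simp only: cos_abs_real)
    qed
    ultimately show ?thesis by (simp add: k_def \<rho>_def)
  qed
  let ?I = "{x0 - d/2..x0 + d/2}"
  have lower: "r x * k x ^ N \<ge> (if x \<in> ?I then c * \<sigma> ^ N else 0) - M * \<rho> ^ N" if x: "x \<in> {0..1}" for x N
  proof (cases "\<bar>x - x0\<bar> \<le> d")
    case True
    have "r x \<ge> c" by (rule rc) (use True in auto)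
    moreover have "c * \<sigma> ^ N \<le> r x * k x ^ N" if "x \<in> ?I"
    proof (rule mult_mono)
      show "\<sigma> ^ N \<le> k x ^ N" by (rule power_mono) (use kin[of x] that rs in \<open>auto simp: abs_if\<close>)
    qed (use \<open>r x \<ge> c\<close> c0 rs in auto)
    moreover have "0 \<le> M * \<rho>^N" using M0 rs by simp
    moreover have "0 \<le> r x * k x ^ N" using \<open>r x \<ge> c\<close> c0 k0 by simp
    ultimately show ?thesis by (smt (verit))
  next
    case False
    have "\<bar>r x * k x ^ N\<bar> \<le> M * \<rho> ^ N" unfolding abs_mult
      by (intro mult_mono) (use M[OF x] M0 kout[OF _ x] False k0 in \<open>auto intro!: power_mono simp: power_abs\<close>)
    moreover have "x \<notin> ?I" using False d by auto
    ultimately show ?thesis by auto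
  qed
  have key: "c * d * \<sigma> ^ N \<le> M * \<rho> ^ N" for N
  proof -
    have sub: "?I \<subseteq> {0..1}" using d by auto
    have h1: "((\<lambda>x. if x \<in> ?I then c * \<sigma> ^ N else 0) has_integral (c * \<sigma> ^ N * d)) {0..1}"
      using has_integral_restrict[OF sub, of "\<lambda>_. c * \<sigma>^N" "c * \<sigma> ^ N * d"] has_integral_const_real[of "c * \<sigma> ^ N" "x0 - d/2" "x0 + d/2"] d
      by (simp add: mult_ac)
    have h2: "((\<lambda>x. (if x \<in> ?I then c * \<sigma> ^ N else 0) - M * \<rho> ^ N) has_integral (c * \<sigma> ^ N * d - M * \<rho>^N)) {0..1}"
      using has_integral_diff[OF h1 has_integral_const_real[of "M * \<rho>^N" 0 1]] by simp
    have h3: "((\<lambda>x. r x * k x ^ N) has_integral 0) {0..1}"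
    proof -
      have "(\<lambda>x. r x * k x ^ N) integrable_on {0..1}"
        by (intro integrable_continuous_interval continuous_intros contr contk)
      thus ?thesis using integrable_integral int0[of N] by fastforce
    qed
    have "c * \<sigma> ^ N * d - M * \<rho>^N \<le> 0"
      by (rule has_integral_le[OF h2 h3]) (use lower in auto)
    thus ?thesis by (simp add: mult_ac)
  qed
  have "(\<lambda>N. M * (\<rho>/\<sigma>)^N) \<longlonglongrightarrow> M * 0"
    by (intro tendsto_mult tendsto_const LIMSEQ_realpow_zero) (use rs in auto)
  moreover have "c * d \<le> M * (\<rho>/\<sigma>)^N" for N
    using key[of N] rs by (simp add: power_divide field_simps)
  ultimately have "c * d \<le> 0" by (metis (no_types, lifting) LIMSEQ_le_const mult_zero_right)
  thus False using c0 d by (simp add: mult_le_0_iff)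
qed

lemma summable_on_int_exp_abs:
  assumes "c > 0"
  shows "(\<lambda>n::int. exp (- c * \<bar>real_of_int n\<bar>)) summable_on UNIV"
proof -
  have s: "(\<lambda>n::nat. exp (- c) ^ n) summable_on UNIV"
    using assms by (subst summable_on_UNIV_nonneg_real_iff) auto
  have e: "exp (- c) ^ n = exp (- c * real n)" for n
    by (simp add: exp_of_nat_mult[symmetric] mult_ac)
  have 1: "(\<lambda>n::int. exp (- c * \<bar>real_of_int n\<bar>)) summable_on range int"
    using s by (subst summable_on_reindex) (auto simp: o_def e inj_on_def)
  have 2: "(\<lambda>n::int. exp (- c * \<bar>real_of_int n\<bar>)) summable_on range (\<lambda>n. - int n)"
    using s by (subst summable_on_reindex) (auto simp: o_def e inj_on_def)
  have "range int \<union> range (\<lambda>n. - int n) = UNIV"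
    by (auto simp: image_iff) (metis int_cases2)
  thus ?thesis using summable_on_union[OF 1 2] by simp
qed

text \<open>From \<open>0 \<le> (n + 2 * x)\<^sup>2\<close> follows
  \<open>(n + x)\<^sup>2 \<ge> n\<^sup>2 / 2 - x\<^sup>2\<close>. The majorant depends on
  \<open>x\<close> only through \<open>X\<close>, as the Weierstrass test requires.\<close>

lemma gauss_int_bound:
  fixes n :: int and x a :: real
  assumes "a > 0" "\<bar>x\<bar> \<le> X"
  shows "exp (- pi * a * (of_int n + x)\<^sup>2) \<le> exp (pi * a * X\<^sup>2) * exp (- (pi * a / 2) * \<bar>of_int n\<bar>)"
proof -
  have "\<bar>real_of_int n\<bar> \<le> (of_int n)\<^sup>2"
  proof (cases "n = 0")
    case False
    hence "1 \<le> \<bar>real_of_int n\<bar>" by linarith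
    hence "\<bar>real_of_int n\<bar> * 1 \<le> \<bar>real_of_int n\<bar> * \<bar>real_of_int n\<bar>" by (intro mult_left_mono) auto
    thus ?thesis by (simp add: power2_eq_square flip: abs_mult)
  qed simp
  moreover have "x\<^sup>2 \<le> X\<^sup>2" using assms(2) by (metis abs_ge_zero power2_abs power_mono)
  moreover have "0 \<le> (of_int n + 2 * x)\<^sup>2" by simp
  ultimately have "\<bar>real_of_int n\<bar> / 2 - X\<^sup>2 \<le> (of_int n + x)\<^sup>2"
    by (simp add: power2_eq_square algebra_simps)
  hence "pi * a * (\<bar>real_of_int n\<bar> / 2 - X\<^sup>2) \<le> pi * a * (of_int n + x)\<^sup>2"
    using assms(1) by (intro mult_left_mono) auto
  thus ?thesis by (simp add: exp_add[symmetric] algebra_simps)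
qed

lemma gauss_summable_int:
  fixes a x :: real
  assumes "a > 0"
  shows "(\<lambda>n::int. exp (- pi * a * (of_int n + x)\<^sup>2)) summable_on UNIV"
proof (rule summable_on_comparison_test)
  show "(\<lambda>n::int. exp (pi * a * \<bar>x\<bar>\<^sup>2) * exp (- (pi * a / 2) * \<bar>of_int n\<bar>)) summable_on UNIV"
    using assms by (intro summable_on_cmult_right summable_on_int_exp_abs) auto
  show "exp (- pi * a * (of_int n + x)\<^sup>2) \<le> exp (pi * a * \<bar>x\<bar>\<^sup>2) * exp (- (pi * a / 2) * \<bar>of_int n\<bar>)" for n
    by (rule gauss_int_bound[OF assms]) simp
qed simp

text \<open>The characteristic function of the standard normal distribution after the substitution
  \<open>x = sqrt (2 * pi * a) * u\<close>.\<close>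

lemma gauss_fourier:
  fixes a s :: real
  assumes a: "a > 0"
  shows "has_bochner_integral lborel (\<lambda>u. exp (- pi * a * u\<^sup>2) *\<^sub>R cis (2 * pi * s * u))
           (complex_of_real (exp (- pi * s\<^sup>2 / a) / sqrt a))"
proof -
  define c where "c = sqrt (2 * pi * a)"
  have c: "c > 0" "c\<^sup>2 = 2 * pi * a" using a by (auto simp: c_def)
  define t where "t = 2 * pi * s / c"
  have int: "integrable lborel (\<lambda>x. std_normal_density x *\<^sub>R iexp (t * x))"
  proof (rule Bochner_Integration.integrable_bound)
    show "integrable lborel std_normal_density" by simp
  qed (auto simp: cis_conv_exp[symmetric])
  have "(LINT x|lborel. std_normal_density x *\<^sub>R iexp (t * x)) = exp (- (t^2) / 2)"
    using fun_cong[OF char_std_normal_distribution, of t] unfolding char_def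
    by (subst (asm) integral_density) auto
  hence "has_bochner_integral lborel (\<lambda>x. std_normal_density x *\<^sub>R iexp (t * x)) (exp (- (t^2) / 2))"
    using int by (simp add: has_bochner_integral_iff)
  hence "has_bochner_integral lborel (\<lambda>x. std_normal_density (0 + c * x) *\<^sub>R iexp (t * (0 + c * x))) (complex_of_real (exp (- (t^2) / 2)) /\<^sub>R \<bar>c\<bar>)"
    using c by (subst (asm) lborel_has_bochner_integral_real_affine_iff[where c=c and t=0]) (auto simp: scaleR_conv_of_real)
  hence "has_bochner_integral lborel (\<lambda>x. sqrt (2 * pi) *\<^sub>R (std_normal_density (0 + c * x) *\<^sub>R iexp (t * (0 + c * x)))) (sqrt (2 * pi) *\<^sub>R (complex_of_real (exp (- (t^2) / 2)) /\<^sub>R \<bar>c\<bar>))"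
    by (intro has_bochner_integral_scaleR_right)
  moreover have "sqrt (2 * pi) *\<^sub>R (std_normal_density (0 + c * x) *\<^sub>R iexp (t * (0 + c * x)))
      = exp (- pi * a * x\<^sup>2) *\<^sub>R cis (2 * pi * s * x)" for x
    using c by (simp add: std_normal_density_def power_mult_distrib cis_conv_exp t_def mult_ac)
  moreover have "sqrt (2 * pi) *\<^sub>R (complex_of_real (exp (- (t^2) / 2)) /\<^sub>R \<bar>c\<bar>) = complex_of_real (exp (- pi * s\<^sup>2 / a) / sqrt a)"
  proof -
    have "t^2 / 2 = pi * s\<^sup>2 / a" using c a
      by (simp add: t_def power_divide power_mult_distrib power2_eq_square[of pi] field_simps)
    moreover have "sqrt (2 * pi) / c = 1 / sqrt a" using a by (simp add: c_def real_sqrt_mult)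
    ultimately show ?thesis using c
      by (simp add: scaleR_conv_of_real field_simps flip: of_real_mult of_real_divide)
  qed
  ultimately show ?thesis by (simp add: exp_of_real)
qed

lemma infsum_int_dominated:
  fixes F :: "int \<Rightarrow> real \<Rightarrow> complex"
  assumes cont: "\<And>n. continuous_on {0..1} (F n)"
    and bound: "\<And>n x. x \<in> {0..1} \<Longrightarrow> norm (F n x) \<le> M n" and M: "M summable_on UNIV"
  shows "continuous_on {0..1} (\<lambda>x. \<Sum>\<^sub>\<infinity>n. F n x)"
    and "((\<lambda>n. integral {0..1} (F n)) has_sum integral {0..1} (\<lambda>x. \<Sum>\<^sub>\<infinity>n. F n x)) UNIV"
proof -
  have u: "uniform_limit {0..1} (\<lambda>X x. \<Sum>n\<in>X. F n x) (\<lambda>x. \<Sum>\<^sub>\<infinity>n. F n x) (finite_subsets_at_top UNIV)"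
    by (rule Weierstrass_m_test_general[OF bound M]) auto
  have c: "continuous_on {0..1} (\<lambda>x. \<Sum>n\<in>X. F n x)" for X
    by (intro continuous_on_sum cont)
  show "continuous_on {0..1} (\<lambda>x. \<Sum>\<^sub>\<infinity>n. F n x)"
    by (rule uniform_limit_theorem[OF _ u]) (auto intro: always_eventually c)
  from uniform_limit_integral[OF u c] obtain I J where IJ:
    "\<And>X. ((\<lambda>x. \<Sum>n\<in>X. F n x) has_integral I X) {0..1}"
    "((\<lambda>x. \<Sum>\<^sub>\<infinity>n. F n x) has_integral J) {0..1}" "(I \<longlongrightarrow> J) (finite_subsets_at_top UNIV)"
    by (metis finite_subsets_at_top_neq_bot)
  have "I X = (\<Sum>n\<in>X. integral {0..1} (F n))" if "finite X" for X
  proof -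
    have "((\<lambda>x. \<Sum>n\<in>X. F n x) has_integral (\<Sum>n\<in>X. integral {0..1} (F n))) {0..1}"
      by (intro has_integral_sum that integrable_integral integrable_continuous_interval cont)
    thus ?thesis using IJ(1)[of X] has_integral_unique by blast
  qed
  hence "((\<lambda>X. \<Sum>n\<in>X. integral {0..1} (F n)) \<longlongrightarrow> J) (finite_subsets_at_top UNIV)"
    by (intro Lim_transform_eventually[OF IJ(3)]) (auto simp: eventually_finite_subsets_at_top)
  thus "((\<lambda>n. integral {0..1} (F n)) has_sum integral {0..1} (\<lambda>x. \<Sum>\<^sub>\<infinity>n. F n x)) UNIV"
    using IJ(2) by (simp add: has_sum_def integral_unique)
qed

lemma infsum_integral_unit_intervals:
  fixes f :: "real \<Rightarrow> complex"
  assumes f: "integrable lborel f" and cont: "continuous_on UNIV f"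
    and summ: "(\<lambda>n::int. integral {0..1} (\<lambda>x. f (of_int n + x))) summable_on UNIV"
  shows "(\<Sum>\<^sub>\<infinity>n::int. integral {0..1} (\<lambda>x. f (of_int n + x))) = integral\<^sup>L lborel f"
proof -
  let ?I = "\<lambda>n::int. integral {0..1} (\<lambda>x. f (of_int n + x))"
  \<comment> \<open>Countable additivity of the integral concerns sequences of sets, so the unit
    intervals are enumerated through \<open>int_decode\<close>.\<close>
  define A where "A = (\<lambda>i::nat. {real_of_int (int_decode i)..<real_of_int (int_decode i) + 1})"
  have si: "set_integrable lborel B f" if "B \<in> sets lborel" for B
    using f that unfolding set_integrable_def by (rule integrable_mult_indicator[rotated])
  have UN: "(\<Union>i. A i) = UNIV"
  proof (intro set_eqI iffI UNIV_I)
    fix x :: real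
    have "x \<in> A (int_encode \<lfloor>x\<rfloor>)" by (simp add: A_def)
    thus "x \<in> (\<Union>i. A i)" by blast
  qed
  have meas: "A i \<in> sets lborel" for i
    unfolding A_def sets_lborel by measurable
  have disj: "A i \<inter> A j = {}" if "i \<noteq> j" for i j
  proof -
    have "int_decode i \<noteq> int_decode j" using that by (metis int_decode_inverse)
    thus ?thesis unfolding A_def by auto
  qed
  have LA: "(LINT x:A i|lborel. f x) = ?I (int_decode i)" for i
  proof -
    let ?n = "real_of_int (int_decode i)"
    have "(LINT x:A i|lborel. f x) = integral {?n..<?n+1} f"
      unfolding A_def by (rule set_borel_integral_eq_integral(2)[OF si[OF meas[unfolded A_def]]])
    also have "\<dots> = integral {?n..?n+1} f"
      by (rule integral_spike_set; rule negligible_subset[of "{?n+1}"]) auto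
    also have "\<dots> = ?I (int_decode i)"
      using integral_shift_Icc_real[of 0 1 f ?n] by (simp add: o_def add.commute)
    finally show ?thesis .
  qed
  have "(LINT x:(\<Union>i. A i)|lborel. f x) = (\<Sum>i. (LINT x:(A i)|lborel. f x))"
  proof (rule lebesgue_integral_countable_add)
    show "set_integrable lborel (\<Union>i. A i) f" unfolding UN by (rule si) simp
  qed (use meas disj in blast)+
  hence "integral\<^sup>L lborel f = (\<Sum>i. ?I (int_decode i))"
    unfolding UN LA by (simp add: set_lebesgue_integral_def)
  moreover have "(\<lambda>i. ?I (int_decode i)) sums (\<Sum>\<^sub>\<infinity>n. ?I n)"
    by (rule has_sum_imp_sums) (use has_sum_infsum[OF summ] has_sum_reindex_bij_betw[OF bij_int_decode, of ?I] in auto)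
  ultimately show ?thesis by (simp add: sums_iff)
qed

lemma gauss_cis_summable_int:
  fixes a x b :: real
  assumes "a > 0"
  shows "(\<lambda>n::int. exp (- pi * a * (of_int n + x)\<^sup>2) *\<^sub>R cis (f n)) summable_on UNIV"
  by (rule abs_summable_summable) (use gauss_summable_int[OF assms, of x] in simp)

text \<open>Both sides are continuous in \<open>x\<close> with the same integrals against
  \<open>e k\<close>, namely \<open>C (- k)\<close>: on the left, unfolding the sum over
  \<open>n\<close> gives the Fourier transform of a Gaussian on the whole line; on the right,
  orthogonality leaves only \<open>m = - k\<close>. The uniqueness lemma then yields equality at
  interior points.\<close>

lemma poisson_gauss_1d_unit:
  fixes a b x :: real
  assumes a: "a > 0" and x: "0 < x" "x < 1"
  shows "(\<Sum>\<^sub>\<infinity>n::int. exp (- pi * a * (of_int n + x)\<^sup>2) *\<^sub>R cis (2 * pi * b * (of_int n + x)))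
       = (\<Sum>\<^sub>\<infinity>m::int. (exp (- pi * (of_int m - b)\<^sup>2 / a) / sqrt a) *\<^sub>R cis (2 * pi * of_int m * x))"
proof -
  define F where "F = (\<lambda>(n::int) x. exp (- pi * a * (of_int n + x)\<^sup>2) *\<^sub>R cis (2 * pi * b * (of_int n + x)))"
  define C where "C = (\<lambda>m::int. exp (- pi * (of_int m - b)\<^sup>2 / a) / sqrt a)"
  define G where "G = (\<lambda>(m::int) x. C m *\<^sub>R cis (2 * pi * of_int m * x))"
  define M where "M = (\<lambda>n::int. exp (pi * a * 1\<^sup>2) * exp (- (pi * a / 2) * \<bar>real_of_int n\<bar>))"
  have M: "M summable_on UNIV"
    unfolding M_def using a by (intro summable_on_cmult_right summable_on_int_exp_abs) auto
  have C: "C summable_on UNIV"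
  proof -
    have "(\<lambda>m::int. exp (- pi * (1/a) * (of_int m + - b)\<^sup>2) * (1 / sqrt a)) summable_on UNIV"
      by (intro summable_on_cmult_left gauss_summable_int) (use a in auto)
    thus ?thesis by (simp add: C_def)
  qed
  have C0: "C m \<ge> 0" for m using a by (simp add: C_def)
  define e where "e = (\<lambda>(k::int) x::real. cis (2 * pi * of_int k * x))"
  have e: "continuous_on A (e k)" for A k unfolding e_def by (intro continuous_intros)
  have cF: "continuous_on A (F n)" for n A unfolding F_def by (intro continuous_intros)
  have cG: "continuous_on A (G n)" for n A unfolding G_def by (intro continuous_intros)
  have bF: "norm (F n x) \<le> M n" if "x \<in> {0..1}" for n x
    unfolding F_def M_def using gauss_int_bound[OF a, of x 1 n] that by auto
  have bG: "norm (G n x) \<le> C n" for n x unfolding G_def using C0 by simp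
  have e1: "norm (e k x) = 1" for k x by (simp add: e_def)
  have contF: "continuous_on {0..1} (\<lambda>x. \<Sum>\<^sub>\<infinity>n. F n x)" by (rule infsum_int_dominated(1)[OF cF bF M])
  have contG: "continuous_on {0..1} (\<lambda>x. \<Sum>\<^sub>\<infinity>n. G n x)" by (rule infsum_int_dominated(1)[OF cG bG C])
  have coF: "integral {0..1} (\<lambda>x. (\<Sum>\<^sub>\<infinity>n. F n x) * e k x) = of_real (C (- k))" for k
  proof -
    define f where "f = (\<lambda>u. exp (- pi * a * u\<^sup>2) *\<^sub>R cis (2 * pi * (b + of_int k) * u))"
    have Fe: "F n x * e k x = f (of_int n + x)" for n x
    proof -
      have "e k x = cis (2 * pi * of_int k * (of_int n + x))"
      proof -
        have "2 * pi * of_int k * (of_int n + x) = 2 * pi * of_int (k * n) + 2 * pi * of_int k * x" by (simp add: algebra_simps)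
        thus ?thesis unfolding e_def by (simp only: cis_mult[symmetric]) (metis cis_multiple_2pi Ints_of_int mult_1)
      qed
      thus ?thesis unfolding F_def f_def by (simp add: cis_mult algebra_simps)
    qed
    have hs: "((\<lambda>n. integral {0..1} (\<lambda>x. F n x * e k x)) has_sum integral {0..1} (\<lambda>x. \<Sum>\<^sub>\<infinity>n. F n x * e k x)) UNIV"
      by (rule infsum_int_dominated(2)[OF _ _ M]) (auto intro!: continuous_intros cF e simp: norm_mult e1 bF)
    have gf: "has_bochner_integral lborel f (of_real (C (- k)))"
    proof -
      have "(- real_of_int k - b)\<^sup>2 = (b + of_int k)\<^sup>2" by (simp add: power2_eq_square algebra_simps)
      thus ?thesis using gauss_fourier[OF a, of "b + of_int k"] unfolding f_def C_def by simp
    qed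
    have "(\<Sum>\<^sub>\<infinity>n::int. integral {0..1} (\<lambda>x. f (of_int n + x))) = integral\<^sup>L lborel f"
    proof (rule infsum_integral_unit_intervals)
      show "continuous_on UNIV f" unfolding f_def by (intro continuous_intros)
      show "(\<lambda>n::int. integral {0..1} (\<lambda>x. f (of_int n + x))) summable_on UNIV"
        using hs has_sum_imp_summable unfolding Fe by blast
    qed (use gf in \<open>simp add: has_bochner_integral_iff\<close>)
    also have "\<dots> = of_real (C (- k))" using gf by (simp add: has_bochner_integral_iff)
    finally have *: "integral {0..1} (\<lambda>x. \<Sum>\<^sub>\<infinity>n. F n x * e k x) = of_real (C (- k))"
      using hs unfolding Fe by (simp add: has_sum_iff)
    have "(\<Sum>\<^sub>\<infinity>n. F n x * e k x) = (\<Sum>\<^sub>\<infinity>n. F n x) * e k x" for x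
      unfolding F_def by (rule infsum_cmult_left) (rule gauss_cis_summable_int[OF a])
    thus ?thesis using * by simp
  qed
  have int_e: "integral {0..1} (e j) = (if j = 0 then 1 else 0)" for j
  proof (cases "j = 0")
    case True thus ?thesis by (simp add: e_def)
  next
    case False
    have "(e j has_integral (e j 1 / (2 * pi * \<i> * of_int j) - e j 0 / (2 * pi * \<i> * of_int j))) {0..1}"
    proof (rule fundamental_theorem_of_calculus)
      fix x :: real
      have "((\<lambda>z. exp (2 * pi * \<i> * of_int j * z) / (2 * pi * \<i> * of_int j)) has_field_derivative
              exp (2 * pi * \<i> * of_int j * of_real x)) (at (of_real x))"
        using False by (auto intro!: derivative_eq_intros)
      from has_vector_derivative_real_field[OF this, of "{0..1}"]
      show "((\<lambda>x. e j x / (2 * pi * \<i> * of_int j)) has_vector_derivative e j x) (at x within {0..1})"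
        unfolding e_def cis_conv_exp by (simp add: mult_ac)
    qed simp
    moreover have "e j 1 = 1" "e j 0 = 1" unfolding e_def by (simp_all add: cis_multiple_2pi)
    ultimately show ?thesis using False by (simp add: integral_unique)
  qed
  have coG: "integral {0..1} (\<lambda>x. (\<Sum>\<^sub>\<infinity>n. G n x) * e k x) = of_real (C (- k))" for k
  proof -
    have Ge: "G n x * e k x = C n *\<^sub>R e (n + k) x" for n x
      unfolding G_def e_def by (simp add: cis_mult algebra_simps)
    have hs: "((\<lambda>n. integral {0..1} (\<lambda>x. G n x * e k x)) has_sum integral {0..1} (\<lambda>x. \<Sum>\<^sub>\<infinity>n. G n x * e k x)) UNIV"
      by (rule infsum_int_dominated(2)[OF _ _ C]) (auto intro!: continuous_intros cG e simp: norm_mult e1 bG)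
    have "((\<lambda>n. if n = - k then complex_of_real (C (- k)) else 0) has_sum integral {0..1} (\<lambda>x. \<Sum>\<^sub>\<infinity>n. G n x * e k x)) UNIV"
      using hs unfolding Ge
      by (rule has_sum_cong[THEN iffD1, rotated]) (auto simp: int_e scaleR_conv_of_real add_eq_0_iff2)
    moreover have "((\<lambda>n. if n = - k then complex_of_real (C (- k)) else 0) has_sum complex_of_real (C (- k))) UNIV"
      by (rule has_sum_finite_neutralI[of "{-k}"]) auto
    ultimately have "integral {0..1} (\<lambda>x. \<Sum>\<^sub>\<infinity>n. G n x * e k x) = complex_of_real (C (- k))"
      using has_sum_unique by blast
    moreover have "(\<Sum>\<^sub>\<infinity>n. G n x * e k x) = (\<Sum>\<^sub>\<infinity>n. G n x) * e k x" for x
    proof (rule infsum_cmult_left)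
      show "(\<lambda>n. G n x) summable_on UNIV"
        by (rule abs_summable_summable, rule Infinite_Sum.abs_summable_on_comparison_test'[OF C], rule bG)
    qed
    ultimately show ?thesis by simp
  qed
  have "(\<Sum>\<^sub>\<infinity>n. F n x) - (\<Sum>\<^sub>\<infinity>n. G n x) = 0"
  proof (rule continuous_eq_0_if_trig_coeffs_0[OF _ _ x])
    show "continuous_on {0..1} (\<lambda>x. (\<Sum>\<^sub>\<infinity>n. F n x) - (\<Sum>\<^sub>\<infinity>n. G n x))"
      by (intro continuous_intros contF contG)
    fix k :: int
    have "integral {0..1} (\<lambda>x. (\<Sum>\<^sub>\<infinity>n. F n x) * e k x - (\<Sum>\<^sub>\<infinity>n. G n x) * e k x) = 0"
      by (subst integral_diff) (auto intro!: integrable_continuous_interval continuous_intros contF contG e simp: coF coG)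
    thus "integral {0..1} (\<lambda>x. ((\<Sum>\<^sub>\<infinity>n. F n x) - (\<Sum>\<^sub>\<infinity>n. G n x)) * cis (2 * pi * of_int k * x)) = 0"
      by (simp add: left_diff_distrib e_def)
  qed
  thus ?thesis by (simp add: F_def G_def C_def)
qed

text \<open>Both sides have period 1, and the integers are reached by continuity. Shift
  \<open>x\<close> and frequency \<open>b\<close> are both kept general because eliminating one
  variable after another produces nonzero values of both, even for a plain theta series.\<close>

lemma poisson_gauss_1d:
  fixes a b x :: real
  assumes a: "a > 0"
  shows "(\<Sum>\<^sub>\<infinity>n::int. exp (- pi * a * (of_int n + x)\<^sup>2) *\<^sub>R cis (2 * pi * b * (of_int n + x)))
       = (\<Sum>\<^sub>\<infinity>m::int. (exp (- pi * (of_int m - b)\<^sup>2 / a) / sqrt a) *\<^sub>R cis (2 * pi * of_int m * x))"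
    (is "?F x = ?G x")
proof -
  have shiftF: "?F (y + of_int k) = ?F y" for y k
  proof -
    have "?F (y + of_int k) = (\<Sum>\<^sub>\<infinity>n::int. (\<lambda>n. exp (- pi * a * (of_int n + y)\<^sup>2) *\<^sub>R cis (2 * pi * b * (of_int n + y))) (n + k))"
      by (simp add: algebra_simps)
    also have "\<dots> = ?F y" by (rule infsum_reindex_bij_betw) (rule bij_betwI[of _ _ _ "\<lambda>n. n - k"], auto)
    finally show ?thesis .
  qed
  have shiftG: "?G (y + of_int k) = ?G y" for y k
  proof -
    have "cis (2 * pi * of_int m * (y + of_int k)) = cis (2 * pi * of_int m * y)" for m :: int
    proof -
      have "2 * pi * of_int m * (y + of_int k) = 2 * pi * of_int (m * k) + 2 * pi * of_int m * y" by (simp add: algebra_simps)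
      thus ?thesis by (simp only: cis_mult[symmetric]) (metis cis_multiple_2pi Ints_of_int mult_1)
    qed
    thus ?thesis by simp
  qed
  show ?thesis
  proof (cases "frac x = 0")
    case False
    have "?F (frac x) = ?G (frac x)"
      by (rule poisson_gauss_1d_unit[OF a]) (use False frac_lt_1[of x] frac_ge_0[of x] in linarith)+
    thus ?thesis using shiftF[of "frac x" "\<lfloor>x\<rfloor>"] shiftG[of "frac x" "\<lfloor>x\<rfloor>"] by (simp add: frac_def)
  next
    case True
    have 0: "?F 0 = ?G 0"
    proof -
      define M where "M = (\<lambda>n::int. exp (pi * a * 1\<^sup>2) * exp (- (pi * a / 2) * \<bar>real_of_int n\<bar>))"
      have M: "M summable_on UNIV"
        unfolding M_def using a by (intro summable_on_cmult_right summable_on_int_exp_abs) auto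
      have C: "(\<lambda>m::int. exp (- pi * (of_int m - b)\<^sup>2 / a) / sqrt a) summable_on UNIV"
      proof -
        have "(\<lambda>m::int. exp (- pi * (1/a) * (of_int m + - b)\<^sup>2) * (1 / sqrt a)) summable_on UNIV"
          by (intro summable_on_cmult_left gauss_summable_int) (use a in auto)
        thus ?thesis by simp
      qed
      have cF: "continuous_on {0..1} ?F"
      proof (rule infsum_int_dominated(1)[OF _ _ M])
        show "norm (exp (- pi * a * (of_int n + x)\<^sup>2) *\<^sub>R cis (2 * pi * b * (of_int n + x))) \<le> M n"
          if "x \<in> {0..1}" for n x
          unfolding M_def using gauss_int_bound[OF a, of x 1 n] that by auto
      qed (intro continuous_intros)
      have cG: "continuous_on {0..1} ?G"
        by (rule infsum_int_dominated(1)[OF _ _ C]) (use a in \<open>auto intro!: continuous_intros\<close>)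
      have "?F x - ?G x = 0" if "x \<in> closure {0<..<1}" for x
      proof (rule continuous_constant_on_closure[OF _ _ that])
        show "continuous_on (closure {0<..<1}) (\<lambda>x. ?F x - ?G x)"
          using cF cG by (intro continuous_on_diff) simp_all
      qed (use poisson_gauss_1d_unit[OF a] in auto)
      from this[of 0] show ?thesis by simp
    qed
    thus ?thesis using shiftF[of 0 "\<lfloor>x\<rfloor>"] shiftG[of 0 "\<lfloor>x\<rfloor>"] True by (simp add: frac_def)
  qed
qed

section \<open>Poisson summation in several variables\<close>

fun dotl :: "real list \<Rightarrow> real list \<Rightarrow> real" where
  "dotl (x # xs) (y # ys) = x * y + dotl xs ys"
| "dotl _ _ = 0"

text \<open>A list of pairs \<open>(\<alpha>, g)\<close> encodes a positive definite form in Lagrange's diagonal shape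
  \<open>\<Sum> \<alpha>\<^sub>i (x\<^sub>i + g\<^sub>i \<bullet> (x\<^sub>i\<^sub>+\<^sub>1, x\<^sub>i\<^sub>+\<^sub>2, \<dots>))\<^sup>2\<close>; \<open>dual_form\<close> is the form of the inverse matrix and \<open>form_lin\<close> multiplication
  by the matrix. Poisson summation then goes through one variable at a time.\<close>

fun form_ok :: "(real \<times> real list) list \<Rightarrow> bool" where
  "form_ok ((\<alpha>, g) # F) \<longleftrightarrow> \<alpha> > 0 \<and> length g = length F \<and> form_ok F"
| "form_ok [] \<longleftrightarrow> True"

fun form :: "(real \<times> real list) list \<Rightarrow> real list \<Rightarrow> real" where
  "form ((\<alpha>, g) # F) (x # xs) = \<alpha> * (x + dotl g xs)\<^sup>2 + form F xs"
| "form _ _ = 0"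

fun dual_form :: "(real \<times> real list) list \<Rightarrow> real list \<Rightarrow> real" where
  "dual_form ((\<alpha>, g) # F) (m # ms) = m\<^sup>2 / \<alpha> + dual_form F (map2 (\<lambda>y c. y - m * c) ms g)"
| "dual_form _ _ = 0"

fun form_lin :: "(real \<times> real list) list \<Rightarrow> real list \<Rightarrow> real list" where
  "form_lin ((\<alpha>, g) # F) (x # xs) =
     (let z = \<alpha> * (x + dotl g xs) in z # map2 (\<lambda>y c. y + z * c) (form_lin F xs) g)"
| "form_lin _ _ = []"

text \<open>The determinant of the form to the power -1/2, the constant of Poisson
  summation.\<close>

fun form_const :: "(real \<times> real list) list \<Rightarrow> real" where
  "form_const ((\<alpha>, g) # F) = form_const F / sqrt \<alpha>"
| "form_const [] = 1"

definition shift_plus :: "int list \<Rightarrow> real list \<Rightarrow> real list" where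
  "shift_plus = map2 (\<lambda>i r. of_int i + r)"
definition shift_minus :: "int list \<Rightarrow> real list \<Rightarrow> real list" where
  "shift_minus = map2 (\<lambda>i r. of_int i - r)"

lemma shift_Cons [simp]:
  "shift_plus (i # is) (r # rs) = (of_int i + r) # shift_plus is rs"
  "shift_minus (i # is) (r # rs) = (of_int i - r) # shift_minus is rs"
  by (simp_all add: shift_plus_def shift_minus_def)

lemma length_shift [simp]:
  "length (shift_plus is rs) = min (length is) (length rs)"
  "length (shift_minus is rs) = min (length is) (length rs)"
  by (simp_all add: shift_plus_def shift_minus_def)

lemma form_const_pos: "form_ok F \<Longrightarrow> form_const F > 0"
  by (induction F rule: form_ok.induct) auto

lemma length_form_lin: "form_ok F \<Longrightarrow> length xs = length F \<Longrightarrow> length (form_lin F xs) = length F"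
proof (induction F arbitrary: xs)
  case (Cons a F)
  thus ?case by (cases a; cases xs) (auto simp: Let_def)
qed simp

text \<open>The leading entry \<open>z\<close> of \<open>form_lin\<close> is exactly what
  \<open>dual_form\<close> uses to subtract the multiples of \<open>g\<close> that
  \<open>form_lin\<close> added, so one square is peeled off on each side. In matrix terms: the
  inverse form at \<open>A x\<close> is the form at \<open>x\<close>.\<close>

lemma dual_form_form_lin:
  "form_ok F \<Longrightarrow> length xs = length F \<Longrightarrow> dual_form F (form_lin F xs) = form F xs"
proof (induction F arbitrary: xs)
  case (Cons a F)
  obtain \<alpha> g where a: "a = (\<alpha>, g)" by force
  obtain y ys where xs: "xs = y # ys" using Cons.prems by (cases xs) auto
  have len: "length (form_lin F ys) = length F"
    using Cons.prems by (intro length_form_lin) (auto simp: a xs)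
  define z where "z = \<alpha> * (y + dotl g ys)"
  have "map2 (\<lambda>y c. y - z * c) (map2 (\<lambda>y c. y + z * c) (form_lin F ys) g) g = form_lin F ys"
    by (rule nth_equalityI) (use len Cons.prems in \<open>auto simp: a\<close>)
  moreover have "z\<^sup>2 / \<alpha> = \<alpha> * (y + dotl g ys)\<^sup>2"
    using Cons.prems by (simp add: z_def a power2_eq_square field_simps)
  ultimately show ?case using Cons by (simp add: a xs Let_def flip: z_def)
qed simp

lemma has_sum_lists_Suc:
  "(f has_sum S) {n :: 'b list. length n = Suc k} \<longleftrightarrow>
     ((\<lambda>(n0, n'). f (n0 # n')) has_sum S) (UNIV \<times> {n. length n = k})"
  by (rule has_sum_reindex_bij_witness[of _ "\<lambda>(n0, n'). n0 # n'" "\<lambda>n. (hd n, tl n)"])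
     (auto simp: length_Suc_conv)

lemma summable_on_lists_Suc:
  "f summable_on {n :: 'b list. length n = Suc k} \<longleftrightarrow>
     (\<lambda>(n0, n'). f (n0 # n')) summable_on (UNIV \<times> {n. length n = k})"
  using has_sum_lists_Suc unfolding summable_on_def by blast

lemma infsum_lists_Suc:
  "infsum f {n :: 'b list. length n = Suc k} = infsum (\<lambda>(n0, n'). f (n0 # n')) (UNIV \<times> {n. length n = k})"
  using has_sum_lists_Suc[of f k] summable_on_lists_Suc[of f k]
  by (metis (no_types, lifting) has_sum_infsum infsumI infsum_not_exists)

lemma dotl_add_scaled:
  "length bs = length v \<Longrightarrow> length g = length v \<Longrightarrow> dotl (map2 (\<lambda>b c. b + s * c) bs g) v = dotl bs v + s * dotl g v"
proof (induction v arbitrary: bs g)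
  case (Cons a v)
  then obtain b bs' c g' where "bs = b # bs'" "g = c # g'" by (metis length_Suc_conv)
  thus ?case using Cons by (simp add: algebra_simps)
qed simp

lemma infsum_complex_of_real:
  "f summable_on A \<Longrightarrow> infsum (\<lambda>x. complex_of_real (f x)) A = of_real (infsum f A)"
  by (intro infsumI has_sum_of_real has_sum_infsum)

text \<open>By Poisson summation the shifted Gaussian sum is a Fourier series with positive
  coefficients, hence largest at shift 0. Uniformity in \<open>x\<close> is what makes the iterated
  sums in several variables summable.\<close>

lemma gauss_int_infsum_le:
  fixes a x :: real
  assumes a: "a > 0"
  shows "(\<Sum>\<^sub>\<infinity>n::int. exp (- pi * a * (of_int n + x)\<^sup>2)) \<le> (\<Sum>\<^sub>\<infinity>m::int. exp (- pi * (of_int m)\<^sup>2 / a) / sqrt a)"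
proof -
  have summ: "(\<lambda>m::int. exp (- pi * (of_int m)\<^sup>2 / a) / sqrt a) summable_on UNIV"
  proof -
    have "(\<lambda>m::int. exp (- pi * (1/a) * (of_int m + 0)\<^sup>2) * (1 / sqrt a)) summable_on UNIV"
      by (intro summable_on_cmult_left gauss_summable_int) (use a in auto)
    thus ?thesis by simp
  qed
  let ?f = "\<lambda>m::int. (exp (- pi * (of_int m)\<^sup>2 / a) / sqrt a) *\<^sub>R cis (2 * pi * of_int m * x)"
  have "(\<Sum>\<^sub>\<infinity>n::int. complex_of_real (exp (- pi * a * (of_int n + x)\<^sup>2))) = infsum ?f UNIV"
    using poisson_gauss_1d[OF a, of x 0] by (simp add: scaleR_conv_of_real)
  hence eq: "complex_of_real (\<Sum>\<^sub>\<infinity>n::int. exp (- pi * a * (of_int n + x)\<^sup>2)) = infsum ?f UNIV"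
    by (simp only: infsum_complex_of_real[OF gauss_summable_int[OF a]])
  have "\<bar>\<Sum>\<^sub>\<infinity>n::int. exp (- pi * a * (of_int n + x)\<^sup>2)\<bar> = norm (infsum ?f UNIV)"
    by (simp only: eq[symmetric] norm_of_real)
  moreover have "norm (infsum ?f UNIV) \<le> (\<Sum>\<^sub>\<infinity>m::int. norm (?f m))"
    by (rule norm_infsum_bound) (use summ a in simp)
  moreover have "(\<Sum>\<^sub>\<infinity>m::int. norm (?f m)) = (\<Sum>\<^sub>\<infinity>m::int. exp (- pi * (of_int m)\<^sup>2 / a) / sqrt a)" using a by simp
  ultimately show ?thesis by linarith
qed

text \<open>Induction on the number of variables. For a fixed tail, one-dimensional Poisson
  summation is applied to the head, whose shift depends linearly on the tail; the resulting phase is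
  absorbed into the frequency of the tail sum, to which the induction hypothesis applies. Absolute
  summability on both sides is carried along to justify exchanging the sums.\<close>

theorem poisson_form:
  assumes "form_ok F" "length x = length F" "length b = length F"
  defines "Z \<equiv> {n :: int list. length n = length F}"
  shows "(\<lambda>n. exp (- pi * form F (shift_plus n x))) summable_on Z"
    and "(\<lambda>m. exp (- pi * dual_form F (shift_minus m b))) summable_on Z"
    and "(\<Sum>\<^sub>\<infinity>n\<in>Z. exp (- pi * form F (shift_plus n x)) *\<^sub>R cis (2 * pi * dotl b (shift_plus n x)))
       = (\<Sum>\<^sub>\<infinity>m\<in>Z. (form_const F * exp (- pi * dual_form F (shift_minus m b))) *\<^sub>R cis (2 * pi * dotl (map of_int m) x))"
proof -
  have "(\<lambda>n. exp (- pi * form F (shift_plus n x))) summable_on Z \<and>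
    (\<lambda>m. exp (- pi * dual_form F (shift_minus m b))) summable_on Z \<and>
    (\<Sum>\<^sub>\<infinity>n\<in>Z. exp (- pi * form F (shift_plus n x)) *\<^sub>R cis (2 * pi * dotl b (shift_plus n x)))
       = (\<Sum>\<^sub>\<infinity>m\<in>Z. (form_const F * exp (- pi * dual_form F (shift_minus m b))) *\<^sub>R cis (2 * pi * dotl (map of_int m) x))"
    using assms(1-3) unfolding Z_def
  proof (induction F arbitrary: x b)
    case Nil
    thus ?case by simp
  next
    case (Cons a F)
    obtain \<alpha> g where a: "a = (\<alpha>, g)" by force
    obtain x0 xs where x: "x = x0 # xs" using Cons.prems by (cases x) auto
    obtain b0 bs where b: "b = b0 # bs" using Cons.prems by (cases b) auto
    have ok: "form_ok F" "\<alpha> > 0" "length g = length F" "length xs = length F" "length bs = length F"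
      using Cons.prems by (auto simp: a x b)
    let ?Z = "{n :: int list. length n = length F}"
    define c where "c = form_const F"
    have c: "c > 0" using form_const_pos[OF ok(1)] by (simp add: c_def)
    define E where "E = (\<lambda>n'. exp (- pi * form F (shift_plus n' xs)))"
    define X where "X = (\<lambda>n'. x0 + dotl g (shift_plus n' xs))"
    define C where "C = (\<lambda>m0::int. exp (- pi * (of_int m0 - b0)\<^sup>2 / \<alpha>) / sqrt \<alpha>)"
    \<comment> \<open>The frequency that the tail inherits once the head variable is replaced by its
      dual \<open>m0\<close>.\<close>
    define b' where "b' = (\<lambda>m0::int. map2 (\<lambda>b c. b + (of_int m0 - b0) * c) bs g)"
    have b'len: "length (b' m0) = length F" for m0 using ok by (simp add: b'_def)
    note IH = Cons.IH[OF ok(1)]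
    have sE: "E summable_on ?Z" unfolding E_def using IH[of xs bs] ok by blast
    have sC: "C summable_on UNIV"
    proof -
      have "(\<lambda>m::int. exp (- pi * (1/\<alpha>) * (of_int m + - b0)\<^sup>2) * (1 / sqrt \<alpha>)) summable_on UNIV"
        by (intro summable_on_cmult_left gauss_summable_int) (use ok in auto)
      thus ?thesis by (simp add: C_def)
    qed
    have C0: "C m \<ge> 0" for m using ok by (simp add: C_def)
    have E0: "E m \<ge> 0" for m by (simp add: E_def)
    have fcons: "form (a # F) (shift_plus (n0 # n') x) = \<alpha> * (of_int n0 + X n')\<^sup>2 + form F (shift_plus n' xs)" for n0 n'
      by (simp add: a x X_def add_ac)
    have dcons: "dual_form (a # F) (shift_minus (m0 # m') b) = (of_int m0 - b0)\<^sup>2 / \<alpha> + dual_form F (shift_minus m' (b' m0))"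
      if "m' \<in> ?Z" for m0 m'
    proof -
      have "map2 (\<lambda>y c. y - (real_of_int m0 - b0) * c) (shift_minus m' bs) g = shift_minus m' (b' m0)"
        by (rule nth_equalityI) (use ok that in \<open>auto simp: b'_def shift_minus_def algebra_simps\<close>)
      thus ?thesis by (simp add: a b)
    qed
    define G where "G = (\<lambda>(n0::int) n'. exp (- pi * \<alpha> * (of_int n0 + X n')\<^sup>2))"
    have sG: "(\<lambda>n0. G n0 n') summable_on UNIV" for n'
      unfolding G_def using gauss_summable_int[OF ok(2)] .
    define K where "K = (\<Sum>\<^sub>\<infinity>m::int. exp (- pi * (of_int m)\<^sup>2 / \<alpha>) / sqrt \<alpha>)"
    have Kb: "(\<Sum>\<^sub>\<infinity>n0. G n0 n') \<le> K" for n' unfolding G_def K_def by (rule gauss_int_infsum_le[OF ok(2)])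
    have S1': "(\<lambda>(n', n0). G n0 n' * E n') summable_on (?Z \<times> UNIV)"
    proof (rule summable_on_SigmaI)
      show "((\<lambda>n0. case (n', n0) of (n', n0) \<Rightarrow> G n0 n' * E n') has_sum (\<Sum>\<^sub>\<infinity>n0. G n0 n') * E n') UNIV" for n'
        unfolding prod.case by (intro has_sum_cmult_left has_sum_infsum sG)
      show "(\<lambda>n'. (\<Sum>\<^sub>\<infinity>n0. G n0 n') * E n') summable_on ?Z"
      proof (rule summable_on_comparison_test)
        show "(\<lambda>n'. K * E n') summable_on ?Z" by (intro summable_on_cmult_right sE)
        show "(\<Sum>\<^sub>\<infinity>n0. G n0 n') * E n' \<le> K * E n'" for n' by (intro mult_right_mono Kb E0)
        show "0 \<le> (\<Sum>\<^sub>\<infinity>n0. G n0 n') * E n'" for n'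
          by (intro mult_nonneg_nonneg infsum_nonneg E0) (simp add: G_def)
      qed
    qed (auto simp: G_def E_def)
    hence S1: "(\<lambda>n. exp (- pi * form (a # F) (shift_plus n x))) summable_on {n :: int list. length n = Suc (length F)}"
      unfolding summable_on_lists_Suc
      by (subst summable_on_swap, elim summable_on_cong[THEN iffD1, rotated])
         (auto simp: fcons G_def E_def exp_add[symmetric] algebra_simps)
    define H where "H = (\<lambda>m0 m'. exp (- pi * dual_form F (shift_minus m' (b' m0))))"
    have sH: "H m0 summable_on ?Z" for m0
      using IH[of xs "b' m0"] b'len ok unfolding H_def by blast
    \<comment> \<open>At shift 0 all terms on the dual side are positive, while on the original side
      the frequency enters through unimodular factors only. Hence this bound is independent of
      \<open>m0\<close>.\<close>
    define Kd where "Kd = (\<Sum>\<^sub>\<infinity>n\<in>?Z. exp (- pi * form F (shift_plus n (replicate (length F) 0)))) / c"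
    have Hb: "(\<Sum>\<^sub>\<infinity>m'\<in>?Z. H m0 m') \<le> Kd" for m0
    proof -
      let ?o = "replicate (length F) (0::real)"
      have d0: "dotl v ?o = 0" for v
      proof -
        have "dotl v (replicate n 0) = 0" for n
        proof (induction n arbitrary: v)
          case (Suc n) thus ?case by (cases v) auto
        next
          case 0 thus ?case by (cases v) auto
        qed
        thus ?thesis .
      qed
      have IH1: "(\<lambda>n. exp (- pi * form F (shift_plus n ?o))) summable_on ?Z"
        using IH[of ?o "b' m0"] b'len by simp
      have IH2: "(\<Sum>\<^sub>\<infinity>n\<in>?Z. exp (- pi * form F (shift_plus n ?o)) *\<^sub>R cis (2 * pi * dotl (b' m0) (shift_plus n ?o)))
       = (\<Sum>\<^sub>\<infinity>m\<in>?Z. (c * H m0 m) *\<^sub>R cis (2 * pi * dotl (map of_int m) ?o))"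
        using IH[of ?o "b' m0"] b'len unfolding H_def c_def by simp
      have "(\<Sum>\<^sub>\<infinity>m\<in>?Z. (c * H m0 m) *\<^sub>R cis (2 * pi * dotl (map of_int m) ?o)) = (\<Sum>\<^sub>\<infinity>m\<in>?Z. complex_of_real (c * H m0 m))"
        by (simp add: d0 scaleR_conv_of_real)
      also have "\<dots> = complex_of_real (c * (\<Sum>\<^sub>\<infinity>m\<in>?Z. H m0 m))"
        by (simp only: infsum_complex_of_real[OF summable_on_cmult_right[OF sH]] infsum_cmult_right[OF sH])
      finally have eq: "(\<Sum>\<^sub>\<infinity>m\<in>?Z. (c * H m0 m) *\<^sub>R cis (2 * pi * dotl (map of_int m) ?o)) = complex_of_real (c * (\<Sum>\<^sub>\<infinity>m\<in>?Z. H m0 m))" .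
      have "c * (\<Sum>\<^sub>\<infinity>m\<in>?Z. H m0 m) \<le> norm (\<Sum>\<^sub>\<infinity>n\<in>?Z. exp (- pi * form F (shift_plus n ?o)) *\<^sub>R cis (2 * pi * dotl (b' m0) (shift_plus n ?o)))"
        unfolding IH2 eq norm_of_real by (rule abs_ge_self)
      also have "\<dots> \<le> (\<Sum>\<^sub>\<infinity>n\<in>?Z. norm (exp (- pi * form F (shift_plus n ?o)) *\<^sub>R cis (2 * pi * dotl (b' m0) (shift_plus n ?o))))"
        by (rule norm_infsum_bound) (use IH1 in simp)
      also have "\<dots> = Kd * c" using c by (simp add: Kd_def)
      finally show ?thesis using c by (simp add: mult_ac)
    qed
    have S2': "(\<lambda>(m0, m'). C m0 * H m0 m') summable_on (UNIV \<times> ?Z)"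
    proof (rule summable_on_SigmaI)
      show "((\<lambda>m'. case (m0, m') of (m0, m') \<Rightarrow> C m0 * H m0 m') has_sum C m0 * (\<Sum>\<^sub>\<infinity>m'\<in>?Z. H m0 m')) ?Z" for m0
        unfolding prod.case by (intro has_sum_cmult_right has_sum_infsum sH)
      show "(\<lambda>m0. C m0 * (\<Sum>\<^sub>\<infinity>m'\<in>?Z. H m0 m')) summable_on UNIV"
      proof (rule summable_on_comparison_test)
        show "(\<lambda>m0. C m0 * Kd) summable_on UNIV" by (intro summable_on_cmult_left sC)
        show "C m0 * (\<Sum>\<^sub>\<infinity>m'\<in>?Z. H m0 m') \<le> C m0 * Kd" for m0 by (intro mult_left_mono Hb C0)
        show "0 \<le> C m0 * (\<Sum>\<^sub>\<infinity>m'\<in>?Z. H m0 m')" for m0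
          by (intro mult_nonneg_nonneg infsum_nonneg C0) (simp add: H_def)
      qed
    qed (use C0 in \<open>auto simp: H_def\<close>)
    have Sd: "exp (- pi * dual_form (a # F) (shift_minus (m0 # m') b)) = sqrt \<alpha> * (C m0 * H m0 m')" if "m' \<in> ?Z" for m0 m'
      using ok that by (simp add: dcons C_def H_def exp_add[symmetric] algebra_simps)
    have S2: "(\<lambda>n. exp (- pi * dual_form (a # F) (shift_minus n b))) summable_on {n :: int list. length n = Suc (length F)}"
      unfolding summable_on_lists_Suc
      by (rule summable_on_cong[THEN iffD1, OF _ summable_on_cmult_right[OF S2', of "sqrt \<alpha>"]]) (clarify, simp only: prod.case Sd mem_Collect_eq)

    \<comment> \<open>Terms of the mixed double sum: the head is already dual, the tail still
      original.\<close>
    define T where "T = (\<lambda>m0 n'. (C m0 *\<^sub>R cis (2 * pi * of_int m0 * x0)) * (E n' *\<^sub>R cis (2 * pi * dotl (b' m0) (shift_plus n' xs))))"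
    have dsplit: "dotl (b' m0) (shift_plus n' xs) = dotl bs (shift_plus n' xs) + (of_int m0 - b0) * dotl g (shift_plus n' xs)"
      if "n' \<in> ?Z" for m0 n'
      unfolding b'_def using ok that by (intro dotl_add_scaled) auto
    let ?t = "\<lambda>n. exp (- pi * form (a # F) (shift_plus n x)) *\<^sub>R cis (2 * pi * dotl b (shift_plus n x))"
    have t_eq: "?t (n0 # n') = (exp (- pi * \<alpha> * (of_int n0 + X n')\<^sup>2) *\<^sub>R cis (2 * pi * b0 * (of_int n0 + X n'))) *
        (E n' *\<^sub>R cis (2 * pi * (dotl bs (shift_plus n' xs) - b0 * dotl g (shift_plus n' xs))))" for n0 n'
    proof -
      have "exp (- pi * form (a # F) (shift_plus (n0 # n') x)) = exp (- pi * \<alpha> * (of_int n0 + X n')\<^sup>2) * E n'"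
        by (simp only: fcons E_def exp_add[symmetric]) (simp add: algebra_simps)
      moreover have "2 * pi * dotl b (shift_plus (n0 # n') x) = 2 * pi * b0 * (of_int n0 + X n') +
          2 * pi * (dotl bs (shift_plus n' xs) - b0 * dotl g (shift_plus n' xs))"
        by (simp add: b x X_def algebra_simps)
      ultimately show ?thesis by (simp add: cis_mult)
    qed
    have sumt: "(\<lambda>(n0, n'). ?t (n0 # n')) summable_on (UNIV \<times> ?Z)"
      by (rule abs_summable_summable) (use S1 in \<open>simp add: summable_on_lists_Suc case_prod_unfold\<close>)
    have sumT: "(\<lambda>(m0, n'). T m0 n') summable_on (UNIV \<times> ?Z)"
    proof (rule abs_summable_summable)
      have "(\<lambda>(m0, n'). C m0 * E n') summable_on (UNIV \<times> ?Z)"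
      proof (rule summable_on_SigmaI)
        show "((\<lambda>n'. case (m0, n') of (m0, n') \<Rightarrow> C m0 * E n') has_sum C m0 * (\<Sum>\<^sub>\<infinity>n'\<in>?Z. E n')) ?Z" for m0
          unfolding prod.case by (intro has_sum_cmult_right has_sum_infsum sE)
        show "(\<lambda>m0. C m0 * (\<Sum>\<^sub>\<infinity>n'\<in>?Z. E n')) summable_on UNIV" by (intro summable_on_cmult_left sC)
      qed (use C0 E0 in auto)
      moreover have "norm (case p of (m0, n') \<Rightarrow> T m0 n') = (case p of (m0, n') \<Rightarrow> C m0 * E n')" for p
        by (auto simp: T_def norm_mult C0 E0 split: prod.splits)
      ultimately show "(\<lambda>p. norm (case p of (m0, n') \<Rightarrow> T m0 n')) summable_on (UNIV \<times> ?Z)" by simp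
    qed
    have inner: "(\<Sum>\<^sub>\<infinity>n0. ?t (n0 # n')) = (\<Sum>\<^sub>\<infinity>m0. T m0 n')" if n': "n' \<in> ?Z" for n'
    proof -
      let ?u = "E n' *\<^sub>R cis (2 * pi * (dotl bs (shift_plus n' xs) - b0 * dotl g (shift_plus n' xs)))"
      have "(\<Sum>\<^sub>\<infinity>n0. ?t (n0 # n')) = (\<Sum>\<^sub>\<infinity>n0::int. exp (- pi * \<alpha> * (of_int n0 + X n')\<^sup>2) *\<^sub>R cis (2 * pi * b0 * (of_int n0 + X n'))) * ?u"
        unfolding t_eq
        by (rule infsum_cmult_left, rule abs_summable_summable) (use gauss_summable_int[OF ok(2)] in simp)
      also have "\<dots> = (\<Sum>\<^sub>\<infinity>m0::int. C m0 *\<^sub>R cis (2 * pi * of_int m0 * X n')) * ?u"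
        by (subst poisson_gauss_1d[OF ok(2)]) (simp add: C_def)
      also have "\<dots> = (\<Sum>\<^sub>\<infinity>m0::int. (C m0 *\<^sub>R cis (2 * pi * of_int m0 * X n')) * ?u)"
        by (rule infsum_cmult_left[symmetric], rule abs_summable_summable) (use sC C0 in simp)
      also have "\<dots> = (\<Sum>\<^sub>\<infinity>m0. T m0 n')"
      proof (rule infsum_cong)
        fix m0 :: int
        have "2 * pi * of_int m0 * X n' + 2 * pi * (dotl bs (shift_plus n' xs) - b0 * dotl g (shift_plus n' xs))
            = 2 * pi * of_int m0 * x0 + 2 * pi * dotl (b' m0) (shift_plus n' xs)"
          unfolding dsplit[OF n'] X_def by (simp add: algebra_simps)
        thus "(C m0 *\<^sub>R cis (2 * pi * of_int m0 * X n')) * ?u = T m0 n'"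
          unfolding T_def by (simp add: cis_mult)
      qed
      finally show ?thesis .
    qed
    have sumt': "(\<lambda>(n', n0). ?t (n0 # n')) summable_on (?Z \<times> UNIV)"
      using sumt by (subst (asm) summable_on_swap) (simp add: case_prod_unfold)
    have sumT': "(\<lambda>(n', m0). T m0 n') summable_on (?Z \<times> UNIV)"
      using sumT by (subst (asm) summable_on_swap) (simp add: case_prod_unfold)
    have "infsum ?t {n :: int list. length n = Suc (length F)} = (\<Sum>\<^sub>\<infinity>n'\<in>?Z. \<Sum>\<^sub>\<infinity>n0. ?t (n0 # n'))"
      unfolding infsum_lists_Suc using infsum_swap_banach[OF sumt] infsum_Sigma'_banach[OF sumt] by simp
    also have "\<dots> = (\<Sum>\<^sub>\<infinity>n'\<in>?Z. \<Sum>\<^sub>\<infinity>m0. T m0 n')" by (rule infsum_cong) (rule inner)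
    also have "\<dots> = (\<Sum>\<^sub>\<infinity>m0. \<Sum>\<^sub>\<infinity>n'\<in>?Z. T m0 n')"
      using infsum_swap_banach[OF sumT] by simp
    also have "\<dots> = (\<Sum>\<^sub>\<infinity>m0. \<Sum>\<^sub>\<infinity>m'\<in>?Z. (C m0 *\<^sub>R cis (2 * pi * of_int m0 * x0)) * ((c * H m0 m') *\<^sub>R cis (2 * pi * dotl (map of_int m') xs)))"
    proof (rule infsum_cong)
      fix m0 :: int
      have "(\<Sum>\<^sub>\<infinity>n'\<in>?Z. T m0 n') = (C m0 *\<^sub>R cis (2 * pi * of_int m0 * x0)) * (\<Sum>\<^sub>\<infinity>n'\<in>?Z. E n' *\<^sub>R cis (2 * pi * dotl (b' m0) (shift_plus n' xs)))"
        unfolding T_def by (rule infsum_cmult_right, rule abs_summable_summable) (use sE E0 in simp)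
      also have "(\<Sum>\<^sub>\<infinity>n'\<in>?Z. E n' *\<^sub>R cis (2 * pi * dotl (b' m0) (shift_plus n' xs))) = (\<Sum>\<^sub>\<infinity>m'\<in>?Z. (c * H m0 m') *\<^sub>R cis (2 * pi * dotl (map of_int m') xs))"
        unfolding E_def H_def c_def using IH[of xs "b' m0"] ok b'len by blast
      also have "(C m0 *\<^sub>R cis (2 * pi * of_int m0 * x0)) * \<dots> = (\<Sum>\<^sub>\<infinity>m'\<in>?Z. (C m0 *\<^sub>R cis (2 * pi * of_int m0 * x0)) * ((c * H m0 m') *\<^sub>R cis (2 * pi * dotl (map of_int m') xs)))"
        by (rule infsum_cmult_right[symmetric], rule abs_summable_summable)
           (use sH c in \<open>simp add: H_def summable_on_cmult_right\<close>)
      finally show "(\<Sum>\<^sub>\<infinity>n'\<in>?Z. T m0 n') = (\<Sum>\<^sub>\<infinity>m'\<in>?Z. (C m0 *\<^sub>R cis (2 * pi * of_int m0 * x0)) * ((c * H m0 m') *\<^sub>R cis (2 * pi * dotl (map of_int m') xs)))" .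
    qed
    also have "\<dots> = (\<Sum>\<^sub>\<infinity>m0. \<Sum>\<^sub>\<infinity>m'\<in>?Z. (form_const (a # F) * exp (- pi * dual_form (a # F) (shift_minus (m0 # m') b))) *\<^sub>R cis (2 * pi * dotl (map of_int (m0 # m')) x))"
    proof (intro infsum_cong)
      fix m0 :: int and m' assume m': "m' \<in> ?Z"
      have "(C m0 *\<^sub>R cis (2 * pi * of_int m0 * x0)) * ((c * H m0 m') *\<^sub>R cis (2 * pi * dotl (map of_int m') xs))
        = (C m0 * (c * H m0 m')) *\<^sub>R cis (2 * pi * dotl (map of_int (m0 # m')) x)"
        by (simp add: x cis_mult algebra_simps)
      also have "C m0 * (c * H m0 m') = form_const (a # F) * exp (- pi * dual_form (a # F) (shift_minus (m0 # m') b))"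
        unfolding Sd[OF m'] using ok by (simp add: a c_def)
      finally show "(C m0 *\<^sub>R cis (2 * pi * of_int m0 * x0)) * ((c * H m0 m') *\<^sub>R cis (2 * pi * dotl (map of_int m') xs)) =
        (form_const (a # F) * exp (- pi * dual_form (a # F) (shift_minus (m0 # m') b))) *\<^sub>R cis (2 * pi * dotl (map of_int (m0 # m')) x)" .
    qed
    also have "\<dots> = infsum (\<lambda>m. (form_const (a # F) * exp (- pi * dual_form (a # F) (shift_minus m b))) *\<^sub>R cis (2 * pi * dotl (map of_int m) x)) {n :: int list. length n = Suc (length F)}"
    proof -
      have "(\<lambda>m. (form_const (a # F) * exp (- pi * dual_form (a # F) (shift_minus m b))) *\<^sub>R cis (2 * pi * dotl (map of_int m) x)) summable_on {n :: int list. length n = Suc (length F)}"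
      proof (rule abs_summable_summable)
        have "(\<lambda>m. \<bar>form_const (a # F)\<bar> * exp (- pi * dual_form (a # F) (shift_minus m b))) summable_on {n :: int list. length n = Suc (length F)}"
          by (intro summable_on_cmult_right S2)
        thus "(\<lambda>m. norm ((form_const (a # F) * exp (- pi * dual_form (a # F) (shift_minus m b))) *\<^sub>R cis (2 * pi * dotl (map of_int m) x))) summable_on {n :: int list. length n = Suc (length F)}"
          by (simp add: abs_mult)
      qed
      hence "(\<lambda>(m0, m'). (form_const (a # F) * exp (- pi * dual_form (a # F) (shift_minus (m0 # m') b))) *\<^sub>R cis (2 * pi * dotl (map of_int (m0 # m')) x)) summable_on UNIV \<times> ?Z"
        by (simp only: summable_on_lists_Suc)
      from infsum_Sigma'_banach[OF this] show ?thesis unfolding infsum_lists_Suc .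
    qed
    finally have S3: "infsum ?t {n :: int list. length n = Suc (length F)} = infsum (\<lambda>m. (form_const (a # F) * exp (- pi * dual_form (a # F) (shift_minus m b))) *\<^sub>R cis (2 * pi * dotl (map of_int m) x)) {n :: int list. length n = Suc (length F)}" .
    show ?case using S1 S2 S3 by simp
  qed
  thus "(\<lambda>n. exp (- pi * form F (shift_plus n x))) summable_on Z"
    "(\<lambda>m. exp (- pi * dual_form F (shift_minus m b))) summable_on Z"
    "(\<Sum>\<^sub>\<infinity>n\<in>Z. exp (- pi * form F (shift_plus n x)) *\<^sub>R cis (2 * pi * dotl b (shift_plus n x)))
       = (\<Sum>\<^sub>\<infinity>m\<in>Z. (form_const F * exp (- pi * dual_form F (shift_minus m b))) *\<^sub>R cis (2 * pi * dotl (map of_int m) x))"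
    by blast+
qed

text \<open>Positivity is required on integer vectors only: the induction clears the single denominator that
  appears when one variable is eliminated.\<close>

lemma lagrange_form_exists:
  fixes A :: "nat \<Rightarrow> nat \<Rightarrow> rat"
  assumes sym: "\<And>i j. A i j = A j i"
    and pos: "\<And>y :: nat \<Rightarrow> int. \<exists>i<k. y i \<noteq> 0 \<Longrightarrow> 0 < (\<Sum>i<k. \<Sum>j<k. of_int (y i) * A i j * of_int (y j))"
  shows "\<exists>F. form_ok F \<and> length F = k \<and>
    (\<forall>xs. length xs = k \<longrightarrow> form_lin F xs = map (\<lambda>i. \<Sum>j<k. of_rat (A i j) * xs ! j) [0..<k]) \<and>
    (\<forall>xs. length xs = k \<longrightarrow> form F xs = (\<Sum>i<k. \<Sum>j<k. xs ! i * of_rat (A i j) * xs ! j))"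
  using assms
proof (induction k arbitrary: A)
  case 0
  show ?case by (intro exI[of _ "[]"]) auto
next
  case (Suc k)
  define \<alpha> where "\<alpha> = A 0 0"
  have "0 < (\<Sum>i<Suc k. \<Sum>j<Suc k. of_int (if i = 0 then 1 else 0) * A i j * of_int (if j = 0 then 1 else 0))"
    using Suc.prems(2)[of "\<lambda>i. if i = 0 then 1 else 0"] by auto
  hence \<alpha>: "\<alpha> > 0" by (simp add: sum.lessThan_Suc_shift \<alpha>_def del: sum.lessThan_Suc)
  define A' where "A' = (\<lambda>i j. A (Suc i) (Suc j) - A 0 (Suc i) * A 0 (Suc j) / \<alpha>)"
  define \<gamma> where "\<gamma> = (\<lambda>j. A 0 (Suc j) / \<alpha>)"
  have A_A': "A (Suc i) (Suc j) = A' i j + \<alpha> * \<gamma> i * \<gamma> j" "A 0 (Suc i) = \<alpha> * \<gamma> i" "A (Suc i) 0 = \<alpha> * \<gamma> i" for i j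
    using \<alpha> Suc.prems(1)[of "Suc i" 0] by (simp_all add: A'_def \<gamma>_def field_simps)
  have split: "(\<Sum>i<Suc k. \<Sum>j<Suc k. x i * f (A i j) * x j)
      = f \<alpha> * (x 0 + (\<Sum>j<k. f (\<gamma> j) * x (Suc j)))\<^sup>2 + (\<Sum>i<k. \<Sum>j<k. x (Suc i) * f (A' i j) * x (Suc j))"
    if f: "\<And>a b. f (a * b) = f a * f b" "\<And>a b. f (a + b) = f a + f b" for f :: "rat \<Rightarrow> 'b :: field_char_0" and x
  proof -
    define s where "s = (\<Sum>j<k. f (\<gamma> j) * x (Suc j))"
    have s2: "(\<Sum>i<k. \<Sum>j<k. x (Suc i) * (f \<alpha> * f (\<gamma> i) * f (\<gamma> j)) * x (Suc j)) = f \<alpha> * (s * s)"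
    proof -
      have "s * s = (\<Sum>i<k. \<Sum>j<k. (f (\<gamma> i) * x (Suc i)) * (f (\<gamma> j) * x (Suc j)))"
        unfolding s_def by (rule sum_product)
      thus ?thesis by (simp add: sum_distrib_left mult_ac)
    qed
    have s1: "(\<Sum>j<k. x 0 * (f \<alpha> * f (\<gamma> j)) * x (Suc j)) = f \<alpha> * x 0 * s" "(\<Sum>i<k. x (Suc i) * (f \<alpha> * f (\<gamma> i)) * x 0) = f \<alpha> * x 0 * s"
      unfolding s_def sum_distrib_left by (intro sum.cong refl; simp add: mult_ac)+
    show ?thesis
      unfolding sum.lessThan_Suc_shift A_A' f distrib_left distrib_right sum.distrib s1 s2 s_def[symmetric] \<alpha>_def[symmetric]
      by (simp add: power2_eq_square algebra_simps)
  qed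
  have pos': "0 < (\<Sum>i<k. \<Sum>j<k. of_int (y i) * A' i j * of_int (y j))" if y: "\<exists>i<k. y i \<noteq> 0" for y :: "nat \<Rightarrow> int"
  proof -
    define r where "r = - (\<Sum>j<k. \<gamma> j * of_int (y j))"
    obtain a d where ad: "quotient_of r = (a, d)" by force
    have d: "d > 0" and r: "r = of_int a / of_int d" using quotient_of_denom_pos[OF ad] quotient_of_div[OF ad] by auto
    \<comment> \<open>This integer vector makes the completed square vanish, which leaves
      \<open>d\<^sup>2\<close> times the reduced form at \<open>y\<close>.\<close>
    define x where "x = (\<lambda>i. case i of 0 \<Rightarrow> a | Suc j \<Rightarrow> d * y j)"
    have "0 < (\<Sum>i<Suc k. \<Sum>j<Suc k. of_int (x i) * A i j * of_int (x j))"
      by (rule Suc.prems(2)) (use y d in \<open>force simp: x_def\<close>)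
    also have "\<dots> = \<alpha> * (of_int (x 0) + (\<Sum>j<k. \<gamma> j * of_int (x (Suc j))))\<^sup>2 + (\<Sum>i<k. \<Sum>j<k. of_int (x (Suc i)) * A' i j * of_int (x (Suc j)))"
      by (rule split[of "\<lambda>x. x"]) auto
    also have "of_int (x 0) + (\<Sum>j<k. \<gamma> j * of_int (x (Suc j))) = 0"
    proof -
      have "of_int a = of_int d * r" using d r by simp
      moreover have "(\<Sum>j<k. \<gamma> j * of_int (x (Suc j))) = of_int d * (\<Sum>j<k. \<gamma> j * of_int (y j))"
        by (simp add: x_def sum_distrib_left mult_ac)
      ultimately show ?thesis by (simp add: x_def r_def)
    qed
    also have "(\<Sum>i<k. \<Sum>j<k. of_int (x (Suc i)) * A' i j * of_int (x (Suc j))) = (of_int d)\<^sup>2 * (\<Sum>i<k. \<Sum>j<k. of_int (y i) * A' i j * of_int (y j))"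
      by (simp add: x_def sum_distrib_left power2_eq_square mult_ac)
    finally show ?thesis using d by (simp add: zero_less_mult_iff)
  qed
  have sym': "A' i j = A' j i" for i j unfolding A'_def using Suc.prems(1)[of "Suc i" "Suc j"] by (simp add: mult.commute)
  from Suc.IH[of A', OF sym' pos'] obtain F where F: "form_ok F" "length F = k"
    "\<And>xs. length xs = k \<Longrightarrow> form_lin F xs = map (\<lambda>i. \<Sum>j<k. of_rat (A' i j) * xs ! j) [0..<k]"
    "\<And>xs. length xs = k \<Longrightarrow> form F xs = (\<Sum>i<k. \<Sum>j<k. xs ! i * of_rat (A' i j) * xs ! j)"
    by blast
  define g where "g = map (\<lambda>j. real_of_rat (\<gamma> j)) [0..<k]"
  have dotg: "dotl g xs = (\<Sum>j<k. of_rat (\<gamma> j) * xs ! j)" if "length xs = k" for xs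
  proof -
    have "dotl (map f [0..<length xs]) xs = (\<Sum>j<length xs. f j * xs ! j)" for f
    proof (induction xs arbitrary: f)
      case (Cons a xs)
      have "map f [0..<length (a # xs)] = f 0 # map (\<lambda>j. f (Suc j)) [0..<length xs]"
        by (rule nth_equalityI) (auto simp: nth_Cons simp del: upt_Suc split: nat.splits)
      thus ?case using Cons.IH[of "\<lambda>j. f (Suc j)"]
        by (simp add: sum.lessThan_Suc_shift del: sum.lessThan_Suc upt_Suc)
    qed simp
    thus ?thesis unfolding g_def using that by auto
  qed
  show ?case
  proof (intro exI[of _ "(of_rat \<alpha>, g) # F"] conjI allI impI)
    show "form_ok ((of_rat \<alpha>, g) # F)" using F \<alpha> by (simp add: g_def)
    show "length ((real_of_rat \<alpha>, g) # F) = Suc k" using F by simp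
    fix xs :: "real list" assume "length xs = Suc k"
    then obtain x0 ys where xs: "xs = x0 # ys" "length ys = k" by (cases xs) auto
    have "(\<Sum>i<Suc k. \<Sum>j<Suc k. xs ! i * of_rat (A i j) * xs ! j) = of_rat \<alpha> * (xs ! 0 + (\<Sum>j<k. of_rat (\<gamma> j) * xs ! Suc j))\<^sup>2
       + (\<Sum>i<k. \<Sum>j<k. xs ! Suc i * of_rat (A' i j) * xs ! Suc j)"
      by (rule split) (auto simp: of_rat_mult of_rat_add)
    thus "form ((of_rat \<alpha>, g) # F) xs = (\<Sum>i<Suc k. \<Sum>j<Suc k. xs ! i * of_rat (A i j) * xs ! j)"
      using F(4) dotg xs by simp
    define z where "z = real_of_rat \<alpha> * (x0 + dotl g ys)"
    have lin: "form_lin ((of_rat \<alpha>, g) # F) xs = z # map2 (\<lambda>y c. y + z * c) (form_lin F ys) g"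
      by (simp add: xs Let_def z_def)
    show "form_lin ((of_rat \<alpha>, g) # F) xs = map (\<lambda>i. \<Sum>j<Suc k. of_rat (A i j) * xs ! j) [0..<Suc k]"
      unfolding lin
    proof (rule nth_equalityI)
      show len: "length (z # map2 (\<lambda>y c. y + z * c) (form_lin F ys) g) = length (map (\<lambda>i. \<Sum>j<Suc k. of_rat (A i j) * xs ! j) [0..<Suc k])"
        using F xs by (simp add: g_def)
      fix i assume "i < length (z # map2 (\<lambda>y c. y + z * c) (form_lin F ys) g)"
      hence i: "i < Suc k" using len by simp
      have zz: "z = of_rat \<alpha> * x0 + (\<Sum>j<k. of_rat \<alpha> * of_rat (\<gamma> j) * ys ! j)"
        unfolding z_def dotg[OF xs(2)] by (simp add: distrib_left sum_distrib_left mult_ac)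
      have "(z # map2 (\<lambda>y c. y + z * c) (form_lin F ys) g) ! i = (\<Sum>j<Suc k. of_rat (A i j) * xs ! j)"
      proof (cases i)
        case 0
        thus ?thesis unfolding zz by (simp add: sum.lessThan_Suc_shift xs A_A' of_rat_mult \<alpha>_def[symmetric] del: sum.lessThan_Suc)
      next
        case (Suc i')
        hence i': "i' < k" using i by simp
        have "(z # map2 (\<lambda>y c. y + z * c) (form_lin F ys) g) ! i = (\<Sum>j<k. of_rat (A' i' j) * ys ! j) + z * of_rat (\<gamma> i')"
          using i' xs F(3)[OF xs(2)] by (simp add: Suc g_def)
        also have "\<dots> = (\<Sum>j<Suc k. of_rat (A i j) * xs ! j)"
          unfolding zz by (simp add: Suc sum.lessThan_Suc_shift xs A_A' of_rat_mult of_rat_add distrib_right distrib_left sum.distrib sum_distrib_left sum_distrib_right mult_ac del: sum.lessThan_Suc)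
        finally show ?thesis .
      qed
      thus "(z # map2 (\<lambda>y c. y + z * c) (form_lin F ys) g) ! i = map (\<lambda>i. \<Sum>j<Suc k. of_rat (A i j) * xs ! j) [0..<Suc k] ! i"
        using i by (simp del: upt_Suc)
    qed
  qed
qed

definition scale_form :: "real \<Rightarrow> (real \<times> real list) list \<Rightarrow> (real \<times> real list) list" where
  "scale_form t = map (\<lambda>(\<alpha>, g). (t * \<alpha>, g))"

lemma scale_form:
  assumes t: "t > 0"
  shows "form_ok F \<Longrightarrow> form_ok (scale_form t F)" "length (scale_form t F) = length F"
    "form (scale_form t F) xs = t * form F xs" "dual_form (scale_form t F) xs = dual_form F xs / t"
    "form_const (scale_form t F) = form_const F / sqrt t ^ length F"
proof -
  show "form_ok F \<Longrightarrow> form_ok (scale_form t F)"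
    using t by (induction F rule: form_ok.induct) (auto simp: scale_form_def)
  show "length (scale_form t F) = length F" by (simp add: scale_form_def)
  show "form (scale_form t F) xs = t * form F xs"
    by (induction F xs rule: form.induct) (auto simp: scale_form_def algebra_simps)
  show "dual_form (scale_form t F) xs = dual_form F xs / t"
    by (induction F xs rule: dual_form.induct) (auto simp: scale_form_def add_divide_distrib)
  show "form_const (scale_form t F) = form_const F / sqrt t ^ length F"
    by (induction F rule: form_const.induct) (auto simp: scale_form_def real_sqrt_mult)
qed

text \<open>Unimodularity enters as \<open>bij\<close>: multiplication by \<open>A\<close> permutes
  the integer vectors, so the sum of the dual form can be reindexed along it and becomes a sum of
  the form itself.\<close>

lemma theta_inversion_lists:
  fixes A :: "nat \<Rightarrow> nat \<Rightarrow> int"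
  assumes sym: "\<And>i j. A i j = A j i"
    and pos: "\<And>y :: nat \<Rightarrow> int. \<exists>i<k. y i \<noteq> 0 \<Longrightarrow> 0 < (\<Sum>i<k. \<Sum>j<k. y i * A i j * y j)"
    and bij: "bij_betw (\<lambda>x. map (\<lambda>i. \<Sum>j<k. A i j * x ! j) [0..<k]) {x. length x = k} {x. length x = k}"
    and t: "t > 0"
  defines "q \<equiv> \<lambda>x :: int list. real_of_int (\<Sum>i<k. \<Sum>j<k. x ! i * A i j * x ! j)"
  shows "(\<lambda>x. exp (- pi * t * q x)) summable_on {x. length x = k}"
    and "(\<Sum>\<^sub>\<infinity>x\<in>{x. length x = k}. exp (- pi * q x / t)) = sqrt t ^ k * (\<Sum>\<^sub>\<infinity>x\<in>{x. length x = k}. exp (- pi * t * q x))"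
proof -
  have pos': "0 < (\<Sum>i<k. \<Sum>j<k. of_int (y i) * rat_of_int (A i j) * of_int (y j))" if "\<exists>i<k. y i \<noteq> 0" for y :: "nat \<Rightarrow> int"
    using pos[OF that] by (simp flip: of_int_mult of_int_sum)
  from lagrange_form_exists[of "\<lambda>i j. of_int (A i j)" k, OF _ pos'] sym obtain F where F: "form_ok F" "length F = k"
    "\<And>xs. length xs = k \<Longrightarrow> form_lin F xs = map (\<lambda>i. \<Sum>j<k. of_int (A i j) * xs ! j) [0..<k]"
    "\<And>xs. length xs = k \<Longrightarrow> form F xs = (\<Sum>i<k. \<Sum>j<k. xs ! i * of_int (A i j) * xs ! j)"
    by (auto simp: of_rat_of_int_eq)
  let ?Z = "{x :: int list. length x = k}"
  let ?o = "replicate k (0::real)"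
  let ?A = "\<lambda>x. map (\<lambda>i. \<Sum>j<k. A i j * x ! j) [0..<k]"
  have fq: "form F (map of_int x) = q x" if "x \<in> ?Z" for x
    using that F(4)[of "map of_int x"] by (simp add: q_def)
  have dq: "dual_form F (map of_int (?A x)) = q x" if "x \<in> ?Z" for x
  proof -
    have eq: "map real_of_int (?A x) = form_lin F (map of_int x)" using that by (subst F(3)) auto
    show ?thesis unfolding eq
      using dual_form_form_lin[OF F(1), of "map of_int x"] that F(2) fq[OF that] by simp
  qed
  have sp: "shift_plus x ?o = map of_int x" "shift_minus x ?o = map of_int x" if "x \<in> ?Z" for x
    by (rule nth_equalityI; use that in \<open>simp add: shift_plus_def shift_minus_def\<close>)+
  have d0: "dotl v ?o = 0" "dotl ?o v = 0" for v
  proof -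
    have "dotl v (replicate n 0) = 0 \<and> dotl (replicate n 0) v = 0" for n
    proof (induction n arbitrary: v)
      case (Suc n) thus ?case by (cases v) auto
    next
      case 0 thus ?case by (cases v) auto
    qed
    thus "dotl v ?o = 0" "dotl ?o v = 0" by blast+
  qed
  have *: "(\<lambda>x. exp (- pi * s * q x)) summable_on ?Z \<and>
    (\<Sum>\<^sub>\<infinity>x\<in>?Z. exp (- pi * s * q x)) = form_const F / sqrt s ^ k * (\<Sum>\<^sub>\<infinity>x\<in>?Z. exp (- pi * q x / s))" if s: "s > 0" for s
  proof -
    let ?F = "scale_form s F"
    have ok: "form_ok ?F" "length ?o = length ?F" "length ?F = k" using scale_form(1,2)[OF s, of F] F(1,2) by auto
    note P = poisson_form[OF ok(1,2,2), unfolded ok(3) d0 scale_form[OF s] F(2)]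
    have S1: "(\<lambda>x. exp (- pi * s * q x)) summable_on ?Z"
      by (rule summable_on_cong[THEN iffD1, OF _ P(1)]) (auto simp: sp fq)
    have S2: "(\<lambda>x. exp (- pi * (dual_form F (map of_int x) / s))) summable_on ?Z"
      by (rule summable_on_cong[THEN iffD1, OF _ P(2)]) (auto simp: sp)
    have "complex_of_real (\<Sum>\<^sub>\<infinity>x\<in>?Z. exp (- pi * s * q x)) = (\<Sum>\<^sub>\<infinity>x\<in>?Z. complex_of_real (exp (- pi * s * q x)))"
      by (rule infsum_complex_of_real[OF S1, symmetric])
    also have "\<dots> = (\<Sum>\<^sub>\<infinity>n\<in>?Z. exp (- pi * (s * form F (shift_plus n ?o))) *\<^sub>R cis (2 * pi * 0))"
      by (rule infsum_cong) (auto simp: sp fq scaleR_conv_of_real mult_ac)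
    also have "\<dots> = (\<Sum>\<^sub>\<infinity>m\<in>?Z. (form_const F / sqrt s ^ k * exp (- pi * (dual_form F (shift_minus m ?o) / s))) *\<^sub>R cis (2 * pi * 0))"
      by (rule P(3))
    also have "\<dots> = (\<Sum>\<^sub>\<infinity>m\<in>?Z. complex_of_real (form_const F / sqrt s ^ k * exp (- pi * (dual_form F (map of_int m) / s))))"
      by (rule infsum_cong) (auto simp: sp scaleR_conv_of_real)
    also have "\<dots> = complex_of_real (\<Sum>\<^sub>\<infinity>m\<in>?Z. form_const F / sqrt s ^ k * exp (- pi * (dual_form F (map of_int m) / s)))"
      by (rule infsum_complex_of_real) (intro summable_on_cmult_right S2)
    finally have "(\<Sum>\<^sub>\<infinity>x\<in>?Z. exp (- pi * s * q x)) = (\<Sum>\<^sub>\<infinity>m\<in>?Z. form_const F / sqrt s ^ k * exp (- pi * (dual_form F (map of_int m) / s)))"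
      by (simp only: of_real_eq_iff)
    also have "\<dots> = form_const F / sqrt s ^ k * (\<Sum>\<^sub>\<infinity>m\<in>?Z. exp (- pi * (dual_form F (map of_int m) / s)))"
      by (rule infsum_cmult_right[OF S2])
    also have "(\<Sum>\<^sub>\<infinity>m\<in>?Z. exp (- pi * (dual_form F (map of_int m) / s))) = (\<Sum>\<^sub>\<infinity>x\<in>?Z. exp (- pi * (dual_form F (map of_int (?A x)) / s)))"
      by (rule infsum_reindex_bij_betw[OF bij, symmetric])
    also have "\<dots> = (\<Sum>\<^sub>\<infinity>x\<in>?Z. exp (- pi * q x / s))"
      by (rule infsum_cong) (use dq in \<open>simp del: map_map\<close>)
    finally show ?thesis using S1 by blast
  qed
  show S: "(\<lambda>x. exp (- pi * t * q x)) summable_on ?Z" using *[OF t] by blast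
  \<comment> \<open>No determinant is computed: at \<open>s = 1\<close> the identity says that a
    positive sum equals \<open>form_const F\<close> times itself.\<close>
  have "form_const F = 1"
  proof -
    have "(\<Sum>\<^sub>\<infinity>x\<in>?Z. exp (- pi * q x)) > 0"
    proof -
      have s: "(\<lambda>x. exp (- pi * q x)) summable_on ?Z" using *[of 1] by simp
      have "sum (\<lambda>x. exp (- pi * q x)) {replicate k 0} \<le> (\<Sum>\<^sub>\<infinity>x\<in>?Z. exp (- pi * q x))"
        by (rule finite_sum_le_infsum[OF s]) auto
      thus ?thesis by (simp add: less_le_trans[OF exp_gt_zero])
    qed
    thus ?thesis using *[of 1] by simp
  qed
  thus "(\<Sum>\<^sub>\<infinity>x\<in>?Z. exp (- pi * q x / t)) = sqrt t ^ k * (\<Sum>\<^sub>\<infinity>x\<in>?Z. exp (- pi * t * q x))"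
    using *[OF t] t by simp
qed

section \<open>Cusp forms of weight 12\<close>

text \<open>For \<open>v = 2 * y - 1 \<ge> 0.73\<close> the quadratic Taylor polynomial gives
  \<open>113/100 * (1 + v) \<le> exp v\<close>. Sixth powers then suffice, because
  \<open>(113/100) ^ 6 > 2\<close> and \<open>6 < 2 * pi\<close>. This is the numerical source of
  the factor 1/2 in the vanishing theorem below.\<close>

lemma exp_ge_twice_sixth_power:
  fixes y :: real
  assumes "y \<ge> sqrt 3 / 2"
  shows "2 * (2 * y) ^ 6 * exp (2 * pi - 4 * pi * y) \<le> 1"
proof -
  define v where "v = 2 * y - 1"
  have "sqrt 3 \<ge> (1.73 :: real)" by (rule real_le_rsqrt) (simp add: power2_eq_square)
  hence v: "v \<ge> 0.73" using assms by (simp add: v_def)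
  have "73 / 100 * v \<le> v\<^sup>2" unfolding power2_eq_square using v by (intro mult_right_mono) auto
  moreover have "v \<ge> 73 / 100" using v by simp
  ultimately have "113 / 100 * (1 + v) \<le> 1 + v + v\<^sup>2 / 2" by (simp add: field_simps)
  also have "\<dots> \<le> exp v" using exp_lower_Taylor_quadratic[of v] v by simp
  finally have "(113 / 100 * (1 + v)) ^ 6 \<le> exp v ^ 6" using v by (intro power_mono) auto
  also have "exp v ^ 6 = exp (6 * v)" by (simp add: exp_of_nat_mult[symmetric])
  also have "\<dots> \<le> exp (2 * pi * v)" using v pi_gt3 by simp
  finally have *: "(113 / 100 * (1 + v)) ^ 6 \<le> exp (2 * pi * v)" .
  have "2 * (2 * y) ^ 6 \<le> (113 / 100 * (1 + v)) ^ 6"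
    using v by (simp add: power_mult_distrib v_def) (simp add: power_divide)
  also note *
  finally have "2 * (2 * y) ^ 6 * exp (2 * pi - 4 * pi * y) \<le> exp (2 * pi * v) * exp (2 * pi - 4 * pi * y)"
    by (intro mult_right_mono) auto
  also have "\<dots> = 1" by (simp add: v_def exp_add[symmetric] algebra_simps)
  finally show ?thesis .
qed

text \<open>A crude bound with \<open>46656 = 6 ^ 6\<close>; it only has to make a supremum
  finite.\<close>

lemma sixth_power_exp_bounded:
  fixes y :: real
  assumes "y \<ge> 0"
  shows "y ^ 6 * exp (- 4 * pi * y) \<le> 46656"
proof -
  have "(y / 6) ^ 6 \<le> (1 + y / real 6) ^ 6" using assms by (intro power_mono) auto
  also have "\<dots> \<le> exp y" using assms by (intro exp_ge_one_plus_x_over_n_power_n) auto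
  finally have "y ^ 6 \<le> 46656 * exp y" by (simp add: power_divide)
  hence "y ^ 6 * exp (- 4 * pi * y) \<le> 46656 * exp y * exp (- 4 * pi * y)" by (intro mult_right_mono) auto
  also have "\<dots> = 46656 * exp ((1 - 4 * pi) * y)" by (simp add: exp_add[symmetric] algebra_simps)
  also have "\<dots> \<le> 46656 * 1" using assms pi_gt3 by (intro mult_left_mono) (auto simp: mult_le_0_iff)
  finally show ?thesis by simp
qed

text \<open>With \<open>h(\<tau>)\<close> the value of \<open>A\<close> at \<open>exp(2 \<pi> i \<tau>)\<close> and \<open>B\<close> the supremum of
  \<open>\<bar>h(\<tau>)\<bar> Im(\<tau>)\<^sup>6\<close> over \<open>Im \<tau> \<ge> \<surd>3/2\<close>, one inversion bounds \<open>h\<close> on the line \<open>Im \<tau> = 1/2\<close> by \<open>64 B\<close>,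
  and the Schwarz lemma carries this back with a factor \<open>1/2\<close>.\<close>

theorem weight12_order2_eq_0:
  fixes A :: "complex fps"
  assumes conv: "fps_conv_radius A \<ge> 1"
    and inv: "\<And>t. t > 0 \<Longrightarrow> eval_fps A (of_real (exp (- 2 * pi / t))) = of_real (t ^ 12) * eval_fps A (of_real (exp (- 2 * pi * t)))"
    and A01: "fps_nth A 0 = 0" "fps_nth A 1 = 0"
  shows "A = 0"
proof -
  define Q where "Q = (\<lambda>\<tau>. exp (2 * pi * \<i> * \<tau>))"
  define h where "h = (\<lambda>\<tau>. eval_fps A (Q \<tau>))"
  define UH where "UH = {\<tau>. Im \<tau> > 0}"
  have nQ: "norm (Q \<tau>) = exp (- 2 * pi * Im \<tau>)" for \<tau>
    by (simp add: Q_def norm_exp_eq_Re)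
  have Qlt1: "norm (Q \<tau>) < 1" if "\<tau> \<in> UH" for \<tau> using that by (simp add: nQ UH_def)
  have conv': "ereal (norm q) < fps_conv_radius A" if "norm q < 1" for q :: complex
    using that conv by (metis less_le_trans ereal_less(3) one_ereal_def)
  have holA: "eval_fps A holomorphic_on ball 0 1"
    by (rule holomorphic_on_eval_fps) (auto intro: conv')
  have openUH: "open UH" unfolding UH_def by (rule open_halfspace_Im_gt)
  have connUH: "connected UH" unfolding UH_def by (intro convex_connected convex_halfspace_Im_gt)
  have holh: "h holomorphic_on UH"
  proof -
    have "eval_fps A \<circ> Q holomorphic_on UH"
      by (rule holomorphic_on_compose_gen[OF _ holA]) (auto simp: Q_def intro!: holomorphic_intros dest: Qlt1[unfolded Q_def])
    thus ?thesis by (simp add: h_def o_def)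
  qed
  have UHinv: "- 1 / \<tau> \<in> UH" if "\<tau> \<in> UH" for \<tau>
    using that by (auto simp: UH_def Im_divide field_simps power2_eq_square intro!: divide_pos_pos) (metis less_irrefl sum_squares_gt_zero_iff)
  \<comment> \<open>The relation is given on the imaginary axis and spreads to the half plane by the
    identity theorem.\<close>
  have S: "h (- 1 / \<tau>) = \<tau> ^ 12 * h \<tau>" if "\<tau> \<in> UH" for \<tau>
  proof -
    define f where "f = (\<lambda>\<tau>. h (- 1 / \<tau>) - \<tau> ^ 12 * h \<tau>)"
    define U where "U = (\<lambda>t. \<i> * of_real t) ` {0<..}"
    have "f holomorphic_on UH"
    proof -
      have "h \<circ> (\<lambda>\<tau>. - 1 / \<tau>) holomorphic_on UH"
        by (rule holomorphic_on_compose_gen[OF _ holh]) (use UHinv in \<open>auto intro!: holomorphic_intros simp: UH_def\<close>)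
      thus ?thesis unfolding f_def o_def by (intro holomorphic_intros holh) auto
    qed
    moreover have "U \<subseteq> UH" by (auto simp: U_def UH_def)
    moreover have "\<i> islimpt U"
    proof -
      have "\<i> islimpt ((\<lambda>t. \<i> * of_real t) ` {0<..<2})"
        unfolding islimpt_approachable
      proof (intro allI impI)
        fix e :: real assume e: "e > 0"
        define t where "t = 1 + min (e / 2) (1 / 2)"
        have t: "0 < t" "t < 2" "t \<noteq> 1" "\<bar>t - 1\<bar> < e" using e by (auto simp: t_def min_def)
        have "dist (\<i> * of_real t) \<i> = \<bar>t - 1\<bar>"
        proof -
          have "\<i> * of_real t - \<i> = \<i> * of_real (t - 1)" by (simp add: algebra_simps)
          thus ?thesis by (simp only: dist_norm norm_mult norm_of_real) simp
        qed
        thus "\<exists>x'\<in>(\<lambda>t. \<i> * of_real t) ` {0<..<2}. x' \<noteq> \<i> \<and> dist x' \<i> < e"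
          using t by (intro bexI[of _ "\<i> * of_real t"]) (auto simp: complex_eq_iff)
      qed
      thus ?thesis by (rule islimpt_subset) (auto simp: U_def)
    qed
    moreover have "f z = 0" if zU: "z \<in> U" for z
    proof -
      obtain t where t: "t > 0" "z = \<i> * of_real t" using zU by (auto simp: U_def)
      have i12: "\<i> ^ 12 = (1 :: complex)" using power_mult[of \<i> 4 3] by (simp add: i_even_power[of 2, simplified])
      have "2 * pi * \<i> * (- 1 / z) = of_real (- 2 * pi / t)" using t by (simp add: field_simps)
      moreover have "2 * pi * \<i> * z = of_real (- 2 * pi * t)" using t by simp
      ultimately have "Q (- 1 / z) = of_real (exp (- 2 * pi / t))" "Q z = of_real (exp (- 2 * pi * t))"
        unfolding Q_def by (simp_all only: exp_of_real)
      thus ?thesis using inv[OF t(1)] t i12 by (simp add: f_def h_def power_mult_distrib)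
    qed
    ultimately have "f \<tau> = 0"
      by (intro analytic_continuation[OF _ openUH connUH, of f U \<i> \<tau>]) (use that in \<open>auto simp: UH_def\<close>)
    thus ?thesis by (simp add: f_def)
  qed
  \<comment> \<open>Divides out the double zero at \<open>q = 0\<close>; the factor
    \<open>q\<^sup>2\<close> contributes the decay
    \<open>exp (- 4 * pi * Im \<tau>)\<close>.\<close>
  define G where "G = fps_shift 2 A"
  have convG: "fps_conv_radius G \<ge> 1" using conv by (simp add: G_def)
  have A_G: "eval_fps A q = q\<^sup>2 * eval_fps G q" if "norm q < 1" for q
  proof -
    have sub: "2 \<le> subdegree A \<or> A = 0" using A01
      by (metis One_nat_def less_2_cases not_less subdegree_geI)
    have "A = fps_X ^ 2 * G" using sub by (auto simp: G_def fps_shift_times_fps_X_power mult.commute)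
    moreover have "ereal (norm q) < fps_conv_radius G" using that convG by (metis less_le_trans ereal_less(3) one_ereal_def)
    ultimately show ?thesis by (simp add: eval_fps_mult)
  qed
  have holG: "eval_fps G holomorphic_on ball 0 1"
  proof (rule holomorphic_on_eval_fps)
    show "ball 0 1 \<subseteq> eball 0 (fps_conv_radius G)"
      using convG by (auto) (metis less_le_trans ereal_less(3) one_ereal_def)
  qed
  have contG: "continuous_on (ball 0 1) (eval_fps G)" by (rule holomorphic_on_imp_continuous_on[OF holG])
  define D where "D = {\<tau>. Im \<tau> \<ge> sqrt 3 / 2}"
  have DUH: "D \<subseteq> UH" by (auto simp: D_def UH_def intro: less_le_trans[of 0 "sqrt 3 / 2"])
  define \<phi> where "\<phi> = (\<lambda>\<tau>. norm (h \<tau>) * Im \<tau> ^ 6)"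
  have phi_eq: "\<phi> \<tau> = exp (- 4 * pi * Im \<tau>) * norm (eval_fps G (Q \<tau>)) * Im \<tau> ^ 6" if "\<tau> \<in> UH" for \<tau>
  proof -
    have "norm (h \<tau>) = norm (Q \<tau>) ^ 2 * norm (eval_fps G (Q \<tau>))"
      unfolding h_def using A_G[OF Qlt1[OF that]] by (simp add: norm_mult norm_power)
    moreover have "norm (Q \<tau>) ^ 2 = exp (- 4 * pi * Im \<tau>)"
      unfolding nQ by (simp add: exp_of_nat_mult[symmetric])
    ultimately show ?thesis by (simp add: \<phi>_def)
  qed
  \<comment> \<open>The value of \<open>norm q\<close> on the line
    \<open>Im \<tau> = 1/2\<close>.\<close>
  define r1 where "r1 = exp (- pi)"
  have r1: "0 < r1" "r1 < 1" by (auto simp: r1_def)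
  have QD: "norm (Q \<tau>) \<le> r1" if "\<tau> \<in> D" for \<tau>
  proof -
    have "sqrt 3 \<ge> 1" by simp
    hence "2 * Im \<tau> \<ge> 1" using that unfolding D_def by (simp del: real_sqrt_ge_1_iff)
    hence "pi * 1 \<le> pi * (2 * Im \<tau>)" by (intro mult_left_mono) auto
    thus ?thesis by (simp add: nQ r1_def)
  qed
  obtain C where C: "\<And>q. norm q \<le> r1 \<Longrightarrow> norm (eval_fps G q) \<le> C"
  proof -
    have "compact (eval_fps G ` cball 0 r1)"
      by (intro compact_continuous_image continuous_on_subset[OF contG]) (use r1 in auto)
    then obtain C where "\<forall>x\<in>eval_fps G ` cball 0 r1. norm x \<le> C"
      using compact_imp_bounded bounded_iff by blast
    hence "norm (eval_fps G q) \<le> C" if "norm q \<le> r1" for q using that by (simp add: Ball_def)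
    thus ?thesis by (rule that)
  qed
  have C0: "C \<ge> 0" using C[of 0] r1 by (simp add: order_trans[OF norm_ge_zero])
  have bound: "\<phi> \<tau> \<le> 46656 * C" if "\<tau> \<in> D" for \<tau>
  proof -
    have u: "\<tau> \<in> UH" using that DUH by blast
    have "\<phi> \<tau> = norm (eval_fps G (Q \<tau>)) * (Im \<tau> ^ 6 * exp (- 4 * pi * Im \<tau>))"
      by (simp add: phi_eq[OF u])
    also have "\<dots> \<le> C * 46656"
      by (intro mult_mono C QD[OF that] sixth_power_exp_bounded) (use u C0 in \<open>auto simp: UH_def\<close>)
    finally show ?thesis by simp
  qed
  define B where "B = Sup (\<phi> ` D)"
  have bdd: "bdd_above (\<phi> ` D)" using bound by (intro bdd_aboveI2)
  have leB: "\<phi> \<tau> \<le> B" if "\<tau> \<in> D" for \<tau> unfolding B_def by (rule cSUP_upper[OF that bdd])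
  have "\<i> \<in> D" using real_sqrt_le_mono[of 3 4] by (simp add: D_def)
  have B0: "B \<ge> 0" using leB[OF \<open>\<i> \<in> D\<close>] by (simp add: \<phi>_def order_trans[OF norm_ge_zero])
  \<comment> \<open>A point \<tau> above \<open>q\<close> exists with real part at most 1/2 in
    absolute value. Then \<open>Im (- 1 / \<tau>) = 1 / (2 * (norm \<tau>)\<^sup>2) \<ge> 1\<close>,
    so the inverted point lies in \<open>D\<close>. In the weight 12 relation the powers of
    \<open>norm \<tau>\<close> cancel and \<open>2 ^ 6 = 64\<close> is left.\<close>
  have circle: "norm (eval_fps G q) \<le> 64 * B / r1\<^sup>2" if q: "norm q = r1" for q
  proof -
    define x where "x = Arg q / (2 * pi)"
    define \<tau> where "\<tau> = Complex x (1 / 2)"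
    have q0: "q \<noteq> 0" using q r1 by auto
    have "Q \<tau> = q"
    proof -
      have "2 * pi * \<i> * \<tau> = of_real (ln (norm q)) + \<i> * Arg q"
        by (simp add: q r1_def \<tau>_def x_def complex_eq_iff)
      thus ?thesis unfolding Q_def using q0
        by (metis Arg_eq exp_add exp_of_real exp_ln zero_less_norm_iff mult.commute)
    qed
    have xb: "\<bar>x\<bar> \<le> 1 / 2" unfolding x_def using Arg_bounded[of q] by (simp add: abs_le_iff field_simps)
    have x2: "x\<^sup>2 \<le> 1 / 4" using abs_le_square_iff[of x "1/2"] xb by (simp add: power2_eq_square)
    have tu: "\<tau> \<in> UH" by (simp add: UH_def \<tau>_def)
    have n2: "(norm \<tau>)\<^sup>2 = x\<^sup>2 + 1 / 4" unfolding cmod_power2 by (simp add: \<tau>_def power2_eq_square)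
    have npos: "norm \<tau> > 0" using tu by (auto simp: UH_def)
    have imv: "Im (- 1 / \<tau>) = 1 / (2 * (norm \<tau>)\<^sup>2)"
      by (simp add: Im_divide cmod_power2) (simp add: \<tau>_def field_simps)
    have "Im (- 1 / \<tau>) \<ge> 1" unfolding imv n2 using x2 by (simp add: le_divide_eq add_nonneg_pos)
    hence inD: "- 1 / \<tau> \<in> D" using real_sqrt_le_mono[of 3 4] by (simp add: D_def)
    have "norm (h (- 1 / \<tau>)) * Im (- 1 / \<tau>) ^ 6 \<le> B" using leB[OF inD] by (simp add: \<phi>_def)
    hence "norm \<tau> ^ 12 * norm (h \<tau>) * (1 / (2 * (norm \<tau>)\<^sup>2)) ^ 6 \<le> B"
      unfolding S[OF tu] imv by (simp add: norm_mult norm_power)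
    moreover have "norm \<tau> ^ 12 * norm (h \<tau>) * (1 / (2 * (norm \<tau>)\<^sup>2)) ^ 6 = norm (h \<tau>) / 64"
      using npos by (simp add: power_divide power_mult_distrib flip: power_mult)
    ultimately have "norm (h \<tau>) \<le> 64 * B" by simp
    moreover have "norm (h \<tau>) = r1\<^sup>2 * norm (eval_fps G q)"
      unfolding h_def \<open>Q \<tau> = q\<close> using A_G[of q] q r1 by (simp add: norm_mult norm_power)
    ultimately show ?thesis using r1 by (simp add: field_simps)
  qed
  have disc: "norm (eval_fps G q) \<le> 64 * B / r1\<^sup>2" if "norm q \<le> r1" for q
  proof (rule maximum_modulus_frontier[of "eval_fps G" "cball 0 r1"])
    show "eval_fps G holomorphic_on interior (cball 0 r1)"
      by (rule holomorphic_on_subset[OF holG]) (use r1 in auto)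
    show "continuous_on (closure (cball 0 r1)) (eval_fps G)"
      by (rule continuous_on_subset[OF contG]) (use r1 in auto)
    show "norm (eval_fps G z) \<le> 64 * B / r1\<^sup>2" if "z \<in> frontier (cball 0 r1)" for z
      by (rule circle) (use that in simp)
  qed (use that in auto)
  have half: "\<phi> \<tau> \<le> B / 2" if "\<tau> \<in> D" for \<tau>
  proof -
    have u: "\<tau> \<in> UH" using that DUH by blast
    let ?y = "Im \<tau>"
    have "\<phi> \<tau> = exp (- 4 * pi * ?y) * norm (eval_fps G (Q \<tau>)) * ?y ^ 6" by (rule phi_eq[OF u])
    also have "\<dots> \<le> exp (- 4 * pi * ?y) * (64 * B / r1\<^sup>2) * ?y ^ 6"
      by (intro mult_right_mono mult_left_mono disc QD[OF that]) (use u in \<open>auto simp: UH_def\<close>)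
    also have "\<dots> = (2 * (2 * ?y) ^ 6 * exp (2 * pi - 4 * pi * ?y)) * (B / 2)"
      by (simp add: r1_def power2_eq_square exp_diff exp_minus exp_add[symmetric] power_mult_distrib field_simps)
    also have "\<dots> \<le> 1 * (B / 2)"
      by (intro mult_right_mono exp_ge_twice_sixth_power) (use that B0 in \<open>auto simp: D_def\<close>)
    finally show ?thesis by simp
  qed
  have "B \<le> B / 2" unfolding B_def[of] using half \<open>\<i> \<in> D\<close> by (intro cSUP_least) (auto simp: B_def)
  hence "B = 0" using B0 by simp
  hence h0: "h \<tau> = 0" if "\<tau> \<in> D" for \<tau>
  proof -
    have "\<phi> \<tau> \<le> 0" using leB[OF that] \<open>B = 0\<close> by simp
    moreover have "Im \<tau> > 0" using that DUH by (auto simp: UH_def)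
    ultimately show ?thesis by (simp add: \<phi>_def mult_le_0_iff)
  qed
  have zero: "eval_fps A q = 0" if "norm q < exp (- 2 * pi)" for q
  proof (cases "q = 0")
    case True thus ?thesis using A01 by (simp add: eval_fps_at_0)
  next
    case False
    define \<tau> where "\<tau> = Ln q / (2 * pi * \<i>)"
    have "Q \<tau> = q" using False by (simp add: Q_def \<tau>_def)
    hence "exp (- 2 * pi * Im \<tau>) < exp (- 2 * pi)" using that nQ[of \<tau>] by simp
    hence "2 * pi * 1 < 2 * pi * Im \<tau>" unfolding exp_less_cancel_iff by linarith
    hence "Im \<tau> > 1" by (rule mult_left_less_imp_less) simp
    hence "\<tau> \<in> D" using real_sqrt_le_mono[of 3 4] by (simp add: D_def)
    thus ?thesis using h0[of \<tau>] \<open>Q \<tau> = q\<close> by (simp add: h_def)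
  qed
  have exA: "eval_fps A has_fps_expansion A"
    by (rule eval_fps_has_fps_expansion, rule less_le_trans[OF _ conv]) simp
  have "eventually (\<lambda>q. q \<in> ball 0 (exp (- 2 * pi))) (nhds (0::complex))"
    by (rule eventually_nhds_in_open) auto
  hence "eventually (\<lambda>q. eval_fps A q = 0) (nhds 0)" by eventually_elim (use zero in auto)
  hence "(\<lambda>_. 0) has_fps_expansion A" using exA by (subst (asm) has_fps_expansion_cong) auto
  thus "A = 0" using fps_expansion_unique_complex has_fps_expansion_0 by blast
qed

section \<open>Theta constants\<close>

definition gen_fps :: "('a \<Rightarrow> nat) \<Rightarrow> complex fps" where
  "gen_fps v = Abs_fps (\<lambda>m. of_nat (card {x. v x = m}))"

lemma gen_fps_sums:
  fixes v :: "'a \<Rightarrow> nat" and z :: complex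
  assumes fin: "\<And>m. finite {x. v x = m}"
    and summ: "(\<lambda>x. norm z ^ v x) summable_on UNIV"
  shows "(\<lambda>m. of_nat (card {x. v x = m}) * z ^ m) sums (\<Sum>\<^sub>\<infinity>x. z ^ v x)"
proof -
  have "(\<lambda>x. z ^ v x) summable_on UNIV"
    by (rule abs_summable_summable) (use summ in \<open>simp add: norm_power\<close>)
  hence "((\<lambda>x. z ^ v x) has_sum (\<Sum>\<^sub>\<infinity>x. z ^ v x)) UNIV" by simp
  hence "((\<lambda>(m, x). z ^ m) has_sum (\<Sum>\<^sub>\<infinity>x. z ^ v x)) (Sigma UNIV (\<lambda>m. {x. v x = m}))"
    by (rule has_sum_reindex_bij_witness[of _ snd "\<lambda>x. (v x, x)", THEN iffD1, rotated -1]) auto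
  hence "((\<lambda>m. of_nat (card {x. v x = m}) * z ^ m) has_sum (\<Sum>\<^sub>\<infinity>x. z ^ v x)) UNIV"
    by (rule has_sum_Sigma') (use fin in \<open>auto intro!: has_sum_finiteI\<close>)
  thus ?thesis by (rule has_sum_imp_sums)
qed

lemma gen_fps:
  fixes v :: "'a \<Rightarrow> nat"
  assumes fin: "\<And>m. finite {x. v x = m}"
    and summ: "\<And>r::real. 0 < r \<Longrightarrow> r < 1 \<Longrightarrow> (\<lambda>x. r ^ v x) summable_on UNIV"
  shows "fps_conv_radius (gen_fps v) \<ge> 1"
    and "z \<noteq> 0 \<Longrightarrow> norm z < 1 \<Longrightarrow> eval_fps (gen_fps v) z = (\<Sum>\<^sub>\<infinity>x. z ^ v x)"
proof -
  have "summable (\<lambda>m. of_nat (card {x. v x = m}) * complex_of_real r ^ m)" if "0 < r" "ereal r < 1" for r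
    using gen_fps_sums[OF fin, of "of_real r"] summ[of r] that by (auto simp: sums_iff)
  thus "fps_conv_radius (gen_fps v) \<ge> 1"
    unfolding fps_conv_radius_def gen_fps_def by (intro conv_radius_geI_ex') auto
  show "z \<noteq> 0 \<Longrightarrow> norm z < 1 \<Longrightarrow> eval_fps (gen_fps v) z = (\<Sum>\<^sub>\<infinity>x. z ^ v x)"
    using gen_fps_sums[OF fin, of z] summ[of "norm z"] by (simp add: eval_fps_def gen_fps_def sums_iff)
qed

text \<open>The average of \<open>f z\<close> and \<open>f (- z)\<close> as a series in
  \<open>z\<^sup>2\<close>: it passes from the nome \<open>exp (- pi * t)\<close> of the theta
  constants to its square \<open>q\<close>.\<close>

definition fps_even :: "complex fps \<Rightarrow> complex fps" where
  "fps_even f = Abs_fps (\<lambda>n. fps_nth f (2 * n))"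

lemma fps_even_conv:
  assumes "fps_conv_radius f \<ge> 1"
  shows "fps_conv_radius (fps_even f) \<ge> 1"
    and "norm z < 1 \<Longrightarrow> eval_fps (fps_even f) (z\<^sup>2) = (eval_fps f z + eval_fps f (- z)) / 2"
proof -
  have s: "(\<lambda>n. fps_nth f (2 * n) * (z\<^sup>2) ^ n) sums ((eval_fps f z + eval_fps f (- z)) / 2)" if z: "norm z < 1" for z
  proof -
    have c: "ereal (norm z) < fps_conv_radius f" using z assms by (metis less_le_trans ereal_less(3) one_ereal_def)
    have "(\<lambda>n. (fps_nth f n * z ^ n + fps_nth f n * (- z) ^ n) / 2) sums ((eval_fps f z + eval_fps f (- z)) / 2)"
      by (intro sums_divide sums_add sums_eval_fps) (use c in auto)
    moreover have "(fps_nth f n * z ^ n + fps_nth f n * (- z) ^ n) / 2 = (if even n then fps_nth f n * z ^ n else 0)" for n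
      by auto
    ultimately have "(\<lambda>n. if even n then fps_nth f n * z ^ n else 0) sums ((eval_fps f z + eval_fps f (- z)) / 2)" by simp
    hence "(\<lambda>n. (\<lambda>n. if even n then fps_nth f n * z ^ n else 0) (2 * n)) sums ((eval_fps f z + eval_fps f (- z)) / 2)"
      by (subst sums_mono_reindex) (auto simp: strict_mono_def image_iff elim!: evenE)
    thus ?thesis by (simp add: power_mult)
  qed
  show "norm z < 1 \<Longrightarrow> eval_fps (fps_even f) (z\<^sup>2) = (eval_fps f z + eval_fps f (- z)) / 2"
    using s[of z] by (simp add: eval_fps_def fps_even_def sums_iff)
  show "fps_conv_radius (fps_even f) \<ge> 1"
    unfolding fps_conv_radius_def
  proof (rule conv_radius_geI_ex')
    fix r :: real assume r: "0 < r" "ereal r < 1"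
    have "norm (complex_of_real (sqrt r)) < 1" using r by simp
    from s[OF this] show "summable (\<lambda>n. fps_nth (fps_even f) n * of_real r ^ n)"
      using r by (simp add: fps_even_def sums_iff flip: of_real_power)
  qed
qed

text \<open>\<open>sq_fps\<close> and \<open>sq_fps'\<close> are Jacobi's theta_3 and theta_4 as
  series in the nome. \<open>tri_fps\<close> is theta_2 as a series in the square \<open>q\<close>
  of the nome, stripped of its fractional leading power \<open>q^(1/8)\<close>.\<close>

definition sq_fps :: "complex fps" where "sq_fps = gen_fps (\<lambda>n::int. nat (n\<^sup>2))"
definition sq_fps' :: "complex fps" where "sq_fps' = Abs_fps (\<lambda>n. (- 1) ^ n * fps_nth sq_fps n)"
definition tri_fps :: "complex fps" where "tri_fps = gen_fps (\<lambda>n::int. nat (n * (n + 1) div 2))"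

text \<open>The theta function of the Leech lattice as a polynomial in Jacobi's theta constants:
  \<open>(\<theta>\<^sub>2\<^sup>2\<^sup>4 + \<theta>\<^sub>3\<^sup>2\<^sup>4 + \<theta>\<^sub>4\<^sup>2\<^sup>4)/2 - (69/16) (\<theta>\<^sub>2 \<theta>\<^sub>3 \<theta>\<^sub>4)\<^sup>8\<close>, rewritten as a power series in \<open>q\<close>.\<close>

definition leech_fps :: "complex fps" where
  "leech_fps = fps_even (sq_fps ^ 24) + fps_const (1/2) * (fps_X ^ 3 * tri_fps ^ 24)
     - fps_const (69/16) * (fps_X * tri_fps ^ 8 * fps_even ((sq_fps * sq_fps') ^ 8))"

lemma abs_le_square_int: "\<bar>n\<bar> \<le> n\<^sup>2" for n :: int
proof (cases "n = 0")
  case False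
  hence "\<bar>n\<bar> * 1 \<le> \<bar>n\<bar> * \<bar>n\<bar>" by (intro mult_left_mono) auto
  thus ?thesis by (simp add: power2_eq_square)
qed simp

lemma triangular_nonneg: "0 \<le> n * (n + 1) div 2" for n :: int
proof -
  have "0 \<le> n * (n + 1)" by (cases "n \<ge> 0") (auto intro: mult_nonneg_nonneg mult_nonpos_nonpos)
  thus ?thesis by simp
qed

lemma real_triangular: "real (nat (n * (n + 1) div 2)) = (of_int n + 1/2)\<^sup>2 / 2 - 1 / 8" for n :: int
proof -
  have "real (nat (n * (n + 1) div 2)) = real_of_int (n * (n + 1) div 2)" using triangular_nonneg[of n] by simp
  also have "\<dots> = of_int (n * (n + 1)) / 2"
  proof -
    obtain m where m: "n * (n + 1) = 2 * m" by (metis even_mult_iff even_plus_one_iff evenE)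
    show ?thesis unfolding m by simp
  qed
  finally show ?thesis by (simp add: power2_eq_square algebra_simps)
qed

lemma power_eq_exp: "0 < r \<Longrightarrow> r ^ n = exp (- pi * (- ln r / pi) * real n)" for r :: real
  by (simp add: exp_of_nat2_mult)

lemma sq_fps_props:
  shows "fps_conv_radius sq_fps \<ge> 1"
    and "z \<noteq> 0 \<Longrightarrow> norm z < 1 \<Longrightarrow> eval_fps sq_fps z = (\<Sum>\<^sub>\<infinity>n::int. z ^ nat (n\<^sup>2))"
proof -
  have fin: "finite {n::int. nat (n\<^sup>2) = m}" for m
  proof (rule finite_subset)
    show "{n::int. nat (n\<^sup>2) = m} \<subseteq> {- int m..int m}"
    proof safe
      fix n :: int
      have "\<bar>n\<bar> \<le> n\<^sup>2" by (rule abs_le_square_int)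
      thus "n \<in> {- int (nat (n\<^sup>2))..int (nat (n\<^sup>2))}" by auto
    qed
  qed simp
  have summ: "(\<lambda>n::int. r ^ nat (n\<^sup>2)) summable_on UNIV" if "0 < r" "r < 1" for r :: real
  proof -
    have "- ln r / pi > 0" using that by (simp add: divide_neg_pos)
    from gauss_summable_int[OF this, of 0] show ?thesis using that by (subst power_eq_exp) auto
  qed
  show "fps_conv_radius sq_fps \<ge> 1" unfolding sq_fps_def by (rule gen_fps(1)[OF fin summ])
  show "z \<noteq> 0 \<Longrightarrow> norm z < 1 \<Longrightarrow> eval_fps sq_fps z = (\<Sum>\<^sub>\<infinity>n::int. z ^ nat (n\<^sup>2))"
    unfolding sq_fps_def by (rule gen_fps(2)[OF fin summ])
qed

lemma tri_fps_props:
  shows "fps_conv_radius tri_fps \<ge> 1"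
    and "z \<noteq> 0 \<Longrightarrow> norm z < 1 \<Longrightarrow> eval_fps tri_fps z = (\<Sum>\<^sub>\<infinity>n::int. z ^ nat (n * (n + 1) div 2))"
proof -
  have fin: "finite {n::int. nat (n * (n + 1) div 2) = m}" for m
  proof (rule finite_subset)
    show "{n::int. nat (n * (n + 1) div 2) = m} \<subseteq> {- int (2 * m + 1)..int (2 * m + 1)}"
    proof safe
      fix n :: int
      have "\<bar>n\<bar> \<le> n\<^sup>2" "\<bar>n + 1\<bar> \<le> (n + 1)\<^sup>2" by (rule abs_le_square_int)+
      hence "\<bar>n\<bar> \<le> n * (n + 1) + 1" by (auto simp: power2_eq_square algebra_simps abs_if split: if_splits)
      moreover have "n * (n + 1) = 2 * (n * (n + 1) div 2)" by simp
      ultimately have "\<bar>n\<bar> \<le> 2 * (n * (n + 1) div 2) + 1" by linarith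
      thus "n \<in> {- int (2 * nat (n * (n + 1) div 2) + 1)..int (2 * nat (n * (n + 1) div 2) + 1)}"
        using triangular_nonneg[of n] by (simp add: abs_le_iff)
    qed
  qed simp
  have summ: "(\<lambda>n::int. r ^ nat (n * (n + 1) div 2)) summable_on UNIV" if "0 < r" "r < 1" for r :: real
  proof -
    have "- ln r / (2 * pi) > 0" using that by (simp add: divide_neg_pos)
    have "r ^ nat (n * (n + 1) div 2) = exp (- ln r / 8) * exp (- pi * (- ln r / (2 * pi)) * (of_int n + 1/2)\<^sup>2)" for n
      unfolding power_eq_exp[OF that(1)] real_triangular exp_add[symmetric] by (simp add: field_simps)
    thus ?thesis
      using summable_on_cmult_right[OF gauss_summable_int[OF \<open>- ln r / (2 * pi) > 0\<close>, of "1/2"], of "exp (- ln r / 8)"] by simp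
  qed
  show "fps_conv_radius tri_fps \<ge> 1" unfolding tri_fps_def by (rule gen_fps(1)[OF fin summ])
  show "z \<noteq> 0 \<Longrightarrow> norm z < 1 \<Longrightarrow> eval_fps tri_fps z = (\<Sum>\<^sub>\<infinity>n::int. z ^ nat (n * (n + 1) div 2))"
    unfolding tri_fps_def by (rule gen_fps(2)[OF fin summ])
qed

definition T2 :: "real \<Rightarrow> complex" where "T2 t = (\<Sum>\<^sub>\<infinity>n::int. of_real (exp (- pi * t * (of_int n + 1/2)\<^sup>2)))"
definition T3 :: "real \<Rightarrow> complex" where "T3 t = (\<Sum>\<^sub>\<infinity>n::int. of_real (exp (- pi * t * (of_int n)\<^sup>2)))"
definition T4 :: "real \<Rightarrow> complex" where "T4 t = (\<Sum>\<^sub>\<infinity>n::int. exp (- pi * t * (of_int n)\<^sup>2) *\<^sub>R cis (pi * of_int n))"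

text \<open>Poisson summation exchanges a shift by 1/2 with a frequency 1/2, hence \<open>T2\<close>
  with \<open>T4\<close>; \<open>T3\<close> has neither.\<close>

lemma theta_constants_inv:
  assumes t: "t > 0"
  shows "T3 (1 / t) = of_real (sqrt t) * T3 t" "T4 (1 / t) = of_real (sqrt t) * T2 t" "T2 (1 / t) = of_real (sqrt t) * T4 t"
proof -
  have scale: "(\<Sum>\<^sub>\<infinity>m::int. (exp (- pi * (of_int m - 0)\<^sup>2 / a) / sqrt a) *\<^sub>R f m) = of_real (1 / sqrt a) * (\<Sum>\<^sub>\<infinity>m::int. exp (- pi * (1 / a) * (of_int m)\<^sup>2) *\<^sub>R f m)"
    for a :: real and f :: "int \<Rightarrow> complex"
    by (subst infsum_cmult_right'[symmetric]) (simp add: scaleR_conv_of_real)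
  show "T3 (1 / t) = of_real (sqrt t) * T3 t"
    using poisson_gauss_1d[OF t, of 0 0] scale[of t "\<lambda>_. 1"] t unfolding T3_def by (simp add: scaleR_conv_of_real field_simps)
  show "T4 (1 / t) = of_real (sqrt t) * T2 t"
    using poisson_gauss_1d[OF t, of "1/2" 0] scale[of t "\<lambda>m. cis (2 * pi * of_int m * (1/2))"] t unfolding T4_def T2_def
    by (simp add: scaleR_conv_of_real field_simps)
  show "T2 (1 / t) = of_real (sqrt t) * T4 t"
    using poisson_gauss_1d[of "1/t" "1/2" 0] scale[of "1/t" "\<lambda>m. cis (2 * pi * of_int m * (1/2))"] t unfolding T4_def T2_def
    by (simp add: scaleR_conv_of_real real_sqrt_divide field_simps)
qed

lemma theta_constants_fps:
  assumes t: "t > 0"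
  shows "T3 t = eval_fps sq_fps (of_real (exp (- pi * t)))"
    and "T4 t = eval_fps sq_fps (- of_real (exp (- pi * t)))"
    and "T2 t = of_real (exp (- pi * t / 4)) * eval_fps tri_fps (of_real (exp (- 2 * pi * t)))"
proof -
  have p: "norm (complex_of_real (exp (- pi * t))) < 1" "norm (complex_of_real (exp (- 2 * pi * t))) < 1" using t by auto
  have e: "complex_of_real (exp (- pi * t)) ^ nat (n\<^sup>2) = of_real (exp (- pi * t * (of_int n)\<^sup>2))" for n :: int
    by (simp add: exp_of_nat2_mult[symmetric] flip: of_real_power)
  show "T3 t = eval_fps sq_fps (of_real (exp (- pi * t)))"
    unfolding T3_def e[symmetric] using p by (subst sq_fps_props(2)) auto
  have s: "(- 1) ^ nat (n\<^sup>2) = cis (pi * of_int n)" for n :: int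
  proof -
    have "even (nat (n\<^sup>2)) = even n" by (simp add: even_nat_iff)
    moreover have "cis (pi * of_int n) = (if even n then 1 else - 1)"
    proof (cases "even n")
      case True
      then obtain k where "n = 2 * k" by (elim evenE)
      hence "cis (pi * of_int n) = cis (2 * pi * of_int k)" by (simp add: mult_ac)
      thus ?thesis using True cis_multiple_2pi[of "of_int k"] by simp
    next
      case False
      then obtain k where "n = 2 * k + 1" by (elim oddE)
      hence "pi * of_int n = 2 * pi * of_int k + pi" by (simp add: algebra_simps)
      hence "cis (pi * of_int n) = cis (2 * pi * of_int k) * cis pi" by (simp only: cis_mult)
      thus ?thesis using False cis_multiple_2pi[of "of_int k"] by simp
    qed
    ultimately show ?thesis by simp
  qed
  have e': "(- complex_of_real (exp (- pi * t))) ^ nat (n\<^sup>2) = exp (- pi * t * (of_int n)\<^sup>2) *\<^sub>R cis (pi * of_int n)" for n :: int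
    using e[of n] s[of n] power_mult_distrib[of "- 1" "complex_of_real (exp (- pi * t))" "nat (n\<^sup>2)"] by (simp add: scaleR_conv_of_real mult.commute)
  show "T4 t = eval_fps sq_fps (- of_real (exp (- pi * t)))"
    unfolding T4_def e'[symmetric] using p by (subst sq_fps_props(2)) auto
  have e2: "complex_of_real (exp (- pi * t * (of_int n + 1/2)\<^sup>2)) = of_real (exp (- pi * t / 4)) * complex_of_real (exp (- 2 * pi * t)) ^ nat (n * (n + 1) div 2)" for n :: int
  proof -
    have "exp (- 2 * pi * t) ^ nat (n * (n + 1) div 2) = exp (real (nat (n * (n + 1) div 2)) * (- 2 * pi * t))"
      by (simp add: exp_of_nat_mult[symmetric])
    also have "exp (- pi * t / 4) * \<dots> = exp (- pi * t * (of_int n + 1/2)\<^sup>2)"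
      unfolding real_triangular exp_add[symmetric] by (simp add: field_simps)
    finally show ?thesis by (metis of_real_mult of_real_power)
  qed
  show "T2 t = of_real (exp (- pi * t / 4)) * eval_fps tri_fps (of_real (exp (- 2 * pi * t)))"
    unfolding T2_def e2 using p by (subst tri_fps_props(2)) (auto simp: infsum_cmult_right')
qed

lemma sq_fps'_props:
  "fps_conv_radius sq_fps' = fps_conv_radius sq_fps" "eval_fps sq_fps' z = eval_fps sq_fps (- z)"
proof -
  show "fps_conv_radius sq_fps' = fps_conv_radius sq_fps"
    proof -
    have "(\<lambda>n. norm (fps_nth sq_fps' n)) = (\<lambda>n. norm (fps_nth sq_fps n))" by (simp add: sq_fps'_def norm_mult norm_power)
    thus ?thesis unfolding fps_conv_radius_def using conv_radius_norm by metis
  qed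
  show "eval_fps sq_fps' z = eval_fps sq_fps (- z)"
  proof -
    have "(- 1) ^ n * fps_nth sq_fps n * z ^ n = fps_nth sq_fps n * (- z) ^ n" for n
      by (simp add: power_minus[of z] mult_ac)
    thus ?thesis by (simp only: eval_fps_def sq_fps'_def fps_nth_Abs_fps)
  qed
qed

lemma fps_conv_ge1:
  fixes f g :: "complex fps"
  shows "fps_conv_radius f \<ge> 1 \<Longrightarrow> fps_conv_radius g \<ge> 1 \<Longrightarrow> fps_conv_radius (f * g) \<ge> 1"
    and "fps_conv_radius f \<ge> 1 \<Longrightarrow> fps_conv_radius g \<ge> 1 \<Longrightarrow> fps_conv_radius (f + g) \<ge> 1"
    and "fps_conv_radius f \<ge> 1 \<Longrightarrow> fps_conv_radius g \<ge> 1 \<Longrightarrow> fps_conv_radius (f - g) \<ge> 1"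
    and "fps_conv_radius f \<ge> 1 \<Longrightarrow> fps_conv_radius (f ^ n) \<ge> 1"
  using fps_conv_radius_mult[of f g] fps_conv_radius_add[of f g] fps_conv_radius_diff[of f g] fps_conv_radius_power[of f n]
  by (auto simp: min_def split: if_splits intro: order_trans)

lemma norm_lt_conv_ge1: "fps_conv_radius f \<ge> 1 \<Longrightarrow> norm z < 1 \<Longrightarrow> ereal (norm z) < fps_conv_radius f" for z :: complex
  by (metis less_le_trans ereal_less(3) one_ereal_def)

lemma leech_fps_conv: "fps_conv_radius leech_fps \<ge> 1"
  unfolding leech_fps_def
  by (intro fps_conv_ge1 fps_even_conv(1) sq_fps_props tri_fps_props) (simp_all add: sq_fps'_props sq_fps_props)

lemma leech_fps_eval:
  assumes t: "t > 0"
  shows "eval_fps leech_fps (of_real (exp (- 2 * pi * t))) =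
    (T2 t ^ 24 + T3 t ^ 24 + T4 t ^ 24) / 2 - 69 / 16 * (T2 t * T3 t * T4 t) ^ 8"
proof -
  define p where "p = complex_of_real (exp (- pi * t))"
  define q where "q = complex_of_real (exp (- 2 * pi * t))"
  define w where "w = complex_of_real (exp (- pi * t / 4))"
  have pq: "p\<^sup>2 = q" "w ^ 8 = q" unfolding p_def q_def w_def
    by (simp_all add: exp_of_nat_mult[symmetric] flip: of_real_power)
  have n: "norm p < 1" "norm q < 1" using t by (auto simp: p_def q_def)
  note conv = fps_conv_ge1 fps_even_conv(1) sq_fps_props(1) tri_fps_props(1) sq_fps'_props(1)[THEN eq_refl, THEN order_trans[rotated]]
  have sq': "fps_conv_radius sq_fps' \<ge> 1" by (simp add: sq_fps'_props sq_fps_props)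
  have E1: "eval_fps (fps_even (sq_fps ^ 24)) q = (T3 t ^ 24 + T4 t ^ 24) / 2"
    unfolding pq(1)[symmetric] theta_constants_fps[OF t] p_def[symmetric]
    by (subst fps_even_conv(2)) (use n in \<open>auto intro!: fps_conv_ge1 sq_fps_props simp: eval_fps_power norm_lt_conv_ge1 sq_fps_props\<close>)
  have E2: "eval_fps (fps_even ((sq_fps * sq_fps') ^ 8)) q = (T3 t * T4 t) ^ 8"
    unfolding pq(1)[symmetric] theta_constants_fps[OF t] p_def[symmetric]
    by (subst fps_even_conv(2)) (use n sq' in \<open>auto intro!: fps_conv_ge1 sq_fps_props
         simp: eval_fps_power eval_fps_mult norm_lt_conv_ge1 fps_conv_ge1 sq_fps_props sq_fps'_props(2) mult.commute\<close>)
  have T2: "T2 t = w * eval_fps tri_fps q" unfolding theta_constants_fps[OF t] w_def q_def ..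
  have E3: "eval_fps (tri_fps ^ k) q = eval_fps tri_fps q ^ k" for k
    using n by (simp add: eval_fps_power norm_lt_conv_ge1 tri_fps_props)
  have w24: "w ^ 24 = q ^ 3" using pq(2) power_mult[of w 8 3] by simp
  have c1: "fps_conv_radius (fps_even (sq_fps ^ 24)) \<ge> 1" by (intro conv)
  have c2: "fps_conv_radius (fps_even ((sq_fps * sq_fps') ^ 8)) \<ge> 1" by (intro fps_conv_ge1 fps_even_conv(1) sq_fps_props sq')
  have c3: "fps_conv_radius (tri_fps ^ k) \<ge> 1" for k by (intro fps_conv_ge1 tri_fps_props)
  have cc: "ereal (norm q) < fps_conv_radius f" if "fps_conv_radius f \<ge> 1" for f using that n(2) by (rule norm_lt_conv_ge1)
  have "eval_fps leech_fps q = eval_fps (fps_even (sq_fps ^ 24)) q + 1/2 * (q ^ 3 * eval_fps (tri_fps ^ 24) q)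
     - 69/16 * (q * eval_fps (tri_fps ^ 8) q * eval_fps (fps_even ((sq_fps * sq_fps') ^ 8)) q)"
    unfolding leech_fps_def
    by (subst eval_fps_diff eval_fps_add eval_fps_mult; (intro cc fps_conv_ge1 c1 c2 c3; simp)?)+ simp
  also have "\<dots> = (T2 t ^ 24 + T3 t ^ 24 + T4 t ^ 24) / 2 - 69 / 16 * (T2 t * T3 t * T4 t) ^ 8"
    unfolding E1 E2 E3 T2 by (simp add: power_mult_distrib w24 pq(2) field_simps)
  finally show ?thesis unfolding q_def .
qed

text \<open>The polynomial in the theta constants is homogeneous of degree 24 and symmetric in
  \<open>T2\<close> and \<open>T4\<close>, so inversion merely collects 24 factors
  \<open>sqrt t\<close>.\<close>

lemma leech_fps_inv:
  assumes t: "t > 0"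
  shows "eval_fps leech_fps (of_real (exp (- 2 * pi / t))) = of_real (t ^ 12) * eval_fps leech_fps (of_real (exp (- 2 * pi * t)))"
proof -
  have "1 / t > 0" using t by simp
  from leech_fps_eval[OF this] have 1: "eval_fps leech_fps (of_real (exp (- 2 * pi / t))) =
    (T2 (1/t) ^ 24 + T3 (1/t) ^ 24 + T4 (1/t) ^ 24) / 2 - 69 / 16 * (T2 (1/t) * T3 (1/t) * T4 (1/t)) ^ 8" by simp
  define s where "s = complex_of_real (sqrt t)"
  have s: "of_real (t ^ 12) = s ^ 24"
  proof -
    have "sqrt t ^ 24 = (sqrt t ^ 2) ^ 12" by (simp only: power_mult[symmetric]) simp
    thus ?thesis using t by (simp add: s_def flip: of_real_power)
  qed
  show ?thesis
    unfolding 1 leech_fps_eval[OF t] theta_constants_inv[OF t] s s_def[symmetric]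
    by (simp add: power_mult_distrib algebra_simps power_mult[symmetric])
qed

section \<open>Coefficients of the comparison series up to \<open>q ^ 4\<close>\<close>

lemma fps_mult_nth_upto8:
  fixes f g :: "complex fps"
  shows "fps_nth (f * g) 0 = fps_nth f 0 * fps_nth g 0"
    "fps_nth (f * g) 1 = fps_nth f 0 * fps_nth g 1 + fps_nth f 1 * fps_nth g 0"
    "fps_nth (f * g) 2 = fps_nth f 0 * fps_nth g 2 + fps_nth f 1 * fps_nth g 1 + fps_nth f 2 * fps_nth g 0"
    "fps_nth (f * g) 3 = fps_nth f 0 * fps_nth g 3 + fps_nth f 1 * fps_nth g 2 + fps_nth f 2 * fps_nth g 1 + fps_nth f 3 * fps_nth g 0"
    "fps_nth (f * g) 4 = fps_nth f 0 * fps_nth g 4 + fps_nth f 1 * fps_nth g 3 + fps_nth f 2 * fps_nth g 2 + fps_nth f 3 * fps_nth g 1 + fps_nth f 4 * fps_nth g 0"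
    "fps_nth (f * g) 5 = fps_nth f 0 * fps_nth g 5 + fps_nth f 1 * fps_nth g 4 + fps_nth f 2 * fps_nth g 3 + fps_nth f 3 * fps_nth g 2 + fps_nth f 4 * fps_nth g 1 + fps_nth f 5 * fps_nth g 0"
    "fps_nth (f * g) 6 = fps_nth f 0 * fps_nth g 6 + fps_nth f 1 * fps_nth g 5 + fps_nth f 2 * fps_nth g 4 + fps_nth f 3 * fps_nth g 3 + fps_nth f 4 * fps_nth g 2 + fps_nth f 5 * fps_nth g 1 + fps_nth f 6 * fps_nth g 0"
    "fps_nth (f * g) 7 = fps_nth f 0 * fps_nth g 7 + fps_nth f 1 * fps_nth g 6 + fps_nth f 2 * fps_nth g 5 + fps_nth f 3 * fps_nth g 4 + fps_nth f 4 * fps_nth g 3 + fps_nth f 5 * fps_nth g 2 + fps_nth f 6 * fps_nth g 1 + fps_nth f 7 * fps_nth g 0"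
    "fps_nth (f * g) 8 = fps_nth f 0 * fps_nth g 8 + fps_nth f 1 * fps_nth g 7 + fps_nth f 2 * fps_nth g 6 + fps_nth f 3 * fps_nth g 5 + fps_nth f 4 * fps_nth g 4 + fps_nth f 5 * fps_nth g 3 + fps_nth f 6 * fps_nth g 2 + fps_nth f 7 * fps_nth g 1 + fps_nth f 8 * fps_nth g 0"
  by (simp_all add: fps_mult_nth numeral_eq_Suc)

lemma sq_fps_nth: "fps_nth sq_fps 0 = 1" "fps_nth sq_fps 1 = 2" "fps_nth sq_fps 2 = 0" "fps_nth sq_fps 3 = 0" "fps_nth sq_fps 4 = 2" "fps_nth sq_fps 5 = 0" "fps_nth sq_fps 6 = 0" "fps_nth sq_fps 7 = 0" "fps_nth sq_fps 8 = 0"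
proof -
  have *: "{n::int. nat (n\<^sup>2) = m} = set (filter (\<lambda>n. nat (n\<^sup>2) = m) [-2, -1, 0, 1, 2])" if "m \<le> 8" for m
  proof -
    have "n \<in> {-2, -1, 0, 1, 2}" if "nat (n\<^sup>2) = m" for n :: int
    proof -
      have "\<bar>n\<bar> < 3"
      proof (rule ccontr)
        assume "\<not> \<bar>n\<bar> < 3"
        hence "3\<^sup>2 \<le> \<bar>n\<bar>\<^sup>2" by (intro power_mono) auto
        thus False using that \<open>m \<le> 8\<close> by simp
      qed
      thus ?thesis by auto
    qed
    thus ?thesis unfolding set_filter list.set by blast
  qed
  show "fps_nth sq_fps 0 = 1" "fps_nth sq_fps 1 = 2" "fps_nth sq_fps 2 = 0" "fps_nth sq_fps 3 = 0" "fps_nth sq_fps 4 = 2" "fps_nth sq_fps 5 = 0" "fps_nth sq_fps 6 = 0" "fps_nth sq_fps 7 = 0" "fps_nth sq_fps 8 = 0"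
    unfolding sq_fps_def gen_fps_def fps_nth_Abs_fps by (subst *; simp)+
qed
lemma tri_fps_nth: "fps_nth tri_fps 0 = 2" "fps_nth tri_fps 1 = 2" "fps_nth tri_fps 2 = 0" "fps_nth tri_fps 3 = 2"
proof -
  have *: "{n::int. nat (n * (n + 1) div 2) = m} = set (filter (\<lambda>n. nat (n * (n + 1) div 2) = m) [-3, -2, -1, 0, 1, 2])" if "m \<le> 3" for m
  proof -
    have "n \<in> {-3, -2, -1, 0, 1, 2}" if "nat (n * (n + 1) div 2) = m" for n :: int
    proof -
      have le: "n * (n + 1) < 8" using that \<open>m \<le> 3\<close> by linarith
      have "\<bar>2 * n + 1\<bar> < 6"
      proof (rule ccontr)
        assume "\<not> \<bar>2 * n + 1\<bar> < 6"
        hence "6\<^sup>2 \<le> \<bar>2 * n + 1\<bar>\<^sup>2" by (intro power_mono) auto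
        thus False using le by (simp add: power2_eq_square algebra_simps)
      qed
      thus ?thesis by auto
    qed
    thus ?thesis unfolding set_filter list.set by blast
  qed
  show "fps_nth tri_fps 0 = 2" "fps_nth tri_fps 1 = 2" "fps_nth tri_fps 2 = 0" "fps_nth tri_fps 3 = 2"
    unfolding tri_fps_def gen_fps_def fps_nth_Abs_fps by (subst *; simp)+
qed
lemma sq_fps_pow_2:
  "fps_nth (sq_fps ^ 2) 0 = 1" "fps_nth (sq_fps ^ 2) 1 = 4" "fps_nth (sq_fps ^ 2) 2 = 4" "fps_nth (sq_fps ^ 2) 3 = 0" "fps_nth (sq_fps ^ 2) 4 = 4" "fps_nth (sq_fps ^ 2) 5 = 8" "fps_nth (sq_fps ^ 2) 6 = 0" "fps_nth (sq_fps ^ 2) 7 = 0" "fps_nth (sq_fps ^ 2) 8 = 4"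
proof -
  have e: "sq_fps ^ 2 = sq_fps * sq_fps" by (rule power2_eq_square)
  show "fps_nth (sq_fps ^ 2) 0 = 1" "fps_nth (sq_fps ^ 2) 1 = 4" "fps_nth (sq_fps ^ 2) 2 = 4" "fps_nth (sq_fps ^ 2) 3 = 0" "fps_nth (sq_fps ^ 2) 4 = 4" "fps_nth (sq_fps ^ 2) 5 = 8" "fps_nth (sq_fps ^ 2) 6 = 0" "fps_nth (sq_fps ^ 2) 7 = 0" "fps_nth (sq_fps ^ 2) 8 = 4"
    unfolding e by (simp_all only: fps_mult_nth_upto8 sq_fps_nth sq_fps_nth) simp_all
qed
lemma sq_fps_pow_3:
  "fps_nth (sq_fps ^ 3) 0 = 1" "fps_nth (sq_fps ^ 3) 1 = 6" "fps_nth (sq_fps ^ 3) 2 = 12" "fps_nth (sq_fps ^ 3) 3 = 8" "fps_nth (sq_fps ^ 3) 4 = 6" "fps_nth (sq_fps ^ 3) 5 = 24" "fps_nth (sq_fps ^ 3) 6 = 24" "fps_nth (sq_fps ^ 3) 7 = 0" "fps_nth (sq_fps ^ 3) 8 = 12"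
proof -
  have e: "sq_fps ^ 3 = sq_fps ^ 2 * sq_fps" by (simp add: power2_eq_square power3_eq_cube)
  show "fps_nth (sq_fps ^ 3) 0 = 1" "fps_nth (sq_fps ^ 3) 1 = 6" "fps_nth (sq_fps ^ 3) 2 = 12" "fps_nth (sq_fps ^ 3) 3 = 8" "fps_nth (sq_fps ^ 3) 4 = 6" "fps_nth (sq_fps ^ 3) 5 = 24" "fps_nth (sq_fps ^ 3) 6 = 24" "fps_nth (sq_fps ^ 3) 7 = 0" "fps_nth (sq_fps ^ 3) 8 = 12"
    unfolding e by (simp_all only: fps_mult_nth_upto8 sq_fps_pow_2 sq_fps_nth) simp_all
qed
lemma sq_fps_pow_6:
  "fps_nth (sq_fps ^ 6) 0 = 1" "fps_nth (sq_fps ^ 6) 1 = 12" "fps_nth (sq_fps ^ 6) 2 = 60" "fps_nth (sq_fps ^ 6) 3 = 160" "fps_nth (sq_fps ^ 6) 4 = 252" "fps_nth (sq_fps ^ 6) 5 = 312" "fps_nth (sq_fps ^ 6) 6 = 544" "fps_nth (sq_fps ^ 6) 7 = 960" "fps_nth (sq_fps ^ 6) 8 = 1020"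
proof -
  have e: "sq_fps ^ 6 = sq_fps ^ 3 * sq_fps ^ 3" by (simp flip: power_add)
  show "fps_nth (sq_fps ^ 6) 0 = 1" "fps_nth (sq_fps ^ 6) 1 = 12" "fps_nth (sq_fps ^ 6) 2 = 60" "fps_nth (sq_fps ^ 6) 3 = 160" "fps_nth (sq_fps ^ 6) 4 = 252" "fps_nth (sq_fps ^ 6) 5 = 312" "fps_nth (sq_fps ^ 6) 6 = 544" "fps_nth (sq_fps ^ 6) 7 = 960" "fps_nth (sq_fps ^ 6) 8 = 1020"
    unfolding e by (simp_all only: fps_mult_nth_upto8 sq_fps_pow_3 sq_fps_pow_3) simp_all
qed
lemma sq_fps_pow_12:
  "fps_nth (sq_fps ^ 12) 0 = 1" "fps_nth (sq_fps ^ 12) 1 = 24" "fps_nth (sq_fps ^ 12) 2 = 264" "fps_nth (sq_fps ^ 12) 3 = 1760" "fps_nth (sq_fps ^ 12) 4 = 7944" "fps_nth (sq_fps ^ 12) 5 = 25872" "fps_nth (sq_fps ^ 12) 6 = 64416" "fps_nth (sq_fps ^ 12) 7 = 133056" "fps_nth (sq_fps ^ 12) 8 = 253704"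
proof -
  have e: "sq_fps ^ 12 = sq_fps ^ 6 * sq_fps ^ 6" by (simp flip: power_add)
  show "fps_nth (sq_fps ^ 12) 0 = 1" "fps_nth (sq_fps ^ 12) 1 = 24" "fps_nth (sq_fps ^ 12) 2 = 264" "fps_nth (sq_fps ^ 12) 3 = 1760" "fps_nth (sq_fps ^ 12) 4 = 7944" "fps_nth (sq_fps ^ 12) 5 = 25872" "fps_nth (sq_fps ^ 12) 6 = 64416" "fps_nth (sq_fps ^ 12) 7 = 133056" "fps_nth (sq_fps ^ 12) 8 = 253704"
    unfolding e by (simp_all only: fps_mult_nth_upto8 sq_fps_pow_6 sq_fps_pow_6) simp_all
qed
lemma sq_fps_pow_24:
  "fps_nth (sq_fps ^ 24) 0 = 1" "fps_nth (sq_fps ^ 24) 1 = 48" "fps_nth (sq_fps ^ 24) 2 = 1104" "fps_nth (sq_fps ^ 24) 3 = 16192" "fps_nth (sq_fps ^ 24) 4 = 170064" "fps_nth (sq_fps ^ 24) 5 = 1362336" "fps_nth (sq_fps ^ 24) 6 = 8662720" "fps_nth (sq_fps ^ 24) 7 = 44981376" "fps_nth (sq_fps ^ 24) 8 = 195082320"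
proof -
  have e: "sq_fps ^ 24 = sq_fps ^ 12 * sq_fps ^ 12" by (simp flip: power_add)
  show "fps_nth (sq_fps ^ 24) 0 = 1" "fps_nth (sq_fps ^ 24) 1 = 48" "fps_nth (sq_fps ^ 24) 2 = 1104" "fps_nth (sq_fps ^ 24) 3 = 16192" "fps_nth (sq_fps ^ 24) 4 = 170064" "fps_nth (sq_fps ^ 24) 5 = 1362336" "fps_nth (sq_fps ^ 24) 6 = 8662720" "fps_nth (sq_fps ^ 24) 7 = 44981376" "fps_nth (sq_fps ^ 24) 8 = 195082320"
    unfolding e by (simp_all only: fps_mult_nth_upto8 sq_fps_pow_12 sq_fps_pow_12) simp_all
qed
lemma tri_fps_pow_2:
  "fps_nth (tri_fps ^ 2) 0 = 4" "fps_nth (tri_fps ^ 2) 1 = 8" "fps_nth (tri_fps ^ 2) 2 = 4" "fps_nth (tri_fps ^ 2) 3 = 8"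
proof -
  have e: "tri_fps ^ 2 = tri_fps * tri_fps" by (rule power2_eq_square)
  show "fps_nth (tri_fps ^ 2) 0 = 4" "fps_nth (tri_fps ^ 2) 1 = 8" "fps_nth (tri_fps ^ 2) 2 = 4" "fps_nth (tri_fps ^ 2) 3 = 8"
    unfolding e by (simp_all only: fps_mult_nth_upto8 tri_fps_nth tri_fps_nth) simp_all
qed
lemma tri_fps_pow_4:
  "fps_nth (tri_fps ^ 4) 0 = 16" "fps_nth (tri_fps ^ 4) 1 = 64" "fps_nth (tri_fps ^ 4) 2 = 96" "fps_nth (tri_fps ^ 4) 3 = 128"
proof -
  have e: "tri_fps ^ 4 = tri_fps ^ 2 * tri_fps ^ 2" by (simp flip: power_add)
  show "fps_nth (tri_fps ^ 4) 0 = 16" "fps_nth (tri_fps ^ 4) 1 = 64" "fps_nth (tri_fps ^ 4) 2 = 96" "fps_nth (tri_fps ^ 4) 3 = 128"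
    unfolding e by (simp_all only: fps_mult_nth_upto8 tri_fps_pow_2 tri_fps_pow_2) simp_all
qed
lemma tri_fps_pow_8:
  "fps_nth (tri_fps ^ 8) 0 = 256" "fps_nth (tri_fps ^ 8) 1 = 2048" "fps_nth (tri_fps ^ 8) 2 = 7168" "fps_nth (tri_fps ^ 8) 3 = 16384"
proof -
  have e: "tri_fps ^ 8 = tri_fps ^ 4 * tri_fps ^ 4" by (simp flip: power_add)
  show "fps_nth (tri_fps ^ 8) 0 = 256" "fps_nth (tri_fps ^ 8) 1 = 2048" "fps_nth (tri_fps ^ 8) 2 = 7168" "fps_nth (tri_fps ^ 8) 3 = 16384"
    unfolding e by (simp_all only: fps_mult_nth_upto8 tri_fps_pow_4 tri_fps_pow_4) simp_all
qed
lemma tri_fps_pow_24: "fps_nth (tri_fps ^ 24) 0 = 16777216" "fps_nth (tri_fps ^ 24) 1 = 402653184"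
proof -
  have e: "tri_fps ^ 24 = tri_fps ^ 8 * (tri_fps ^ 8 * tri_fps ^ 8)" by (simp flip: power_add)
  show "fps_nth (tri_fps ^ 24) 0 = 16777216" "fps_nth (tri_fps ^ 24) 1 = 402653184"
    unfolding e by (simp_all only: fps_mult_nth_upto8 tri_fps_pow_8) simp_all
qed
definition alt_fps :: "complex fps" where "alt_fps = sq_fps * sq_fps'"

lemma sq_sq'_nth:
  "fps_nth alt_fps 0 = 1" "fps_nth alt_fps 1 = 0" "fps_nth alt_fps 2 = - 4" "fps_nth alt_fps 3 = 0" "fps_nth alt_fps 4 = 4" "fps_nth alt_fps 5 = 0" "fps_nth alt_fps 6 = 0" "fps_nth alt_fps 7 = 0" "fps_nth alt_fps 8 = 4"
  by (simp_all only: alt_fps_def fps_mult_nth_upto8 sq_fps'_def fps_nth_Abs_fps sq_fps_nth) simp_all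
lemma sq_sq'_pow_2:
  "fps_nth (alt_fps ^ 2) 0 = 1" "fps_nth (alt_fps ^ 2) 1 = 0" "fps_nth (alt_fps ^ 2) 2 = - 8" "fps_nth (alt_fps ^ 2) 3 = 0" "fps_nth (alt_fps ^ 2) 4 = 24" "fps_nth (alt_fps ^ 2) 5 = 0" "fps_nth (alt_fps ^ 2) 6 = - 32" "fps_nth (alt_fps ^ 2) 7 = 0" "fps_nth (alt_fps ^ 2) 8 = 24"
proof -
  have e: "alt_fps ^ 2 = alt_fps * alt_fps" by (rule power2_eq_square)
  show "fps_nth (alt_fps ^ 2) 0 = 1" "fps_nth (alt_fps ^ 2) 1 = 0" "fps_nth (alt_fps ^ 2) 2 = - 8" "fps_nth (alt_fps ^ 2) 3 = 0" "fps_nth (alt_fps ^ 2) 4 = 24" "fps_nth (alt_fps ^ 2) 5 = 0" "fps_nth (alt_fps ^ 2) 6 = - 32" "fps_nth (alt_fps ^ 2) 7 = 0" "fps_nth (alt_fps ^ 2) 8 = 24"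
    unfolding e by (simp_all only: fps_mult_nth_upto8 sq_sq'_nth) simp_all
qed
lemma sq_sq'_pow_4:
  "fps_nth (alt_fps ^ 4) 0 = 1" "fps_nth (alt_fps ^ 4) 1 = 0" "fps_nth (alt_fps ^ 4) 2 = - 16" "fps_nth (alt_fps ^ 4) 3 = 0" "fps_nth (alt_fps ^ 4) 4 = 112" "fps_nth (alt_fps ^ 4) 5 = 0" "fps_nth (alt_fps ^ 4) 6 = - 448" "fps_nth (alt_fps ^ 4) 7 = 0" "fps_nth (alt_fps ^ 4) 8 = 1136"
proof -
  have e: "alt_fps ^ 4 = (alt_fps ^ 2) * (alt_fps ^ 2)" by (simp flip: power_add)
  show "fps_nth (alt_fps ^ 4) 0 = 1" "fps_nth (alt_fps ^ 4) 1 = 0" "fps_nth (alt_fps ^ 4) 2 = - 16" "fps_nth (alt_fps ^ 4) 3 = 0" "fps_nth (alt_fps ^ 4) 4 = 112" "fps_nth (alt_fps ^ 4) 5 = 0" "fps_nth (alt_fps ^ 4) 6 = - 448" "fps_nth (alt_fps ^ 4) 7 = 0" "fps_nth (alt_fps ^ 4) 8 = 1136"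
    unfolding e by (simp_all only: fps_mult_nth_upto8 sq_sq'_pow_2) simp_all
qed
lemma sq_sq'_pow_8:
  "fps_nth (alt_fps ^ 8) 0 = 1" "fps_nth (alt_fps ^ 8) 1 = 0" "fps_nth (alt_fps ^ 8) 2 = - 32" "fps_nth (alt_fps ^ 8) 3 = 0" "fps_nth (alt_fps ^ 8) 4 = 480" "fps_nth (alt_fps ^ 8) 5 = 0" "fps_nth (alt_fps ^ 8) 6 = - 4480" "fps_nth (alt_fps ^ 8) 7 = 0" "fps_nth (alt_fps ^ 8) 8 = 29152"
proof -
  have e: "alt_fps ^ 8 = (alt_fps ^ 4) * (alt_fps ^ 4)" by (simp flip: power_add)
  show "fps_nth (alt_fps ^ 8) 0 = 1" "fps_nth (alt_fps ^ 8) 1 = 0" "fps_nth (alt_fps ^ 8) 2 = - 32" "fps_nth (alt_fps ^ 8) 3 = 0" "fps_nth (alt_fps ^ 8) 4 = 480" "fps_nth (alt_fps ^ 8) 5 = 0" "fps_nth (alt_fps ^ 8) 6 = - 4480" "fps_nth (alt_fps ^ 8) 7 = 0" "fps_nth (alt_fps ^ 8) 8 = 29152"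
    unfolding e by (simp_all only: fps_mult_nth_upto8 sq_sq'_pow_4) simp_all
qed
text \<open>Since \<open>fps_even\<close> halves indices, the powers of the theta constants are
  needed up to index 8. The constant \<open>69/16\<close> is \<open>1104/256\<close>: it cancels the
  coefficient 1104 of \<open>q\<close> in the first summand, in accordance with the absence of
  vectors of norm 2.\<close>

lemma leech_fps_nth:
  "fps_nth leech_fps 0 = 1" "fps_nth leech_fps 1 = 0" "fps_nth leech_fps 2 = 196560"
  "fps_nth leech_fps 3 = 16773120" "fps_nth leech_fps 4 = 398034000"
proof -
  have ev: "fps_nth (fps_even f) n = fps_nth f (2 * n)" for f n by (simp add: fps_even_def)
  have X: "fps_nth (fps_X * f) 0 = 0" "fps_nth (fps_X * f) 1 = fps_nth f 0" "fps_nth (fps_X * f) 2 = fps_nth f 1"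
     "fps_nth (fps_X * f) 3 = fps_nth f 2" "fps_nth (fps_X * f) 4 = fps_nth f 3" for f :: "complex fps"
    by simp_all
  have X3: "fps_nth (fps_X ^ 3 * f) 0 = 0" "fps_nth (fps_X ^ 3 * f) 1 = 0" "fps_nth (fps_X ^ 3 * f) 2 = 0"
     "fps_nth (fps_X ^ 3 * f) 3 = fps_nth f 0" "fps_nth (fps_X ^ 3 * f) 4 = fps_nth f 1" for f :: "complex fps"
    by (simp_all add: fps_X_power_mult_nth)
  have m2: "2 * 0 = (0::nat)" "2 * 1 = (2::nat)" "2 * 2 = (4::nat)" "2 * 3 = (6::nat)" "2 * 4 = (8::nat)" by simp_all
  show "fps_nth leech_fps 0 = 1" "fps_nth leech_fps 1 = 0" "fps_nth leech_fps 2 = 196560"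
    "fps_nth leech_fps 3 = 16773120" "fps_nth leech_fps 4 = 398034000"
    unfolding leech_fps_def alt_fps_def[symmetric]
    by (simp_all only: fps_sub_nth fps_add_nth fps_mult_left_const_nth ev X X3 mult.assoc m2
         sq_fps_pow_24 tri_fps_pow_24 fps_mult_nth_upto8(1-4) tri_fps_pow_8 sq_sq'_pow_8) simp_all
qed

section \<open>Shells of the Leech lattice\<close>

definition realmat :: "int ^'n ^'m \<Rightarrow> real ^'n ^'m" where
  "realmat A = (\<chi> i j. of_int (A $ i $ j))"

lemma realmat_inject: "realmat A = realmat B \<longleftrightarrow> A = B"
  by (simp add: realmat_def vec_eq_iff)

lemma realmat_mult: "realmat (A ** B) = realmat A ** realmat B"
  by (simp add: realmat_def matrix_matrix_mult_def vec_eq_iff)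

lemma realmat_mat_1: "realmat (mat 1) = mat 1"
  by (simp add: realmat_def mat_def vec_eq_iff)

lemma det_realmat: "det (realmat A) = of_int (det A)"
  by (simp add: det_def realmat_def)

text \<open>Cramer's rule over the reals. \<open>M\<close> is the adjugate, whose entries are
  integral determinants, and \<open>det L = 1\<close> leaves no denominator.\<close>

lemma int_matrix_inverse:
  fixes L :: "int ^'n ^'n"
  assumes "det L = 1"
  obtains M where "L ** M = mat 1" "M ** L = mat 1"
proof -
  have d: "det (realmat L) = 1" by (simp add: det_realmat assms)
  define M where "M = (\<chi> k j. det (\<chi> i l. if l = k then (if i = j then 1 else 0) else L $ i $ l))"
  have "realmat L *v (\<chi> k. of_int (M $ k $ j)) = axis j 1" for j
  proof -
    have "(\<chi> k. real_of_int (M $ k $ j)) = (\<chi> k. det (\<chi> i l. if l = k then axis j 1 $ i else realmat L $ i $ l) / det (realmat L))"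
    proof (subst vec_eq_iff, intro allI)
      fix k
      have "(\<chi> i l. if l = k then axis j 1 $ i else realmat L $ i $ l) = realmat (\<chi> i l. if l = k then (if i = j then 1 else 0) else L $ i $ l)"
        by (auto simp: realmat_def vec_eq_iff axis_def)
      thus "(\<chi> k. real_of_int (M $ k $ j)) $ k = (\<chi> k. det (\<chi> i l. if l = k then axis j 1 $ i else realmat L $ i $ l) / det (realmat L)) $ k"
        by (simp add: M_def det_realmat assms)
    qed
    thus ?thesis using cramer[of "realmat L" _ "axis j 1"] d by simp
  qed
  hence "realmat L ** realmat M = mat 1"
    by (simp add: vec_eq_iff matrix_matrix_mult_def matrix_vector_mult_def realmat_def mat_def axis_def)
  moreover hence "realmat M ** realmat L = mat 1" by (simp add: matrix_left_right_inverse)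
  ultimately show ?thesis using that[of M] by (simp add: realmat_mult[symmetric] realmat_mat_1[symmetric] realmat_inject)
qed

text \<open>Transported from the list version along an enumeration of the index type; determinant 1
  makes multiplication by \<open>L\<close> a bijection of the integer vectors.\<close>

lemma theta_inversion:
  fixes L :: "int ^'n ^'n"
  assumes sym: "transpose L = L" and pos: "\<And>x. x \<noteq> 0 \<Longrightarrow> qform L x > 0" and det: "det L = 1" and t: "t > 0"
  shows "(\<lambda>x. exp (- pi * t * of_int (qform L x))) summable_on UNIV"
    and "(\<Sum>\<^sub>\<infinity>x. exp (- pi * of_int (qform L x) / t)) = sqrt t ^ CARD('n) * (\<Sum>\<^sub>\<infinity>x. exp (- pi * t * of_int (qform L x)))"
proof -
  define k where "k = CARD('n)"
  obtain e where e: "bij_betw e {..<k} (UNIV :: 'n set)"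
    using ex_bij_betw_nat_finite[of "UNIV :: 'n set"] unfolding k_def lessThan_atLeast0 by auto
  define d where "d = the_inv_into {..<k} e"
  have de: "d (e i) = i" if "i < k" for i
    unfolding d_def by (rule the_inv_into_f_f) (use e that in \<open>auto simp: bij_betw_def\<close>)
  have ed: "e (d j) = j" "d j < k" for j
    using f_the_inv_into_f_bij_betw[OF e, of j] the_inv_into_into[of e "{..<k}" j] e by (auto simp: d_def bij_betw_def)
  define A where "A = (\<lambda>i j. L $ e i $ e j)"
  define v where "v = (\<lambda>x :: int list. (\<chi> j. x ! d j) :: int ^'n)"
  define l where "l = (\<lambda>y :: int ^'n. map (\<lambda>i. y $ e i) [0..<k])"
  have vl: "v (l y) = y" for y using ed by (simp add: v_def l_def vec_eq_iff)
  have lv: "l (v x) = x" if "length x = k" for x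
    by (rule nth_equalityI) (use that de in \<open>auto simp: v_def l_def\<close>)
  have ll: "length (l y) = k" for y by (simp add: l_def)
  have bl: "bij_betw l UNIV {x. length x = k}"
    by (rule bij_betwI[of _ _ _ v]) (auto simp: vl lv ll)
  have reind: "(\<Sum>i<k. f (e i)) = (\<Sum>j\<in>UNIV. f j)" for f :: "'n \<Rightarrow> int"
    by (rule sum.reindex_bij_betw[OF e])
  have qf: "(\<Sum>i<k. \<Sum>j<k. l y ! i * A i j * l y ! j) = qform L y" for y
  proof -
    have "(\<Sum>i<k. \<Sum>j<k. l y ! i * A i j * l y ! j) = (\<Sum>i<k. \<Sum>j<k. y $ e i * L $ e i $ e j * y $ e j)"
      by (intro sum.cong refl) (simp add: l_def A_def)
    also have "\<dots> = qform L y"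
      unfolding qform_def reind[of "\<lambda>j. y $ e i * L $ e i $ j * y $ j" for i] by (rule reind)
    finally show ?thesis .
  qed
  have symA: "A i j = A j i" for i j
    using sym unfolding A_def by (metis transpose_def vec_lambda_beta)
  have posA: "0 < (\<Sum>i<k. \<Sum>j<k. y i * A i j * y j)" if "\<exists>i<k. y i \<noteq> 0" for y :: "nat \<Rightarrow> int"
  proof -
    define z where "z = v (map y [0..<k])"
    have lz: "l z = map y [0..<k]" unfolding z_def by (rule lv) simp
    have "z \<noteq> 0"
    proof
      assume "z = 0"
      hence "map y [0..<k] = l 0" using lz by simp
      hence "y i = 0" if "i < k" for i using that arg_cong[of "map y [0..<k]" "l 0" "\<lambda>xs. xs ! i"] by (simp add: l_def)
      thus False using that by blast
    qed
    hence "0 < (\<Sum>i<k. \<Sum>j<k. l z ! i * A i j * l z ! j)" using pos qf by simp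
    also have "\<dots> = (\<Sum>i<k. \<Sum>j<k. y i * A i j * y j)" unfolding lz by (intro sum.cong refl) simp
    finally show ?thesis .
  qed
  obtain M where M: "L ** M = mat 1" "M ** L = mat 1" using int_matrix_inverse[OF det] .
  have "bij (\<lambda>x. L *v x)"
    by (rule bijI'[of "\<lambda>x. L *v x", OF _ exI[of _ "M *v y" for y]])
       (metis M matrix_vector_mul_assoc matrix_vector_mul_lid, simp add: matrix_vector_mul_assoc M)
  hence "bij_betw (\<lambda>x. l (L *v x)) UNIV {x. length x = k}"
    using bij_betw_trans[OF _ bl, unfolded o_def] by blast
  moreover have bv: "bij_betw v {x. length x = k} UNIV"
    by (rule bij_betwI[of _ _ _ l]) (auto simp: vl lv ll)
  ultimately have "bij_betw (\<lambda>x. l (L *v v x)) {x. length x = k} {x. length x = k}"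
    using bij_betw_trans[OF bv, unfolded o_def] by fast
  moreover have "l (L *v v x) = map (\<lambda>i. \<Sum>j<k. A i j * x ! j) [0..<k]" if "length x = k" for x
  proof -
    have "(L *v v x) $ e i = (\<Sum>j<k. A i j * x ! j)" for i
    proof -
      have "(L *v v x) $ e i = (\<Sum>j<k. L $ e i $ e j * v x $ e j)"
        unfolding matrix_vector_mult_def reind[of "\<lambda>j. L $ e i $ j * v x $ j"] by simp
      also have "\<dots> = (\<Sum>j<k. A i j * x ! j)" by (intro sum.cong refl) (simp add: A_def v_def de)
      finally show ?thesis .
    qed
    thus ?thesis by (simp add: l_def)
  qed
  ultimately have bij: "bij_betw (\<lambda>x. map (\<lambda>i. \<Sum>j<k. A i j * x ! j) [0..<k]) {x. length x = k} {x. length x = k}"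
    by (subst bij_betw_cong[symmetric, of _ "\<lambda>x. l (L *v v x)"]) auto
  have T1: "(\<lambda>x. exp (- pi * t * real_of_int (\<Sum>i<k. \<Sum>j<k. x ! i * A i j * x ! j))) summable_on {x. length x = k}"
    by (rule theta_inversion_lists(1)[OF symA _ bij t]) (rule posA)
  have T2: "(\<Sum>\<^sub>\<infinity>x\<in>{x. length x = k}. exp (- pi * real_of_int (\<Sum>i<k. \<Sum>j<k. x ! i * A i j * x ! j) / t)) =
     sqrt t ^ k * (\<Sum>\<^sub>\<infinity>x\<in>{x. length x = k}. exp (- pi * t * real_of_int (\<Sum>i<k. \<Sum>j<k. x ! i * A i j * x ! j)))"
    by (rule theta_inversion_lists(2)[OF symA _ bij t]) (rule posA)
  show "(\<lambda>x. exp (- pi * t * of_int (qform L x))) summable_on UNIV"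
    using T1 unfolding summable_on_reindex_bij_betw[OF bl, symmetric] qf .
  show "(\<Sum>\<^sub>\<infinity>x. exp (- pi * of_int (qform L x) / t)) = sqrt t ^ CARD('n) * (\<Sum>\<^sub>\<infinity>x. exp (- pi * t * of_int (qform L x)))"
    using T2 unfolding infsum_reindex_bij_betw[OF bl, symmetric] qf by (simp only: k_def)
qed

text \<open>A positive constant is not summable over an infinite set; finiteness of the shells thus
  comes for free with convergence of the theta series.\<close>

lemma finite_fibre_if_summable:
  fixes v :: "'a \<Rightarrow> nat" and r :: real
  assumes "(\<lambda>x. r ^ v x) summable_on UNIV" "r > 0"
  shows "finite {x. v x = m}"
proof -
  have "(\<lambda>x. r ^ v x) summable_on {x. v x = m}" by (rule summable_on_subset_banach[OF assms(1)]) simp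
  hence "(\<lambda>x::'a. r ^ m) summable_on {x. v x = m}" by (rule summable_on_cong[THEN iffD1, rotated]) auto
  thus ?thesis using infsum_diverge_constant[of "{x. v x = m}" "r ^ m"] assms(2) by auto
qed

lemma qform_even:
  fixes L :: "int ^'n ^'n"
  assumes "transpose L = L" "\<And>i. even (L $ i $ i)"
  shows "even (qform L x)"
proof -
  define f where "f = (\<lambda>i j. x $ i * L $ i $ j * x $ j)"
  have sym: "f i j = f j i" for i j
    using assms(1) unfolding f_def by (metis (no_types, lifting) mult.assoc mult.commute transpose_def vec_lambda_beta)
  have "even (\<Sum>i\<in>S. \<Sum>j\<in>S. f i j)" if "finite S" for S
    using that
  proof (induction S rule: finite_induct)
    case (insert a S)
    have "(\<Sum>i\<in>insert a S. \<Sum>j\<in>insert a S. f i j) = f a a + (\<Sum>j\<in>S. f a j) + (\<Sum>i\<in>S. f i a) + (\<Sum>i\<in>S. \<Sum>j\<in>S. f i j)"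
      using insert by (simp add: sum.distrib algebra_simps)
    also have "(\<Sum>i\<in>S. f i a) = (\<Sum>j\<in>S. f a j)" by (intro sum.cong refl sym)
    finally show ?case using insert assms(2) by (simp add: f_def)
  qed simp
  thus ?thesis unfolding qform_def f_def by simp
qed

text \<open>The theta series of \<open>L\<close> and \<open>leech_fps\<close> satisfy the same
  inversion of weight \<open>12 = 24/2\<close>. They agree at \<open>q ^ 0\<close>, where only the
  zero vector counts, and at \<open>q ^ 1\<close>, as there is no norm 2, so the difference has a
  double zero and vanishes. The exponent of \<open>q\<close> is half the norm.\<close>

theorem leech_shell_cards:
  assumes L: "leech_gram L"
  shows "\<And>m. finite {x. qform L x = m}"
    and "card {x. qform L x = 4} = 196560" "card {x. qform L x = 6} = 16773120" "card {x. qform L x = 8} = 398034000"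
proof -
  have sym: "transpose L = L" and pos: "\<And>x. x \<noteq> 0 \<Longrightarrow> qform L x > 0" and ev: "\<And>i. even (L $ i $ i)"
    and det: "det L = 1" and n2: "\<And>x. qform L x \<noteq> 2" using L by (auto simp: leech_gram_def)
  define v where "v = (\<lambda>x. nat (qform L x div 2))"
  have q0: "qform L x \<ge> 0" for x using pos[of x] by (cases "x = 0") (auto simp: qform_def less_imp_le)
  have qv: "qform L x = 2 * int (v x)" for x
    using qform_even[OF sym ev, of x] q0[of x] by (auto simp: v_def)
  have fibre: "{x. v x = m} = {x. qform L x = 2 * int m}" for m by (auto simp: qv)
  have e: "exp (- 2 * pi * t) ^ v x = exp (- pi * t * of_int (qform L x))" for t x
    by (simp add: qv exp_of_nat_mult[symmetric] mult_ac)
  have summ: "(\<lambda>x. r ^ v x) summable_on UNIV" if "0 < r" "r < 1" for r :: real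
  proof -
    define t where "t = - ln r / (2 * pi)"
    have "t > 0" using that by (simp add: t_def divide_neg_pos)
    moreover have "exp (- 2 * pi * t) = r" using that by (simp add: t_def)
    ultimately show ?thesis using theta_inversion(1)[OF sym pos det, of t] e[of t] by simp
  qed
  have fin: "finite {x. v x = m}" for m
    by (rule finite_fibre_if_summable[OF summ[of "1/2"]]) auto
  show "finite {x. qform L x = m}" for m
  proof (cases "m \<ge> 0 \<and> even m")
    case True
    hence "m = 2 * int (nat (m div 2))" by auto
    thus ?thesis using fin[of "nat (m div 2)"] unfolding fibre by simp
  next
    case False
    hence "{x. qform L x = m} = {}" using qv by auto
    thus ?thesis by simp
  qed
  define G where "G = gen_fps v"
  have conv: "fps_conv_radius G \<ge> 1" unfolding G_def by (rule gen_fps(1)[OF fin summ])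
  have ev_G: "eval_fps G (of_real (exp (- 2 * pi * t))) = of_real (\<Sum>\<^sub>\<infinity>x. exp (- pi * t * of_int (qform L x)))" if "t > 0" for t
  proof -
    have "eval_fps G (of_real (exp (- 2 * pi * t))) = (\<Sum>\<^sub>\<infinity>x. complex_of_real (exp (- 2 * pi * t)) ^ v x)"
      unfolding G_def by (rule gen_fps(2)[OF fin summ]) (use that in auto)
    also have "\<dots> = (\<Sum>\<^sub>\<infinity>x. complex_of_real (exp (- pi * t * of_int (qform L x))))"
      by (simp only: of_real_power[symmetric] e)
    also have "\<dots> = of_real (\<Sum>\<^sub>\<infinity>x. exp (- pi * t * of_int (qform L x)))"
      by (intro infsumI has_sum_of_real has_sum_infsum theta_inversion(1)[OF sym pos det that])
    finally show ?thesis .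
  qed
  have inv: "eval_fps G (of_real (exp (- 2 * pi / t))) = of_real (t ^ 12) * eval_fps G (of_real (exp (- 2 * pi * t)))" if t: "t > 0" for t
  proof -
    have "eval_fps G (of_real (exp (- 2 * pi / t))) = of_real (\<Sum>\<^sub>\<infinity>x. exp (- pi * of_int (qform L x) / t))"
      using ev_G[of "1 / t"] t by simp
    also have "\<dots> = of_real (sqrt t ^ 24 * (\<Sum>\<^sub>\<infinity>x. exp (- pi * t * of_int (qform L x))))"
      using theta_inversion(2)[OF sym pos det t] by simp
    also have "sqrt t ^ 24 = t ^ 12"
    proof -
      have "sqrt t ^ 24 = (sqrt t ^ 2) ^ 12" by (simp only: power_mult[symmetric]) simp
      thus ?thesis using t by simp
    qed
    finally show ?thesis using ev_G[OF t] by simp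
  qed
  have G_nth: "fps_nth G m = of_nat (card {x. qform L x = 2 * int m})" for m
    by (simp add: G_def gen_fps_def fibre)
  have "G - leech_fps = 0"
  proof (rule weight12_order2_eq_0)
    show "fps_conv_radius (G - leech_fps) \<ge> 1" by (intro fps_conv_ge1 conv leech_fps_conv)
    show "eval_fps (G - leech_fps) (of_real (exp (- 2 * pi / t))) = of_real (t ^ 12) * eval_fps (G - leech_fps) (of_real (exp (- 2 * pi * t)))" if t: "t > 0" for t
    proof -
      have n: "norm (complex_of_real (exp (- 2 * pi / t))) < 1" "norm (complex_of_real (exp (- 2 * pi * t))) < 1" using t by auto
      show ?thesis
        unfolding eval_fps_diff[OF norm_lt_conv_ge1[OF conv n(1)] norm_lt_conv_ge1[OF leech_fps_conv n(1)]]
          eval_fps_diff[OF norm_lt_conv_ge1[OF conv n(2)] norm_lt_conv_ge1[OF leech_fps_conv n(2)]] inv[OF t] leech_fps_inv[OF t]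
        by (simp add: right_diff_distrib)
    qed
    have q00: "qform L 0 = 0" by (simp add: qform_def)
    have "qform L x = 0 \<longleftrightarrow> x = 0" for x using q00 pos[of x] by (cases "x = 0") auto
    hence "{x. qform L x = 0} = {0}" by simp
    thus "fps_nth (G - leech_fps) 0 = 0" by (simp add: G_nth leech_fps_nth)
    have "{x. qform L x = 2} = {}" using n2 by auto
    moreover have "fps_nth (G - leech_fps) 1 = of_nat (card {x. qform L x = 2 * int 1})"
      unfolding fps_sub_nth G_nth[of 1] leech_fps_nth(2) by (rule diff_0_right)
    ultimately show "fps_nth (G - leech_fps) 1 = 0" by (simp only: of_nat_1 mult_1_right card.empty of_nat_0)
  qed
  hence GL: "G = leech_fps" by simp
  have c: "(of_nat (card {x. qform L x = 2 * int m}) :: complex) = fps_nth leech_fps m" for m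
    using G_nth[of m] GL by simp
  have num: "a = numeral n" if "(of_nat a :: complex) = numeral n" for a n
    using that by (metis of_nat_eq_iff of_nat_numeral)
  have i: "2 * int 2 = 4" "2 * int 3 = 6" "2 * int 4 = 8" by simp_all
  show "card {x. qform L x = 4} = 196560"
    by (rule num) (use c[of 2] in \<open>simp only: i leech_fps_nth(3)\<close>)
  show "card {x. qform L x = 6} = 16773120"
    by (rule num) (use c[of 3] in \<open>simp only: i leech_fps_nth(4)\<close>)
  show "card {x. qform L x = 8} = 398034000"
    by (rule num) (use c[of 4] in \<open>simp only: i leech_fps_nth(5)\<close>)
qed

section \<open>Frames of vectors of norm 8\<close>

definition bil :: "int ^'n ^'n \<Rightarrow> int ^'n \<Rightarrow> int ^'n \<Rightarrow> int" where
  "bil L x y = (\<Sum>i\<in>UNIV. x $ i * (L *v y) $ i)"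

lemma bil_add_left: "bil L (x + y) z = bil L x z + bil L y z"
  and bil_diff_left: "bil L (x - y) z = bil L x z - bil L y z"
  and bil_minus_left: "bil L (- x) z = - bil L x z"
  and bil_scale_left: "bil L (c *s x) z = c * bil L x z"
  by (simp_all add: bil_def algebra_simps sum.distrib sum_subtractf sum_negf sum_distrib_left)

lemma bil_sym:
  assumes "transpose L = L"
  shows "bil L x y = bil L y x"
proof -
  have l: "L $ i $ j = L $ j $ i" for i j using assms by (metis transpose_def vec_lambda_beta)
  have "bil L x y = (\<Sum>i\<in>UNIV. \<Sum>j\<in>UNIV. y $ j * L $ j $ i * x $ i)"
    unfolding bil_def matrix_vector_mult_def by (simp add: sum_distrib_left l[of _ _] mult_ac)
  also have "\<dots> = bil L y x"
    unfolding bil_def matrix_vector_mult_def by (subst sum.swap) (simp add: sum_distrib_left mult_ac)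
  finally show ?thesis .
qed

lemma bil_add_right: "bil L x (y + z) = bil L x y + bil L x z"
  and bil_diff_right: "bil L x (y - z) = bil L x y - bil L x z"
  and bil_minus_right: "bil L x (- y) = - bil L x y"
  and bil_scale_right: "bil L x (c *s y) = c * bil L x y"
  by (simp_all add: bil_def matrix_vector_mult_def algebra_simps sum.distrib sum_subtractf sum_negf sum_distrib_left)

lemma qform_bil: "qform L x = bil L x x"
  by (simp add: qform_def bil_def matrix_vector_mult_def sum_distrib_left mult_ac)

lemma card_eq_sum_fibres:
  "finite V \<Longrightarrow> card V = (\<Sum>c\<in>p ` V. card {x \<in> V. p x = c})"
  using sum.image_gen[of V "\<lambda>_. 1::nat" p] by simp

text \<open>Vector entries are coefficients in a lattice basis, so the parity condition is
  congruence modulo \<open>2L\<close>. Divided by \<open>sqrt 8\<close>, a frame gives the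
  orthonormal axes of the usual Leech coordinates.\<close>

definition is_frame :: "int ^24 ^24 \<Rightarrow> (24 \<Rightarrow> int ^24) \<Rightarrow> bool" where
  "is_frame L f \<longleftrightarrow> (\<forall>i j. bil L (f i) (f j) = (if i = j then 8 else 0)) \<and> (\<forall>i j k. even (f i $ k - f j $ k))"

text \<open>Conway's count: by the minimal norm a class of \<open>L/2L\<close> meets the vectors of norm at most 6 in at most one pair
  \<open>\<plusminus>x\<close>, so there are too few classes left if none of them contains 48 vectors of norm 8.\<close>

theorem frame_exists:
  assumes L: "leech_gram L"
  shows "\<exists>f. is_frame L f"
proof -
  have sym: "transpose L = L" and pos: "\<And>x. x \<noteq> 0 \<Longrightarrow> qform L x > 0" and evL: "\<And>i. even (L $ i $ i)"
    and n2: "\<And>x. qform L x \<noteq> 2" using L by (auto simp: leech_gram_def)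
  define par where "par = (\<lambda>x :: int ^24. \<lambda>k. odd (x $ k))"
  define V where "V = (\<lambda>m. {x. qform L x = m})"
  have finV: "finite (V m)" for m unfolding V_def by (rule leech_shell_cards(1)[OF L])
  have qm: "qform L (- x) = qform L x" for x by (simp add: qform_bil bil_minus_left bil_minus_right)
  have q4: "qform L z \<ge> 4" if "z \<noteq> 0" for z
    using pos[OF that] n2[of z] qform_even[OF sym evL, of z] by presburger
  \<comment> \<open>The difference is \<open>2 *s z\<close> with \<open>z\<close> nonzero, hence of
    norm at least \<open>4 * 4\<close>.\<close>
  have q16: "qform L (x - y) \<ge> 16" if "par x = par y" "x \<noteq> y" for x y
  proof -
    define z where "z = (\<chi> k. (x $ k - y $ k) div 2)"
    have "even (x $ k - y $ k)" for k using fun_cong[OF that(1), of k] by (simp add: par_def)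
    hence xy: "x - y = 2 *s z" by (simp add: vec_eq_iff z_def)
    have "z \<noteq> 0" using that(2) xy by auto
    thus ?thesis unfolding xy qform_bil bil_scale_left bil_scale_right using q4[of z] by (simp add: qform_bil)
  qed
  have pm: "par (- x) = par x" for x by (simp add: par_def)
  have sum16: "qform L x + qform L y \<ge> 16 \<and> (qform L x + qform L y = 16 \<longrightarrow> bil L x y = 0)"
    if "par x = par y" "x \<noteq> y" "x \<noteq> - y" for x y
  proof -
    have "qform L (x - y) \<ge> 16" by (rule q16) (use that in auto)
    moreover have "qform L (x - (- y)) \<ge> 16" by (rule q16) (use that pm in auto)
    moreover have "qform L (x - y) = qform L x + qform L y - 2 * bil L x y"
      "qform L (x - (- y)) = qform L x + qform L y + 2 * bil L x y"
      using bil_sym[OF sym, of x y]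
      by (simp_all add: qform_bil bil_diff_left bil_diff_right bil_minus_left bil_minus_right bil_add_left bil_add_right)
    ultimately show ?thesis by linarith
  qed
  have neg_ne: "x \<noteq> - x" if "x \<in> V m" "m > 0" for x m
  proof
    assume "x = - x"
    hence "x = 0" by (auto simp: vec_eq_iff)
    thus False using that by (simp add: V_def qform_bil bil_def)
  qed
  have half: "card (V m) = 2 * card (par ` V m)" if "m \<in> {4, 6}" for m
  proof -
    have "{x \<in> V m. par x = par y} = {y, - y}" if "y \<in> V m" for y
      using that \<open>m \<in> {4, 6}\<close> sum16[of _ y] pm[of y] qm[of y] by (fastforce simp: V_def)
    hence "card {x \<in> V m. par x = c} = 2" if "c \<in> par ` V m" for c
      using that neg_ne[of _ m] \<open>m \<in> {4, 6}\<close> by force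
    thus ?thesis using card_eq_sum_fibres[OF finV[of m], of par] by simp
  qed
  have disj: "par ` V m \<inter> par ` V n = {}" if "m \<noteq> n" "m + n < 16" for m n
    using that sum16 qm by (fastforce simp: V_def)
  have fincls: "finite (UNIV :: (24 \<Rightarrow> bool) set)" by simp
  have "card (par ` V 0 \<union> par ` V 4 \<union> par ` V 6 \<union> par ` V 8) \<le> card (UNIV :: (24 \<Rightarrow> bool) set)"
    by (rule card_mono) auto
  also have "card (UNIV :: (24 \<Rightarrow> bool) set) = 2 ^ 24" by (simp add: card_fun)
  also have "card (par ` V 0 \<union> par ` V 4 \<union> par ` V 6 \<union> par ` V 8) = card (par ` V 0) + card (par ` V 4) + card (par ` V 6) + card (par ` V 8)"
  proof -
    have f: "finite (par ` V m)" for m using finV by simp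
    have "card (par ` V 0 \<union> par ` V 4) = card (par ` V 0) + card (par ` V 4)"
      by (intro card_Un_disjoint f disj) auto
    moreover have "card (par ` V 0 \<union> par ` V 4 \<union> par ` V 6) = card (par ` V 0 \<union> par ` V 4) + card (par ` V 6)"
      by (intro card_Un_disjoint finite_UnI f) (use disj[of 0 6] disj[of 4 6] in \<open>simp add: Int_Un_distrib2\<close>)
    moreover have "card (par ` V 0 \<union> par ` V 4 \<union> par ` V 6 \<union> par ` V 8) = card (par ` V 0 \<union> par ` V 4 \<union> par ` V 6) + card (par ` V 8)"
      by (intro card_Un_disjoint finite_UnI f) (use disj[of 0 8] disj[of 4 8] disj[of 6 8] in \<open>simp add: Int_Un_distrib2\<close>)
    ultimately show ?thesis by simp
  qed
  finally have le: "card (par ` V 0) + card (par ` V 4) + card (par ` V 6) + card (par ` V 8) \<le> 16777216" by simp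
  have "0 \<in> V 0" by (simp add: V_def qform_bil bil_def)
  hence c0: "card (par ` V 0) \<ge> 1" using finV[of 0] by (metis One_nat_def Suc_leI card_gt_0_iff empty_iff finite_imageI image_is_empty)
  have c4: "card (par ` V 4) = 98280" using half[of 4] leech_shell_cards(2)[OF L] by (simp add: V_def)
  have c6: "card (par ` V 6) = 8386560" using half[of 6] leech_shell_cards(3)[OF L] by (simp add: V_def)
  \<comment> \<open>\<open>8292375 = 2 ^ 24 - 1 - 98280 - 8386560\<close>. Since
    \<open>48 * 8292375 = 398034000\<close> is exactly the number of vectors of norm 8, at most 47
    in every class would be too few.\<close>
  have c8: "card (par ` V 8) \<le> 8292375" using le c0 c4 c6 by linarith
  have "\<exists>c \<in> par ` V 8. card {x \<in> V 8. par x = c} \<ge> 48"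
  proof (rule ccontr)
    assume neg: "\<not> ?thesis"
    have "card (V 8) = (\<Sum>c\<in>par ` V 8. card {x \<in> V 8. par x = c})" by (rule card_eq_sum_fibres[OF finV])
    also have "\<dots> \<le> (\<Sum>c\<in>par ` V 8. 47)" by (rule sum_mono) (use neg in force)
    also have "\<dots> \<le> 47 * 8292375" using c8 by simp
    finally show False using leech_shell_cards(4)[OF L] by (simp add: V_def)
  qed
  then obtain c where c: "card {x \<in> V 8. par x = c} \<ge> 48" by blast
  define \<Phi> where "\<Phi> = {x \<in> V 8. par x = c}"
  \<comment> \<open>The choice depends only on the set \<open>{x, - x}\<close>, so the image
    \<open>R\<close> keeps exactly one vector of each pair.\<close>
  define g where "g = (\<lambda>x :: int ^24. SOME y. y \<in> {x, - x})"
  have g: "g x \<in> {x, - x}" for x unfolding g_def by (rule someI[of _ x]) simp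
  have gm: "g (- x) = g x" for x by (simp only: g_def minus_minus insert_commute)
  define R where "R = g ` \<Phi>"
  have negPhi: "- x \<in> \<Phi>" if "x \<in> \<Phi>" for x using that pm qm by (simp add: \<Phi>_def V_def)
  have RPhi: "R \<subseteq> \<Phi>"
  proof
    fix y assume "y \<in> R"
    then obtain x where "x \<in> \<Phi>" "y = g x" by (auto simp: R_def)
    thus "y \<in> \<Phi>" using g[of x] negPhi[of x] by auto
  qed
  have finPhi: "finite \<Phi>" using finV by (simp add: \<Phi>_def)
  have finR: "finite R" using RPhi finPhi finite_subset by blast
  have "\<Phi> \<subseteq> R \<union> uminus ` R"
  proof
    fix x assume x: "x \<in> \<Phi>"
    hence "g x \<in> R" by (simp add: R_def)
    moreover from g[of x] have "x = g x \<or> x = - g x" by auto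
    ultimately show "x \<in> R \<union> uminus ` R" by (metis UnI1 UnI2 imageI)
  qed
  hence "card \<Phi> \<le> card (R \<union> uminus ` R)" by (intro card_mono) (use finR in auto)
  also have "\<dots> \<le> card R + card (uminus ` R)" by (rule card_Un_le)
  also have "\<dots> \<le> 2 * card R" using card_image_le[OF finR, of uminus] by simp
  finally have "card R \<ge> 24" using c by (simp add: \<Phi>_def)
  then obtain R' where R': "R' \<subseteq> R" "card R' = 24" by (metis obtain_subset_with_card_n)
  have finR': "finite R'" using R' finR finite_subset by blast
  obtain f :: "24 \<Rightarrow> int ^24" where f: "bij_betw f UNIV R'"
    using finite_same_card_bij[of "UNIV :: 24 set" R'] finR' R' by auto
  have fR: "f i \<in> R" for i using f R' by (auto simp: bij_betw_def)
  have fPhi: "f i \<in> \<Phi>" for i using fR RPhi by blast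
  have orth: "bil L (f i) (f j) = 0" if "i \<noteq> j" for i j
  proof -
    have ne: "f i \<noteq> f j" using that f by (metis bij_betw_imp_inj_on inj_eq)
    have "f i \<noteq> - f j"
    proof
      assume eq: "f i = - f j"
      obtain x y where xy: "f i = g x" "f j = g y" using fR[of i] fR[of j] by (auto simp: R_def)
      have "x = g x \<or> x = - g x" "y = g y \<or> y = - g y" using g[of x] g[of y] by auto
      hence "x = y \<or> x = - y" using eq unfolding xy by (metis minus_minus)
      hence "g x = g y" using gm by auto
      thus False using ne xy by simp
    qed
    moreover have "par (f i) = par (f j)" "qform L (f i) = 8" "qform L (f j) = 8"
      using fPhi[of i] fPhi[of j] by (auto simp: \<Phi>_def V_def)
    ultimately show ?thesis using sum16[of "f i" "f j"] ne by simp
  qed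
  have "is_frame L f"
    unfolding is_frame_def
  proof (intro conjI allI)
    show "bil L (f i) (f j) = (if i = j then 8 else 0)" for i j
      using orth[of i j] fPhi[of i] by (auto simp: \<Phi>_def V_def qform_bil)
    show "even (f i $ k - f j $ k)" for i j k
    proof -
      have "par (f i) = par (f j)" using fPhi[of i] fPhi[of j] by (auto simp: \<Phi>_def)
      from fun_cong[OF this, of k] show ?thesis by (simp add: par_def)
    qed
  qed
  thus ?thesis by blast
qed

section \<open>Coordinates with respect to a frame\<close>

definition dotp :: "('n::finite \<Rightarrow> int) \<Rightarrow> ('n \<Rightarrow> int) \<Rightarrow> int" where
  "dotp x y = (\<Sum>i\<in>UNIV. x i * y i)"

text \<open>These are \<open>sqrt 8\<close> times the orthonormal coordinates, hence integers; dot
  products are accordingly 8 times inner products.\<close>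

definition coords :: "int ^'n ^'n \<Rightarrow> ('n \<Rightarrow> int ^'n) \<Rightarrow> int ^'n \<Rightarrow> 'n \<Rightarrow> int" where
  "coords L f x = (\<lambda>i. bil L (f i) x)"

text \<open>Orthogonality says that \<open>G ** Fm\<close> is 8 times the identity. Over the reals a
  one-sided inverse of a square matrix is two-sided, so \<open>Fm ** G\<close> is as well, which is
  the expansion.\<close>

lemma frame_expansion:
  assumes f: "is_frame L f"
  shows "8 *s x = (\<Sum>i\<in>UNIV. coords L f x i *s f i)"
proof -
  define Fm where "Fm = (\<chi> k i. f i $ k)"
  define G where "G = transpose Fm ** L"
  have GF: "(G ** Fm) $ i $ j = (if i = j then 8 else 0)" for i j
  proof -
    have "(G ** Fm) $ i $ j = (\<Sum>k\<in>UNIV. f i $ k * (\<Sum>l\<in>UNIV. L $ k $ l * f j $ l))"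
      unfolding G_def matrix_mul_assoc[symmetric]
      by (simp add: matrix_matrix_mult_def transpose_def Fm_def)
    also have "\<dots> = bil L (f i) (f j)" by (simp add: bil_def matrix_vector_mult_def)
    finally show ?thesis using f by (simp add: is_frame_def)
  qed
  define G' where "G' = (1/8) *\<^sub>R realmat G"
  have "G' ** realmat Fm = mat 1"
  proof -
    have "(realmat G ** realmat Fm) $ i $ j = (if i = j then 8 else 0)" for i j
      unfolding realmat_mult[symmetric] using GF[of i j] by (simp add: realmat_def)
    thus ?thesis unfolding G'_def scalar_matrix_assoc[symmetric] by (simp add: vec_eq_iff mat_def)
  qed
  hence eq: "realmat Fm ** G' = mat 1" by (simp add: matrix_left_right_inverse)
  have FG: "(realmat Fm ** realmat G) $ k $ l = (if k = l then 8 else 0)" for k l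
  proof -
    have "(realmat Fm ** G') $ k $ l = (1/8) * (realmat Fm ** realmat G) $ k $ l"
      by (simp add: matrix_matrix_mult_def G'_def sum_divide_distrib)
    thus ?thesis unfolding eq by (simp add: mat_def split: if_splits)
  qed
  have FG': "(Fm ** G) $ k $ l = (if k = l then 8 else 0)" for k l
    using FG[of k l] unfolding realmat_mult[symmetric] by (simp add: realmat_def split: if_splits)
  have "(\<Sum>i\<in>UNIV. coords L f x i *s f i) $ k = 8 * x $ k" for k
  proof -
    have "coords L f x i = (G *v x) $ i" for i
    proof -
      have "(G *v x) $ i = (transpose Fm *v (L *v x)) $ i" by (simp add: G_def matrix_vector_mul_assoc)
      also have "\<dots> = coords L f x i" by (simp add: coords_def bil_def matrix_vector_mult_def transpose_def Fm_def)
      finally show ?thesis by simp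
    qed
    hence "(\<Sum>i\<in>UNIV. coords L f x i *s f i) $ k = (Fm *v (G *v x)) $ k"
      by (simp add: matrix_vector_mult_def Fm_def mult.commute)
    also have "\<dots> = ((Fm ** G) *v x) $ k" by (simp add: matrix_vector_mul_assoc)
    also have "\<dots> = (\<Sum>l\<in>UNIV. (if k = l then 8 else 0) * x $ l)" unfolding matrix_vector_mult_def by (simp add: FG')
    also have "\<dots> = 8 * x $ k" by (simp add: if_distrib[of "\<lambda>a. a * _"] cong: if_cong)
    finally show ?thesis .
  qed
  thus ?thesis by (simp add: vec_eq_iff)
qed

lemma coords_add: "coords L f (x + y) = (\<lambda>i. coords L f x i + coords L f y i)"
  and coords_diff: "coords L f (x - y) = (\<lambda>i. coords L f x i - coords L f y i)"
  by (simp_all add: coords_def bil_add_right bil_diff_right)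

lemma bil_sum_left: "bil L (\<Sum>i\<in>A. g i) y = (\<Sum>i\<in>A. bil L (g i) y)"
  by (induction A rule: infinite_finite_induct) (simp_all add: bil_add_left, simp_all add: bil_def)

lemma dotp_coords:
  assumes f: "is_frame L f"
  shows "dotp (coords L f x) (coords L f y) = 8 * bil L x y"
proof -
  have "8 * bil L x y = bil L (\<Sum>i\<in>UNIV. coords L f x i *s f i) y"
    unfolding frame_expansion[OF f, of x, symmetric] by (simp add: bil_scale_left)
  also have "\<dots> = dotp (coords L f x) (coords L f y)"
    by (simp add: bil_sum_left bil_scale_left dotp_def coords_def)
  finally show ?thesis ..
qed

lemma coords_inject:
  assumes f: "is_frame L f" and eq: "coords L f x = coords L f y"
  shows "x = y"
proof -
  have "8 *s x = 8 *s y" using frame_expansion[OF f, of x] frame_expansion[OF f, of y] eq by simp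
  thus ?thesis by (simp add: vec_eq_iff)
qed

text \<open>A unimodular lattice is its own dual: \<open>x\<close> maps to
  \<open>dotp (coords L f x) y div 8\<close> by an integral linear form, and the integral inverse of
  \<open>L\<close> turns the form into a lattice vector. Later membership proofs rest on
  this.\<close>

lemma coords_dual:
  assumes f: "is_frame L f" and L: "leech_gram L"
    and y: "\<And>x. 8 dvd dotp (coords L f x) y"
  shows "\<exists>z. coords L f z = y"
proof -
  have sym: "transpose L = L" and det: "det L = 1" using L by (auto simp: leech_gram_def)
  obtain M where M: "L ** M = mat 1" "M ** L = mat 1" using int_matrix_inverse[OF det] .
  define h where "h = (\<lambda>x. dotp (coords L f x) y div 8)"
  have h: "dotp (coords L f x) y = 8 * h x" for x using y[of x] by (simp add: h_def)
  define z where "z = M *v (\<chi> j. h (axis j 1))"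
  have Lz: "L *v z = (\<chi> j. h (axis j 1))" by (simp add: z_def matrix_vector_mul_assoc M)
  have "bil L x z = h x" for x
  proof -
    have "8 * bil L x z = (\<Sum>j\<in>UNIV. x $ j * dotp (coords L f (axis j 1)) y)"
      unfolding bil_def Lz h by (simp add: sum_distrib_left mult_ac)
    also have "\<dots> = (\<Sum>i\<in>UNIV. (\<Sum>j\<in>UNIV. x $ j * coords L f (axis j 1) i) * y i)"
      unfolding dotp_def sum_distrib_left sum_distrib_right by (subst sum.swap) (simp add: mult_ac)
    also have "\<dots> = dotp (coords L f x) y"
    proof -
      have ax: "bil L v (axis j 1) = (\<Sum>k\<in>UNIV. v $ k * L $ k $ j)" for v j
        unfolding bil_def by (simp add: matrix_vector_mult_def axis_def if_distrib cong: if_cong)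
      have "(\<Sum>j\<in>UNIV. x $ j * coords L f (axis j 1) i) = coords L f x i" for i
      proof -
        have "(\<Sum>j\<in>UNIV. x $ j * coords L f (axis j 1) i) = (\<Sum>j\<in>UNIV. x $ j * (\<Sum>k\<in>UNIV. f i $ k * L $ k $ j))"
          unfolding coords_def ax ..
        also have "\<dots> = coords L f x i"
          unfolding coords_def bil_def matrix_vector_mult_def sum_distrib_left vec_lambda_beta
          by (subst sum.swap) (simp add: mult_ac)
        finally show ?thesis .
      qed
      thus ?thesis by (simp add: dotp_def)
    qed
    finally show ?thesis using h[of x] by simp
  qed
  moreover have "h (f i) = y i" for i
  proof -
    have "dotp (coords L f (f i)) y = (\<Sum>k\<in>UNIV. (if k = i then 8 * y k else 0))"
      unfolding dotp_def coords_def using f by (intro sum.cong) (auto simp: is_frame_def)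
    thus ?thesis by (simp add: h_def)
  qed
  ultimately have "coords L f z = y" by (auto simp: coords_def)
  thus ?thesis by blast
qed

text \<open>Congruence of the frame vectors modulo \<open>2L\<close> puts half of
  \<open>f i + s *s f j\<close> into the lattice.\<close>

lemma coords_half_sum:
  assumes f: "is_frame L f" and ij: "i \<noteq> j" and s: "s \<in> {1, - 1}"
  shows "\<exists>z. coords L f z = (\<lambda>k. if k = i then 4 else if k = j then 4 * s else 0)"
proof -
  define z where "z = (\<chi> k. (f i $ k + s * f j $ k) div 2)"
  have "even (f i $ k + s * f j $ k)" for k
    using f s unfolding is_frame_def by (metis (no_types, lifting) diff_minus_eq_add even_add even_diff empty_iff insert_iff mult.left_neutral mult_minus_left)
  hence z2: "2 *s z = f i + s *s f j" by (simp add: vec_eq_iff z_def)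
  have "2 * coords L f z k = bil L (f k) (f i) + s * bil L (f k) (f j)" for k
    unfolding coords_def bil_scale_right[symmetric] z2 bil_add_right by simp
  hence eq: "2 * coords L f z k = (if k = i then 8 else 0) + s * (if k = j then 8 else 0)" for k
    using f by (simp add: is_frame_def)
  hence "coords L f z k = (if k = i then 4 else if k = j then 4 * s else 0)" for k
  proof -
    have "2 * coords L f z k = 2 * (if k = i then 4 else if k = j then 4 * s else 0)"
      unfolding eq using ij by auto
    thus ?thesis by simp
  qed
  thus ?thesis by blast
qed

section \<open>The Golay code\<close>

text \<open>Addition of binary words, each word being identified with its support.\<close>

definition sdiff :: "'a set \<Rightarrow> 'a set \<Rightarrow> 'a set" where
  "sdiff A B = (A - B) \<union> (B - A)"

lemma card_sdiff:
  assumes "finite A" "finite B"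
  shows "card (sdiff A B) + 2 * card (A \<inter> B) = card A + card B"
proof -
  have "card (sdiff A B) = card (A - B) + card (B - A)"
    unfolding sdiff_def by (rule card_Un_disjoint) (use assms in auto)
  moreover have "card A = card (A - B) + card (A \<inter> B)" "card B = card (B - A) + card (A \<inter> B)"
    using card_Int_Diff[of A B] card_Int_Diff[of B A] assms by (simp_all add: Int_commute)
  ultimately show ?thesis by simp
qed

lemma even_card_Int_sdiff:
  assumes "finite A" "finite B"
  shows "even (card (T \<inter> sdiff A B)) \<longleftrightarrow> (even (card (T \<inter> A)) = even (card (T \<inter> B)))"
proof -
  have "T \<inter> sdiff A B = sdiff (T \<inter> A) (T \<inter> B)" by (auto simp: sdiff_def)
  thus ?thesis using card_sdiff[of "T \<inter> A" "T \<inter> B"] assms by (metis even_add even_mult_iff even_numeral finite_Int)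
qed

text \<open>Duality over the field with two elements: a functional separates a word from a subspace
  not containing it. Induction on coordinates; if \<open>a\<close> occurs in some \<open>v1\<close>
  of \<open>V\<close>, adding \<open>v1\<close> eliminates it from the other words.\<close>

lemma binary_separation:
  assumes "finite X" "\<And>v. v \<in> V \<Longrightarrow> v \<subseteq> X" "{} \<in> V" "\<And>v v'. v \<in> V \<Longrightarrow> v' \<in> V \<Longrightarrow> sdiff v v' \<in> V"
    "w \<subseteq> X" "w \<notin> V"
  shows "\<exists>t\<subseteq>X. (\<forall>v\<in>V. even (card (t \<inter> v))) \<and> odd (card (t \<inter> w))"
  using assms
proof (induction X arbitrary: V w rule: finite_induct)
  case empty
  thus ?case by auto
next
  case (insert a Y)
  have fin: "finite v" if "v \<subseteq> insert a Y" for v using that insert.hyps finite_subset by blast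
  show ?case
  proof (cases "\<exists>v\<in>V. a \<in> v")
    case False
    show ?thesis
    proof (cases "a \<in> w")
      case True
      have "{a} \<inter> v = {}" if "v \<in> V" for v using False that by auto
      moreover have "{a} \<inter> w = {a}" using True by auto
      ultimately show ?thesis by (intro exI[of _ "{a}"]) auto
    next
      case a: False
      have "\<exists>t\<subseteq>Y. (\<forall>v\<in>V. even (card (t \<inter> v))) \<and> odd (card (t \<inter> w))"
      proof (rule insert.IH)
      show "v \<subseteq> Y" if "v \<in> V" for v using insert.prems(1)[OF that] False that by blast
      show "w \<subseteq> Y" using insert.prems(4) a by blast
    qed (use insert.prems in blast)+
      thus ?thesis by blast
    qed
  next
    case True
    then obtain v1 where v1: "v1 \<in> V" "a \<in> v1" by blast
    define V0 where "V0 = {v \<in> V. a \<notin> v}"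
    define w' where "w' = (if a \<in> w then sdiff w v1 else w)"
    have ss: "sdiff (sdiff w v1) v1 = w" by (auto simp: sdiff_def)
    have w': "w' \<notin> V0" "w' \<subseteq> Y"
    proof -
      show "w' \<notin> V0"
      proof
        assume "w' \<in> V0"
        hence "sdiff w' v1 \<in> V" "w' \<in> V" using insert.prems(3)[of w' v1] v1 by (auto simp: V0_def)
        thus False using insert.prems ss by (auto simp: w'_def split: if_splits)
      qed
      show "w' \<subseteq> Y" using insert.prems(1)[OF v1(1)] insert.prems(4) v1 by (auto simp: w'_def sdiff_def)
    qed
    have "\<exists>t\<subseteq>Y. (\<forall>v\<in>V0. even (card (t \<inter> v))) \<and> odd (card (t \<inter> w'))"
    proof (rule insert.IH)
      show "v \<subseteq> Y" if "v \<in> V0" for v using that insert.prems(1)[of v] by (auto simp: V0_def)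
      show "{} \<in> V0" using insert.prems(2) by (simp add: V0_def)
      show "sdiff v v' \<in> V0" if "v \<in> V0" "v' \<in> V0" for v v'
        using that insert.prems(3)[of v v'] by (auto simp: V0_def sdiff_def)
    qed (use w' in auto)
    then obtain t0 where t0: "t0 \<subseteq> Y" "\<And>v. v \<in> V0 \<Longrightarrow> even (card (t0 \<inter> v))" "odd (card (t0 \<inter> w'))" by blast
    \<comment> \<open>It remains to make \<open>v1\<close> orthogonal. Inserting \<open>a\<close>
      flips the parity there and leaves the words avoiding \<open>a\<close> alone.\<close>
    define t where "t = (if even (card (t0 \<inter> v1)) then t0 else insert a t0)"
    have a0: "a \<notin> t0" using t0(1) insert.hyps by auto
    have ft: "finite t0" using t0(1) insert.hyps finite_subset by blast
    have tY: "card (t \<inter> z) = card (t0 \<inter> z)" if "a \<notin> z" for z using that by (auto simp: t_def)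
    have t1: "even (card (t \<inter> v1))"
    proof (cases "even (card (t0 \<inter> v1))")
      case False
      have "insert a t0 \<inter> v1 = insert a (t0 \<inter> v1)" using v1 by auto
      hence "card (insert a t0 \<inter> v1) = Suc (card (t0 \<inter> v1))" using a0 ft by simp
      thus ?thesis using False by (simp add: t_def)
    qed (simp add: t_def)
    have fv1: "finite v1" using fin insert.prems(1)[OF v1(1)] by blast
    show ?thesis
    proof (intro exI[of _ t] conjI ballI)
      show "t \<subseteq> insert a Y" using t0(1) by (auto simp: t_def)
      fix v assume v: "v \<in> V"
      have fv: "finite v" using fin insert.prems(1)[OF v] by blast
      show "even (card (t \<inter> v))"
      proof (cases "a \<in> v")
        case True
        hence "sdiff v v1 \<in> V0" using insert.prems(3)[OF v v1(1)] v1 by (auto simp: V0_def sdiff_def)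
        hence "even (card (t \<inter> sdiff v v1))" using t0(2) tY[of "sdiff v v1"] by (auto simp: V0_def)
        thus ?thesis using even_card_Int_sdiff[OF fv fv1, of t] t1 by simp
      qed (use t0(2) tY v in \<open>auto simp: V0_def\<close>)
    next
      have fw: "finite w" using fin insert.prems(4) by blast
      show "odd (card (t \<inter> w))"
      proof (cases "a \<in> w")
        case True
        have "a \<notin> w'" using w'(2) insert.hyps by auto
        hence "odd (card (t \<inter> sdiff w v1))" using t0(3) tY[of w'] True by (simp add: w'_def)
        thus ?thesis using even_card_Int_sdiff[OF fw fv1, of t] t1 by simp
      qed (use t0(3) tY in \<open>auto simp: w'_def\<close>)
    qed
  qed
qed

section \<open>The residual of a block of the biplane\<close>

lemma card_Int_explicit3:
  assumes "distinct [x, y, z]"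
  shows "card (S \<inter> {x, y, z}) = of_bool (x \<in> S) + of_bool (y \<in> S) + of_bool (z \<in> S)"
  using assms by (auto simp: Int_insert_right)

lemma card_Int_explicit6:
  assumes "distinct [a, b, c, d, e, f]"
  shows "card (S \<inter> {a, b, c, d, e, f}) = of_bool (a \<in> S) + of_bool (b \<in> S) + of_bool (c \<in> S)
    + of_bool (d \<in> S) + of_bool (e \<in> S) + of_bool (f \<in> S)"
  using assms by (auto simp: Int_insert_right)

text \<open>A truth table for an unknown triple, \<open>a\<close> to \<open>f\<close> telling which
  of six points \<open>A\<close> to \<open>F\<close> it contains. The premises are its intersection
  numbers with \<open>{A, B, C}\<close>, \<open>{B, C, D}\<close>, \<open>{A, C, E}\<close> and
  \<open>{A, B, F}\<close>. The two solutions in each case will be the triples belonging to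
  \<open>y1\<close> and \<open>y2\<close>.\<close>

lemma triple_membership:
  fixes a b c d e f :: bool
  shows "of_bool a + of_bool b + of_bool c = (1::nat) \<Longrightarrow> of_bool b + of_bool c + of_bool d = (1::nat) \<Longrightarrow>
      of_bool a + of_bool c + of_bool e = (1::nat) \<Longrightarrow> of_bool a + of_bool b + of_bool f = (2::nat) \<Longrightarrow>
      of_bool a + of_bool b + of_bool c + of_bool d + of_bool e + of_bool f = (3::nat) \<Longrightarrow>
      a \<and> d \<and> f \<and> \<not> b \<and> \<not> c \<and> \<not> e \<or> b \<and> e \<and> f \<and> \<not> a \<and> \<not> c \<and> \<not> d"
    and "of_bool a + of_bool b + of_bool c = (1::nat) \<Longrightarrow> of_bool b + of_bool c + of_bool d = (1::nat) \<Longrightarrow>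
      of_bool a + of_bool c + of_bool e = (2::nat) \<Longrightarrow> of_bool a + of_bool b + of_bool f = (1::nat) \<Longrightarrow>
      of_bool a + of_bool b + of_bool c + of_bool d + of_bool e + of_bool f = (3::nat) \<Longrightarrow>
      a \<and> d \<and> e \<and> \<not> b \<and> \<not> c \<and> \<not> f \<or> c \<and> e \<and> f \<and> \<not> a \<and> \<not> b \<and> \<not> d"
    and "of_bool a + of_bool b + of_bool c = (1::nat) \<Longrightarrow> of_bool b + of_bool c + of_bool d = (2::nat) \<Longrightarrow>
      of_bool a + of_bool c + of_bool e = (1::nat) \<Longrightarrow> of_bool a + of_bool b + of_bool f = (1::nat) \<Longrightarrow>
      of_bool a + of_bool b + of_bool c + of_bool d + of_bool e + of_bool f = (3::nat) \<Longrightarrow>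
      b \<and> d \<and> e \<and> \<not> a \<and> \<not> c \<and> \<not> f \<or> c \<and> d \<and> f \<and> \<not> a \<and> \<not> b \<and> \<not> e"
  by (cases a; cases b; cases c; cases d; cases e; cases f; simp)+

text \<open>The residual of a block of the biplane on 11 points: ten triples in a 6-set, indexed by the pairs of a 5-set,
  meeting in 2 or 1 points according to whether the pairs are disjoint.\<close>

lemma biplane_table:
  fixes P :: "'a set"
  assumes P: "finite P" "card P = 6"
    and R3: "\<And>x y. x \<in> X \<Longrightarrow> y \<in> X \<Longrightarrow> x \<noteq> y \<Longrightarrow> R x y \<subseteq> P \<and> card (R x y) = 3"
    and dis: "\<And>x y z w. {x, y, z, w} \<subseteq> X \<Longrightarrow> distinct [x, y, z, w] \<Longrightarrow> card (R x y \<inter> R z w) = 2"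
    and adj: "\<And>x y z. {x, y, z} \<subseteq> X \<Longrightarrow> distinct [x, y, z] \<Longrightarrow> card (R x y \<inter> R x z) = 1"
    and sym: "\<And>x y. R x y = R y x"
    and X: "{x1, x2, x3, x4, x5} \<subseteq> X" "distinct [x1, x2, x3, x4, x5]"
  shows "\<exists>y1 y2 A B C D E F. {y1, y2} = {x1, x2} \<and> distinct [A, B, C, D, E, F] \<and> P = {A, B, C, D, E, F} \<and>
    R y1 y2 = {A, B, C} \<and> R y1 x3 = {A, D, F} \<and> R y1 x4 = {C, E, F} \<and> R y1 x5 = {B, D, E} \<and>
    R y2 x3 = {B, E, F} \<and> R y2 x4 = {A, D, E} \<and> R y2 x5 = {C, D, F} \<and>
    R x3 x4 = {B, C, D} \<and> R x3 x5 = {A, C, E} \<and> R x4 x5 = {A, B, F}"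
proof -
  have sub: "R x y \<subseteq> P" "card (R x y) = 3" "finite (R x y)" if "x \<in> X" "y \<in> X" "x \<noteq> y" for x y
    using R3[OF that] P finite_subset by auto
  define S where "S = R x1 x2"
  have S: "card S = 3" "finite S" "S \<subseteq> P" using sub[of x1 x2] X by (auto simp: S_def)
  have c2: "card (R x3 x4 \<inter> S) = 2" "card (R x3 x5 \<inter> S) = 2" "card (R x4 x5 \<inter> S) = 2"
    unfolding S_def using X by (intro dis; auto)+
  have split: "\<exists>a d. S - T = {a} \<and> T - S = {d}" if "card (T \<inter> S) = 2" "card T = 3" "finite T" for T
  proof -
    have "card (S - T) = 1" "card (T - S) = 1"
      using that S card_Int_Diff[of S T] card_Int_Diff[of T S] by (simp_all add: Int_commute)
    thus ?thesis by (auto simp: card_1_singleton_iff)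
  qed
  \<comment> \<open>Each of the three triples on two of \<open>x3\<close>, \<open>x4\<close>,
    \<open>x5\<close> meets \<open>S\<close> in two points, so it is \<open>S\<close> with one point
    exchanged. These exchanges name all six points.\<close>
  obtain A D where AD: "S - R x3 x4 = {A}" "R x3 x4 - S = {D}" using split[OF c2(1)] sub[of x3 x4] X by auto
  obtain B E where BE: "S - R x3 x5 = {B}" "R x3 x5 - S = {E}" using split[OF c2(2)] sub[of x3 x5] X by auto
  obtain C F where CF: "S - R x4 x5 = {C}" "R x4 x5 - S = {F}" using split[OF c2(3)] sub[of x4 x5] X by auto
  have swap: "T = (S - {a}) \<union> {d} \<and> a \<in> S \<and> d \<notin> S" if "S - T = {a}" "T - S = {d}" for T :: "'a set" and a d
    using that by blast
  have R34: "R x3 x4 = (S - {A}) \<union> {D}" and R35: "R x3 x5 = (S - {B}) \<union> {E}" and R45: "R x4 x5 = (S - {C}) \<union> {F}"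
    and in_S: "A \<in> S" "B \<in> S" "C \<in> S" "D \<notin> S" "E \<notin> S" "F \<notin> S"
    using swap[OF AD] swap[OF BE] swap[OF CF] by simp_all
  have c1: "card (R x3 x4 \<inter> R x3 x5) = 1" "card (R x3 x4 \<inter> R x4 x5) = 1" "card (R x3 x5 \<inter> R x4 x5) = 1"
    using X adj[of x3 x4 x5] adj[of x4 x3 x5] adj[of x5 x3 x4] by (auto simp: sym[of x4 x3] sym[of x5 x3] sym[of x5 x4])
  have ne: "A \<noteq> B" "A \<noteq> C" "B \<noteq> C"
  proof -
    have c: "card (S - {y}) = 2" if "y \<in> S" for y using that S by simp
    have no: "a \<noteq> b" if "T = (S - {a}) \<union> {d}" "T' = (S - {b}) \<union> {e}" "card (T \<inter> T') = 1" "a \<in> S" for a b d e T T'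
    proof
      assume "a = b"
      hence "S - {a} \<subseteq> T \<inter> T'" using that by auto
      moreover have "finite (T \<inter> T')" using that S by auto
      ultimately have "card (S - {a}) \<le> card (T \<inter> T')" by (rule card_mono[rotated])
      thus False using that c[of a] by simp
    qed
    show "A \<noteq> B" "A \<noteq> C" "B \<noteq> C"
      using no[OF R34 R35 c1(1)] no[OF R34 R45 c1(2)] no[OF R35 R45 c1(3)] in_S by auto
  qed
  have SABC: "S = {A, B, C}"
    using card_subset_eq[of S "{A, B, C}"] in_S ne S by auto
  have ne': "D \<noteq> E" "D \<noteq> F" "E \<noteq> F"
    using c1 ne in_S unfolding R34 R35 R45 SABC by (auto simp: Int_insert_left insert_Diff_if)
  have d6: "distinct [A, B, C, D, E, F]" using ne ne' in_S SABC by auto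
  have Pe: "P = {A, B, C, D, E, F}"
  proof (rule card_subset_eq[symmetric, OF P(1)])
    show "{A, B, C, D, E, F} \<subseteq> P" using S(3) in_S AD(2) BE(2) CF(2) sub(1)[of x3 x4] sub(1)[of x3 x5] sub(1)[of x4 x5] X by auto
    show "card {A, B, C, D, E, F} = card P" using d6 P by auto
  qed
  have T: "R x3 x4 = {B, C, D}" "R x3 x5 = {A, C, E}" "R x4 x5 = {A, B, F}"
    unfolding R34 R35 R45 SABC using d6 by auto
  have d3: "distinct [A, B, C]" "distinct [B, C, D]" "distinct [A, C, E]" "distinct [A, B, F]" using d6 by auto
  note ci = card_Int_explicit3[OF d3(1)] card_Int_explicit3[OF d3(2)] card_Int_explicit3[OF d3(3)] card_Int_explicit3[OF d3(4)] card_Int_explicit6[OF d6]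
  have R12: "R x1 x2 = {A, B, C}" using SABC by (simp add: S_def)
  have total: "of_bool (A \<in> T) + of_bool (B \<in> T) + of_bool (C \<in> T) + of_bool (D \<in> T) + of_bool (E \<in> T) + of_bool (F \<in> T) = (3::nat)"
    if "T \<subseteq> P" "card T = 3" for T
    using that ci(5)[of T] unfolding Pe by (simp add: Int_absorb2)
  have sets: "T = {y \<in> {A, B, C, D, E, F}. y \<in> T}" if "T \<subseteq> P" for T using that Pe by auto
  have h3: "R y x3 = {A, D, F} \<or> R y x3 = {B, E, F}" and h4: "R y x4 = {A, D, E} \<or> R y x4 = {C, E, F}"
    and h5: "R y x5 = {B, D, E} \<or> R y x5 = {C, D, F}" if y: "y \<in> {x1, x2}" for y
  proof -
    have X': "y \<in> X" "y \<noteq> x3" "y \<noteq> x4" "y \<noteq> x5" "x3 \<in> X" "x4 \<in> X" "x5 \<in> X" "x3 \<noteq> x4" "x3 \<noteq> x5" "x4 \<noteq> x5"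
      using y X by auto
    have S1: "card (R y x \<inter> {A, B, C}) = 1" if "x \<in> {x3, x4, x5}" for x
    proof (cases "y = x1")
      case True
      thus ?thesis using adj[of x1 x x2] X that unfolding R12[symmetric] by auto
    next
      case False
      hence "y = x2" using y by simp
      thus ?thesis using adj[of x2 x x1] X that unfolding R12[symmetric] sym[of x1 x2] by auto
    qed
    have 3: "card (R y x3 \<inter> {B, C, D}) = 1" "card (R y x3 \<inter> {A, C, E}) = 1" "card (R y x3 \<inter> {A, B, F}) = 2"
      unfolding T[symmetric] sym[of y x3] using X' adj[of x3 y x4] adj[of x3 y x5] dis[of x3 y x4 x5] by auto
    have 4: "card (R y x4 \<inter> {B, C, D}) = 1" "card (R y x4 \<inter> {A, C, E}) = 2" "card (R y x4 \<inter> {A, B, F}) = 1"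
      unfolding T[symmetric] sym[of y x4] using X' adj[of x4 y x3] adj[of x4 y x5] dis[of x4 y x3 x5] by (auto simp: sym[of x3 x4])
    have 5: "card (R y x5 \<inter> {B, C, D}) = 2" "card (R y x5 \<inter> {A, C, E}) = 1" "card (R y x5 \<inter> {A, B, F}) = 1"
      unfolding T[symmetric] sym[of y x5] using X' adj[of x5 y x3] adj[of x5 y x4] dis[of x5 y x3 x4] by (auto simp: sym[of x3 x5] sym[of x4 x5])
    have sy: "R y x3 \<subseteq> P" "card (R y x3) = 3" "R y x4 \<subseteq> P" "card (R y x4) = 3" "R y x5 \<subseteq> P" "card (R y x5) = 3"
      using R3 X' by auto
    have S1': "card (R y x3 \<inter> {A, B, C}) = 1" "card (R y x4 \<inter> {A, B, C}) = 1" "card (R y x5 \<inter> {A, B, C}) = 1"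
      using S1 by simp_all
    from triple_membership(1)[OF S1'(1)[unfolded ci(1)] 3(1)[unfolded ci(2)] 3(2)[unfolded ci(3)] 3(3)[unfolded ci(4)] total[OF sy(1,2)]]
    show "R y x3 = {A, D, F} \<or> R y x3 = {B, E, F}" using sy(1) unfolding Pe by blast
    from triple_membership(2)[OF S1'(2)[unfolded ci(1)] 4(1)[unfolded ci(2)] 4(2)[unfolded ci(3)] 4(3)[unfolded ci(4)] total[OF sy(3,4)]]
    show "R y x4 = {A, D, E} \<or> R y x4 = {C, E, F}" using sy(3) unfolding Pe by blast
    from triple_membership(3)[OF S1'(3)[unfolded ci(1)] 5(1)[unfolded ci(2)] 5(2)[unfolded ci(3)] 5(3)[unfolded ci(4)] total[OF sy(5,6)]]
    show "R y x5 = {B, D, E} \<or> R y x5 = {C, D, F}" using sy(5) unfolding Pe by blast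
  qed
  have share: False if c: "card (U \<inter> W) = 1" and pq: "p \<in> U" "p \<in> W" "q \<in> U" "q \<in> W" "p \<noteq> q" for U W :: "'a set" and p q
  proof -
    obtain z where "U \<inter> W = {z}" using c card_1_singletonE by blast
    hence "p = z" "q = z" using pq(1-4) by blast+
    thus False using pq(5) by simp
  qed
  \<comment> \<open>Triples whose index pairs overlap meet in a single point; each time this
    excludes one of the two candidates, so \<open>R y1 x3\<close> determines the remaining
    triples.\<close>
  have fin: "R y1 x3 = {A, D, F} \<and> R y1 x4 = {C, E, F} \<and> R y1 x5 = {B, D, E} \<and> R y2 x3 = {B, E, F} \<and> R y2 x4 = {A, D, E} \<and> R y2 x5 = {C, D, F}"
    if y: "{y1, y2} = {x1, x2}" and h: "R y1 x3 = {A, D, F}" for y1 y2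
  proof -
    have yy: "y1 \<in> {x1, x2}" "y2 \<in> {x1, x2}" "y1 \<noteq> y2" using y X by (auto simp: doubleton_eq_iff)
    have m: "y1 \<in> X" "y2 \<in> X" "x3 \<in> X" "x4 \<in> X" "x5 \<in> X"
      "distinct [y1, x3, x4]" "distinct [y1, x3, x5]" "distinct [x3, y1, y2]" "distinct [x4, y1, y2]" "distinct [x5, y1, y2]"
      using yy X by auto
    have i: "card (R y1 x3 \<inter> R y1 x4) = 1" "card (R y1 x3 \<inter> R y1 x5) = 1" "card (R y1 x3 \<inter> R y2 x3) = 1"
      "card (R y1 x4 \<inter> R y2 x4) = 1" "card (R y1 x5 \<inter> R y2 x5) = 1"
      using adj[OF _ m(6)] adj[OF _ m(7)] adj[OF _ m(8)] adj[OF _ m(9)] adj[OF _ m(10)] m(1-5)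
      unfolding sym[of x3] sym[of x4] sym[of x5] by simp_all
    have "R y1 x4 \<noteq> {A, D, E}" using share[OF i(1), of A D] h d6 by auto
    hence 14: "R y1 x4 = {C, E, F}" using h4[OF yy(1)] by blast
    have "R y1 x5 \<noteq> {C, D, F}" using share[OF i(2), of D F] h d6 by auto
    hence 15: "R y1 x5 = {B, D, E}" using h5[OF yy(1)] by blast
    have "R y2 x3 \<noteq> {A, D, F}" using share[OF i(3), of A D] h d6 by auto
    hence 23: "R y2 x3 = {B, E, F}" using h3[OF yy(2)] by blast
    have "R y2 x4 \<noteq> {C, E, F}" using share[OF i(4), of C E] 14 d6 by auto
    hence 24: "R y2 x4 = {A, D, E}" using h4[OF yy(2)] by blast
    have "R y2 x5 \<noteq> {B, D, E}" using share[OF i(5), of B D] 15 d6 by auto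
    hence 25: "R y2 x5 = {C, D, F}" using h5[OF yy(2)] by blast
    show ?thesis using h 14 15 23 24 25 by simp
  qed
  \<comment> \<open>If \<open>x1\<close> carries the other candidate, \<open>x1\<close> and
    \<open>x2\<close> exchange roles.\<close>
  have "\<exists>y1 y2. {y1, y2} = {x1, x2} \<and> R y1 x3 = {A, D, F}"
  proof (cases "R x1 x3 = {A, D, F}")
    case False
    hence 1: "R x1 x3 = {B, E, F}" using h3[of x1] by simp
    have "card (R x3 x1 \<inter> R x3 x2) = 1" using X by (intro adj) auto
    hence c12: "card (R x1 x3 \<inter> R x2 x3) = 1" unfolding sym[of x3] .
    have "R x2 x3 \<noteq> {B, E, F}" using share[OF c12, of B E] 1 d6 by auto
    hence "R x2 x3 = {A, D, F}" using h3[of x2] by blast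
    hence "{x2, x1} = {x1, x2} \<and> R x2 x3 = {A, D, F}" by (simp add: insert_commute)
    thus ?thesis by blast
  qed blast
  then obtain y1 y2 where y: "{y1, y2} = {x1, x2}" "R y1 x3 = {A, D, F}" by blast
  have "R y1 y2 = {A, B, C}" using y(1) R12 sym[of x1 x2] by (auto simp: doubleton_eq_iff)
  show ?thesis
  proof (intro exI conjI)
    show "{y1, y2} = {x1, x2}" by (rule y(1))
    show "distinct [A, B, C, D, E, F]" by (rule d6)
    show "P = {A, B, C, D, E, F}" by (rule Pe)
    show "R y1 y2 = {A, B, C}" by fact
  qed (simp_all only: fin[OF y] T)
qed

text \<open>The equivalence says that \<open>C\<close> is its own dual, so closure under
  \<open>sdiff\<close> is a consequence. In length 24, self-dual and doubly even without words of
  weight 4 characterises the extended binary Golay code.\<close>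

definition golay_code :: "'n::finite set set \<Rightarrow> bool" where
  "golay_code C \<longleftrightarrow> (\<forall>c. c \<in> C \<longleftrightarrow> (\<forall>d\<in>C. even (card (c \<inter> d)))) \<and> (\<forall>c\<in>C. 4 dvd card c \<and> card c \<noteq> 4)"

section \<open>Words of a Golay code\<close>

context
  fixes C :: "'n::finite set set"
  assumes C: "golay_code C" and card24: "CARD('n) = 24"
begin

lemma golay_self_dual: "c \<in> C \<longleftrightarrow> (\<forall>d\<in>C. even (card (c \<inter> d)))"
  using C unfolding golay_code_def by blast

lemma golay_card: "c \<in> C \<Longrightarrow> 4 dvd card c" "c \<in> C \<Longrightarrow> card c \<noteq> 4"
  using C unfolding golay_code_def by blast+

lemma golay_sdiff: "c \<in> C \<Longrightarrow> d \<in> C \<Longrightarrow> sdiff c d \<in> C"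
proof (subst golay_self_dual, intro ballI)
  fix e assume c: "c \<in> C" and d: "d \<in> C" and e: "e \<in> C"
  have "even (card (e \<inter> c))" "even (card (e \<inter> d))" using golay_self_dual[of e] e c d by auto
  thus "even (card (sdiff c d \<inter> e))" using even_card_Int_sdiff[of c d e] by (simp add: Int_commute)
qed

lemma golay_empty: "{} \<in> C"
  by (subst golay_self_dual) simp

lemma golay_UNIV: "UNIV \<in> C"
proof (subst golay_self_dual, intro ballI)
  fix d assume "d \<in> C"
  hence "4 dvd card d" by (rule golay_card)
  thus "even (card (UNIV \<inter> d))" by auto
qed

lemma golay_compl: "c \<in> C \<Longrightarrow> - c \<in> C"
proof -
  have "sdiff UNIV c = - c" by (auto simp: sdiff_def)
  thus "c \<in> C \<Longrightarrow> - c \<in> C" using golay_sdiff[OF golay_UNIV, of c] by metis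
qed

lemma card_compl24: "card (- c) = 24 - card (c :: 'n set)" "card (c :: 'n set) \<le> 24"
  using card_Diff_subset[of c UNIV] card_mono[of UNIV c] card24 unfolding Compl_eq_Diff_UNIV[symmetric] by simp_all

lemma golay_weights:
  assumes c: "c \<in> C"
  shows "card c \<in> {0, 8, 12, 16, 24}"
proof -
  have "4 dvd card c" "card c \<noteq> 4" "card (- c) \<noteq> 4" by (intro golay_card golay_compl c)+
  moreover then obtain k where "card c = 4 * k" by auto
  moreover have "k \<le> 6" using card_compl24(2)[of c] \<open>card c = 4 * k\<close> by simp
  hence "k \<in> {0, 1, 2, 3, 4, 5, 6}" by auto
  ultimately show ?thesis using card_compl24[of c] by auto
qed

text \<open>Otherwise all weights are divisible by 8, intersections of two words by 4, and the code
  is closed under intersection. No pair \<open>{i, j}\<close> is a code word, so some word meets it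
  in one point, and that word or its complement contains \<open>i\<close> but not \<open>j\<close>.
  Intersecting all words through \<open>i\<close> would then leave the code word
  \<open>{i}\<close>.\<close>

lemma golay_dodecad: "\<exists>u\<in>C. card u = 12"
proof (rule ccontr)
  assume no: "\<not> ?thesis"
  have w8: "8 dvd card c" if "c \<in> C" for c
  proof -
    have "card c \<in> {0, 8, 16, 24}" using golay_weights[OF that] no that by auto
    thus ?thesis by auto
  qed
  have i4: "4 dvd card (c \<inter> d)" if "c \<in> C" "d \<in> C" for c d
  proof -
    have "card (sdiff c d) + 2 * card (c \<inter> d) = card c + card d" by (rule card_sdiff) auto
    thus ?thesis using w8[OF that(1)] w8[OF that(2)] w8[OF golay_sdiff[OF that]] by presburger
  qed
  have Int: "c \<inter> d \<in> C" if "c \<in> C" "d \<in> C" for c d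
  proof (subst golay_self_dual, intro ballI)
    fix e assume e: "e \<in> C"
    have "sdiff (c \<inter> d) (c \<inter> e) = c \<inter> sdiff d e" "(c \<inter> d) \<inter> (c \<inter> e) = c \<inter> d \<inter> e" by (auto simp: sdiff_def)
    hence "card (c \<inter> sdiff d e) + 2 * card (c \<inter> d \<inter> e) = card (c \<inter> d) + card (c \<inter> e)"
      using card_sdiff[of "c \<inter> d" "c \<inter> e"] by simp
    thus "even (card (c \<inter> d \<inter> e))"
      using i4[OF that] i4[OF that(1) e] i4[OF that(1) golay_sdiff[OF that(2) e]] by presburger
  qed
  define i :: 'n where "i = undefined"
  define I where "I = \<Inter> {c \<in> C. i \<in> c}"
  have "\<Inter> F \<in> C" if "finite F" "F \<subseteq> C" for F
    using that by (induction F rule: finite_induct) (auto intro: golay_UNIV Int)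
  hence I: "I \<in> C" unfolding I_def by simp
  have "j \<notin> I" if ji: "j \<noteq> i" for j
  proof -
    have "{i, j} \<notin> C" using ji golay_weights[of "{i, j}"] by auto
    then obtain d where d: "d \<in> C" "odd (card ({i, j} \<inter> d))" using golay_self_dual by blast
    show ?thesis
    proof (cases "i \<in> d")
      case True
      hence "j \<notin> d" using d(2) ji by auto
      thus ?thesis using True d(1) by (auto simp: I_def)
    next
      case False
      hence "j \<in> d" using d(2) by (cases "j \<in> d") auto
      thus ?thesis using False golay_compl[OF d(1)] by (auto simp: I_def)
    qed
  qed
  hence "I = {i}" by (auto simp: I_def)
  thus False using golay_weights[OF I] by simp
qed

text \<open>A word of weight 8 inside \<open>u\<close> would make \<open>sdiff u c\<close> a word of
  weight 4.\<close>

lemma golay_in_dodecad: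
  assumes u: "u \<in> C" "card u = 12" and c: "c \<in> C" "c \<subseteq> u"
  shows "c = {} \<or> c = u"
proof -
  have "card c \<le> 12" using card_mono[of u c] c u by simp
  hence "card c \<in> {0, 8, 12}" using golay_weights[OF c(1)] by auto
  moreover have "card c \<noteq> 8"
  proof
    assume "card c = 8"
    hence "card (sdiff u c) = 4" using card_sdiff[of u c] c u by (simp add: Int_absorb1)
    thus False using golay_weights[OF golay_sdiff[OF u(1) c(1)]] by simp
  qed
  ultimately show ?thesis using card_subset_eq[of u c] c u by auto
qed

text \<open>The possible weights of \<open>c\<close> leave 6 or 10 points on \<open>u\<close>; with
  10, \<open>sdiff u c\<close> would have weight \<open>12 + 12 - 20 = 4\<close>.\<close>

lemma golay_pair_word_card:
  assumes u: "u \<in> C" "card u = 12" and c: "c \<in> C" "c \<inter> - u = {x, y}" "x \<noteq> y"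
  shows "card (c \<inter> u) = 6"
proof -
  have split: "card d = card (d \<inter> u) + card (d \<inter> - u)" for d :: "'n set"
    using card_Int_Diff[of d u] by (simp add: Diff_eq)
  have cd: "card c = card (c \<inter> u) + 2" using split[of c] c by simp
  moreover have "card (c \<inter> u) \<le> 12" using card_mono[of u "c \<inter> u"] u by simp
  ultimately have "card (c \<inter> u) \<in> {6, 10}" using golay_weights[OF c(1)] by auto
  moreover have "card (c \<inter> u) \<noteq> 10"
  proof
    assume "card (c \<inter> u) = 10"
    hence "card (sdiff u c) = 4" using card_sdiff[of u c] cd u by (simp add: Int_commute)
    thus False using golay_weights[OF golay_sdiff[OF u(1) c(1)]] by simp
  qed
  ultimately show ?thesis by auto
qed

text \<open>A set \<open>t\<close> outside \<open>u\<close> that meets all restrictions of code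
  words evenly is itself a code word by self-duality, hence empty or all of \<open>- u\<close>, and
  meets \<open>{x, y}\<close> evenly. By separation every pair is therefore a restriction. Adding
  \<open>u\<close> complements the word within \<open>u\<close>, which arranges
  \<open>p \<in> c\<close>.\<close>

lemma golay_pair_word:
  assumes u: "u \<in> C" "card u = 12" and xy: "x \<notin> u" "y \<notin> u" "x \<noteq> y" and p: "p \<in> u"
  shows "\<exists>c\<in>C. c \<inter> - u = {x, y} \<and> card (c \<inter> u) = 6 \<and> p \<in> c"
proof -
  define V where "V = (\<lambda>c. c \<inter> - u) ` C"
  have "{x, y} \<in> V"
  proof (rule ccontr)
    assume notin: "{x, y} \<notin> V"
    have "\<exists>t\<subseteq>-u. (\<forall>v\<in>V. even (card (t \<inter> v))) \<and> odd (card (t \<inter> {x, y}))"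
    proof (rule binary_separation)
      show "{} \<in> V" unfolding V_def using golay_empty by (auto intro!: image_eqI[of _ _ "{}"])
      show "sdiff v v' \<in> V" if v: "v \<in> V" "v' \<in> V" for v v'
      proof -
        obtain c c' where c: "c \<in> C" "c' \<in> C" "v = c \<inter> - u" "v' = c' \<inter> - u" using v by (auto simp: V_def)
        hence "sdiff v v' = sdiff c c' \<inter> - u" by (auto simp: sdiff_def)
        thus ?thesis using golay_sdiff[OF c(1,2)] by (auto simp: V_def)
      qed
    qed (use notin xy in \<open>auto simp: V_def\<close>)
    then obtain t where t: "t \<subseteq> - u" "\<And>v. v \<in> V \<Longrightarrow> even (card (t \<inter> v))" "odd (card (t \<inter> {x, y}))" by blast
    have "t \<in> C"
    proof (subst golay_self_dual, intro ballI)
      fix d assume "d \<in> C"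
      moreover have "t \<inter> d = t \<inter> (d \<inter> - u)" using t(1) by auto
      ultimately show "even (card (t \<inter> d))" using t(2)[of "d \<inter> - u"] by (auto simp: V_def)
    qed
    hence "t = {} \<or> t = - u"
      using golay_in_dodecad[OF golay_compl[OF u(1)], of t] card_compl24[of u] u t(1) by simp
    moreover have "- u \<inter> {x, y} = {x, y}" using xy by auto
    ultimately show False using t(3) xy by auto
  qed
  then obtain c where c: "c \<in> C" "c \<inter> - u = {x, y}" by (auto simp: V_def)
  show ?thesis
  proof (cases "p \<in> c")
    case True
    thus ?thesis using c golay_pair_word_card[OF u c xy(3)] by blast
  next
    case False
    have s: "sdiff c u \<in> C" "sdiff c u \<inter> - u = {x, y}" using golay_sdiff[OF c(1) u(1)] c(2) by (auto simp: sdiff_def)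
    moreover have "p \<in> sdiff c u" using False p by (auto simp: sdiff_def)
    ultimately show ?thesis using golay_pair_word_card[OF u s xy(3)] by blast
  qed
qed

end

definition nx :: "nat \<Rightarrow> nat" where "nx i = (if i = 23 then 23 else (i + 1) mod 23)"

section \<open>A 23-cycle preserving the code\<close>

context
  fixes C :: "'n::finite set set"
  assumes C: "golay_code C" and card24: "CARD('n) = 24"
begin

lemma golay_even_Int: "c \<in> C \<Longrightarrow> d \<in> C \<Longrightarrow> even (card (c \<inter> d))"
  using golay_self_dual[OF C card24] by blast

text \<open>Coordinates \<open>lab 0, \<dots>, lab 22\<close> form the long cycle and \<open>lab 23\<close> is the fixed point; the labelling
  was found by matching the biplane description of the code with the extended quadratic residue code modulo 23.\<close>

lemma golay_labelled:
  obtains lab :: "nat \<Rightarrow> 'n" where "bij_betw lab {..<24} UNIV"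
    "\<And>Q. Q {} \<Longrightarrow> (\<And>c d. c \<in> C \<Longrightarrow> d \<in> C \<Longrightarrow> Q c \<Longrightarrow> Q d \<Longrightarrow> Q (sdiff c d)) \<Longrightarrow>
       Q (lab ` {0, 1, 2, 3, 4, 5, 12, 13, 16, 17, 19, 23}) \<Longrightarrow>
         Q (lab ` {0, 1, 2, 3, 9, 12, 21, 23}) \<Longrightarrow> Q (lab ` {0, 1, 4, 5, 13, 20, 21, 23}) \<Longrightarrow>
         Q (lab ` {0, 2, 4, 16, 17, 21, 22, 23}) \<Longrightarrow> Q (lab ` {0, 3, 5, 6, 16, 19, 21, 23}) \<Longrightarrow>
         Q (lab ` {0, 12, 13, 17, 18, 19, 21, 23}) \<Longrightarrow>
         Q (lab ` {1, 2, 8, 13, 16, 19, 21, 23}) \<Longrightarrow> Q (lab ` {1, 3, 4, 14, 17, 19, 21, 23}) \<Longrightarrow>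
         Q (lab ` {1, 5, 7, 12, 16, 17, 21, 23}) \<Longrightarrow> Q (lab ` {2, 3, 5, 13, 15, 17, 21, 23}) \<Longrightarrow>
         Q (lab ` {2, 4, 5, 10, 12, 19, 21, 23}) \<Longrightarrow>
         Q (lab ` {3, 4, 11, 12, 13, 16, 21, 23}) \<Longrightarrow> (\<forall>c\<in>C. Q c)"
    "lab ` {0, 1, 2, 3, 4, 5, 12, 13, 16, 17, 19, 23} \<in> C" "lab ` {0, 1, 2, 3, 9, 12, 21, 23} \<in> C"
      "lab ` {0, 1, 4, 5, 13, 20, 21, 23} \<in> C" "lab ` {0, 2, 4, 16, 17, 21, 22, 23} \<in> C"
      "lab ` {0, 3, 5, 6, 16, 19, 21, 23} \<in> C" "lab ` {0, 12, 13, 17, 18, 19, 21, 23} \<in> C"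
      "lab ` {1, 2, 8, 13, 16, 19, 21, 23} \<in> C" "lab ` {1, 3, 4, 14, 17, 19, 21, 23} \<in> C"
      "lab ` {1, 5, 7, 12, 16, 17, 21, 23} \<in> C" "lab ` {2, 3, 5, 13, 15, 17, 21, 23} \<in> C"
      "lab ` {2, 4, 5, 10, 12, 19, 21, 23} \<in> C" "lab ` {3, 4, 11, 12, 13, 16, 21, 23} \<in> C"
proof -
  note cl = golay_sdiff[OF C card24] golay_empty[OF C card24] golay_compl[OF C card24]
  obtain u where u: "u \<in> C" "card u = 12" using golay_dodecad[OF C card24] by blast
  have u': "- u \<in> C" "card (- u) = 12" using cl(3)[OF u(1)] card_compl24[OF C card24, of u] u by auto
  obtain p0 where p0: "p0 \<in> u" using u by (metis card.empty ex_in_conv zero_neq_numeral)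
  obtain w where w: "w \<notin> u" using u' by (metis card.empty ComplD ex_in_conv zero_neq_numeral)
  have "card (- u - {w}) = 11" using u' w by simp
  then obtain i0 where i0: "i0 \<notin> u" "i0 \<noteq> w" by (metis card.empty Diff_iff ComplD ex_in_conv insertI1 zero_neq_numeral)
  \<comment> \<open>Requiring \<open>p0\<close> in the word selects one of the two candidates
    \<open>c\<close> and \<open>sdiff c u\<close>. The words \<open>ew p\<close> below are obtained
    with \<open>u\<close> and \<open>- u\<close> exchanged.\<close>
  have "\<exists>c. \<forall>i. i \<notin> u \<and> i \<noteq> w \<longrightarrow> c i \<in> C \<and> c i \<inter> - u = {w, i} \<and> card (c i \<inter> u) = 6 \<and> p0 \<in> c i"
    using golay_pair_word[OF C card24 u w _ _ p0] by (intro choice) (metis insert_commute)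
  then obtain cw where cw: "\<And>i. i \<notin> u \<Longrightarrow> i \<noteq> w \<Longrightarrow> cw i \<in> C" "\<And>i. i \<notin> u \<Longrightarrow> i \<noteq> w \<Longrightarrow> cw i \<inter> - u = {w, i}"
    "\<And>i. i \<notin> u \<Longrightarrow> i \<noteq> w \<Longrightarrow> card (cw i \<inter> u) = 6" "\<And>i. i \<notin> u \<Longrightarrow> i \<noteq> w \<Longrightarrow> p0 \<in> cw i" by blast
  have "\<exists>e. \<forall>p. p \<in> u \<and> p \<noteq> p0 \<longrightarrow> e p \<in> C \<and> e p \<inter> u = {p0, p} \<and> card (e p \<inter> - u) = 6 \<and> w \<in> e p"
    using golay_pair_word[OF C card24 u', of p0 _ w] p0 w by (intro choice) (simp, metis)
  then obtain ew where ew: "\<And>p. p \<in> u \<Longrightarrow> p \<noteq> p0 \<Longrightarrow> ew p \<in> C" "\<And>p. p \<in> u \<Longrightarrow> p \<noteq> p0 \<Longrightarrow> ew p \<inter> u = {p0, p}"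
    "\<And>p. p \<in> u \<Longrightarrow> p \<noteq> p0 \<Longrightarrow> card (ew p \<inter> - u) = 6" "\<And>p. p \<in> u \<Longrightarrow> p \<noteq> p0 \<Longrightarrow> w \<in> ew p" by blast
  \<comment> \<open>The two words always share \<open>p0\<close> and \<open>w\<close>; beyond these
    they can share only \<open>p\<close> and \<open>i\<close>. Even intersection makes the two
    incidences equivalent.\<close>
  have inc: "p \<in> cw i \<longleftrightarrow> i \<in> ew p" if "p \<in> u" "p \<noteq> p0" "i \<notin> u" "i \<noteq> w" for p i
  proof -
    have "cw i \<inter> ew p = (cw i \<inter> {p0, p}) \<union> (ew p \<inter> {w, i})"
      using cw(2)[OF that(3,4)] ew(2)[OF that(1,2)] by blast
    also have "\<dots> = (if p \<in> cw i then {p0, p} else {p0}) \<union> (if i \<in> ew p then {w, i} else {w})"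
      using cw(4)[OF that(3,4)] ew(4)[OF that(1,2)] by auto
    finally have "card (cw i \<inter> ew p) = card ((if p \<in> cw i then {p0, p} else {p0}) \<union> (if i \<in> ew p then {w, i} else {w}))" by simp
    also have "\<dots> = (if p \<in> cw i then 2 else 1) + (if i \<in> ew p then 2 else 1)"
      using that p0 w by (subst card_Un_disjoint) auto
    finally show ?thesis using golay_even_Int[OF cw(1)[OF that(3,4)] ew(1)[OF that(1,2)]] by (auto split: if_splits)
  qed
  \<comment> \<open>Both words and their sum have 6 points on \<open>v\<close>, and
    \<open>6 + 6 - 2 * 3 = 6\<close>. Thus the sets \<open>cw i \<inter> u - {p0}\<close> are
    5-subsets of 11 points that meet pairwise in 2 points, the blocks of a biplane.\<close>
  have three: "card (c \<inter> d \<inter> v) = 3"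
    if v: "v \<in> C" "card v = 12" and c: "c \<in> C" "d \<in> C" "c \<inter> - v = {z, x}" "d \<inter> - v = {z, y}" "card (c \<inter> v) = 6" "card (d \<inter> v) = 6" "x \<noteq> y" "z \<noteq> x" "z \<noteq> y"
    for v c d x y z
  proof -
    have "sdiff c d \<inter> - v = {x, y}"
    proof (rule set_eqI)
      fix a
      have "a \<in> c \<inter> - v \<longleftrightarrow> a \<in> {z, x}" "a \<in> d \<inter> - v \<longleftrightarrow> a \<in> {z, y}" using c(3,4) by simp_all
      thus "a \<in> sdiff c d \<inter> - v \<longleftrightarrow> a \<in> {x, y}" using c(7-9) unfolding sdiff_def by auto
    qed
    from golay_pair_word_card[OF C card24 v cl(1)[OF c(1,2)] this c(7)] have "card (sdiff c d \<inter> v) = 6" .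
    moreover have "sdiff c d \<inter> v = sdiff (c \<inter> v) (d \<inter> v)" by (auto simp: sdiff_def)
    moreover have "(c \<inter> v) \<inter> (d \<inter> v) = c \<inter> d \<inter> v" by auto
    ultimately show ?thesis using card_sdiff[of "c \<inter> v" "d \<inter> v"] c by simp
  qed
  have three_c: "card (cw i \<inter> cw j \<inter> u) = 3" if "i \<notin> u" "i \<noteq> w" "j \<notin> u" "j \<noteq> w" "i \<noteq> j" for i j
    by (rule three[OF u, of _ _ w i j]) (use that cw in auto)
  have three_e: "card (ew p \<inter> ew q \<inter> - u) = 3" if "p \<in> u" "p \<noteq> p0" "q \<in> u" "q \<noteq> p0" "p \<noteq> q" for p q
    by (rule three[OF u', of _ _ p0 p q]) (use that ew in auto)
  \<comment> \<open>The block whose residual is taken; \<open>P\<close> is its complement in the 11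
    points.\<close>
  define X where "X = cw i0 \<inter> u - {p0}"
  define P where "P = u - {p0} - X"
  have Xu: "X \<subseteq> u" "p0 \<notin> X" by (auto simp: X_def)
  have cX: "card X = 5" unfolding X_def using cw(3,4)[OF i0] p0 by simp
  have cP: "card P = 6"
  proof -
    have "card P = card (u - {p0}) - card X" unfolding P_def by (rule card_Diff_subset) (use Xu in auto)
    thus ?thesis using u p0 cX by simp
  qed
  have upart: "u = insert p0 (X \<union> P)" using p0 Xu by (auto simp: P_def)
  \<comment> \<open>Two points of a biplane lie on two blocks; one has index \<open>i0\<close>, and
    this is the index of the other.\<close>
  define I where "I = (\<lambda>x y. SOME i. i \<in> ew x \<inter> ew y \<inter> - u - {w, i0})"
  have Isym: "I x y = I y x" for x y
    unfolding I_def by (subst Int_commute[of "ew x" "ew y"]) (rule refl)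
  have I: "I x y \<notin> u \<and> I x y \<noteq> w \<and> I x y \<noteq> i0 \<and> x \<in> cw (I x y) \<and> y \<in> cw (I x y)"
    if xy: "x \<in> X" "y \<in> X" "x \<noteq> y" for x y
  proof -
    have m: "x \<in> u" "x \<noteq> p0" "y \<in> u" "y \<noteq> p0" using xy by (auto simp: X_def)
    have "card (ew x \<inter> ew y \<inter> - u) - card {w, i0} \<le> card (ew x \<inter> ew y \<inter> - u - {w, i0})"
      by (rule diff_card_le_card_Diff) simp
    moreover have "card {w, i0} = 2" using i0 by simp
    ultimately have "card (ew x \<inter> ew y \<inter> - u - {w, i0}) \<noteq> 0" using three_e[OF m xy(3)] by linarith
    hence "\<exists>i. i \<in> ew x \<inter> ew y \<inter> - u - {w, i0}" by (metis card.empty ex_in_conv)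
    hence "I x y \<in> ew x \<inter> ew y \<inter> - u - {w, i0}" unfolding I_def by (rule someI_ex)
    thus ?thesis using inc[OF m(1,2)] inc[OF m(3,4)] by auto
  qed
  have part: "card (c \<inter> u) = 1 + card (c \<inter> X) + card (c \<inter> P)" if "p0 \<in> c" for c
  proof -
    have "c \<inter> u = insert p0 ((c \<inter> X) \<union> (c \<inter> P))" using that upart by auto
    moreover have "p0 \<notin> (c \<inter> X) \<union> (c \<inter> P)" using Xu by (auto simp: P_def)
    moreover have "card ((c \<inter> X) \<union> (c \<inter> P)) = card (c \<inter> X) + card (c \<inter> P)"
      by (rule card_Un_disjoint) (auto simp: P_def)
    ultimately show ?thesis by simp
  qed
  have IX: "cw (I x y) \<inter> X = {x, y}" if xy: "x \<in> X" "y \<in> X" "x \<noteq> y" for x y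
  proof -
    note Ixy = I[OF xy]
    have "card (cw (I x y) \<inter> cw i0 \<inter> u) = 3" by (rule three_c) (use Ixy i0 in auto)
    moreover have "cw (I x y) \<inter> cw i0 \<inter> u = insert p0 (cw (I x y) \<inter> X)"
      using cw(4)[OF i0] cw(4)[of "I x y"] Ixy p0 by (auto simp: X_def)
    ultimately have "card (cw (I x y) \<inter> X) = 2" using Xu by simp
    thus ?thesis using card_subset_eq[of "cw (I x y) \<inter> X" "{x, y}"] Ixy xy by auto
  qed
  define R where "R = (\<lambda>x y. cw (I x y) \<inter> P)"
  have Rint: "card (R x y \<inter> R z v) + card ({x, y} \<inter> {z, v}) = 2"
    if "x \<in> X" "y \<in> X" "x \<noteq> y" "z \<in> X" "v \<in> X" "z \<noteq> v" "{x, y} \<noteq> {z, v}" for x y z v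
  proof -
    have ne: "I x y \<noteq> I z v" using IX[OF that(1-3)] IX[OF that(4-6)] that(7) by metis
    have "card (cw (I x y) \<inter> cw (I z v) \<inter> u) = 3" by (rule three_c) (use I[OF that(1-3)] I[OF that(4-6)] ne in auto)
    moreover have "card (cw (I x y) \<inter> cw (I z v) \<inter> u) = 1 + card (cw (I x y) \<inter> cw (I z v) \<inter> X) + card (cw (I x y) \<inter> cw (I z v) \<inter> P)"
      by (rule part) (use cw(4) I[OF that(1-3)] I[OF that(4-6)] in auto)
    moreover have "cw (I x y) \<inter> cw (I z v) \<inter> X = {x, y} \<inter> {z, v}" using IX[OF that(1-3)] IX[OF that(4-6)] by blast
    moreover have "cw (I x y) \<inter> cw (I z v) \<inter> P = R x y \<inter> R z v" by (auto simp: R_def)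
    ultimately show ?thesis by simp
  qed
  obtain xs where xs: "set xs = X" "distinct xs" "length xs = 5"
    using finite_distinct_list[of X] cX distinct_card by (metis finite)
  obtain x1 x2 x3 x4 x5 where "xs = [x1, x2, x3, x4, x5]"
    using xs(3) by (auto simp: length_Suc_conv numeral_eq_Suc)
  hence X5: "X = {x1, x2, x3, x4, x5}" "distinct [x1, x2, x3, x4, x5]" using xs by auto
  have "\<exists>y1 y2 A B C D E F. {y1, y2} = {x1, x2} \<and> distinct [A, B, C, D, E, F] \<and> P = {A, B, C, D, E, F} \<and>
    R y1 y2 = {A, B, C} \<and> R y1 x3 = {A, D, F} \<and> R y1 x4 = {C, E, F} \<and> R y1 x5 = {B, D, E} \<and>
    R y2 x3 = {B, E, F} \<and> R y2 x4 = {A, D, E} \<and> R y2 x5 = {C, D, F} \<and>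
    R x3 x4 = {B, C, D} \<and> R x3 x5 = {A, C, E} \<and> R x4 x5 = {A, B, F}"
  proof (rule biplane_table[of P X R x1 x2 x3 x4 x5])
    show "R x y \<subseteq> P \<and> card (R x y) = 3" if xy: "x \<in> X" "y \<in> X" "x \<noteq> y" for x y
    proof -
      note Ixy = I[OF xy]
      have "card (cw (I x y) \<inter> u) = 1 + card (cw (I x y) \<inter> X) + card (cw (I x y) \<inter> P)"
        by (rule part) (use cw(4) Ixy in auto)
      thus ?thesis using cw(3)[of "I x y"] Ixy IX[OF xy] xy(3) by (simp add: R_def)
    qed
    show "card (R x y \<inter> R z v) = 2" if "{x, y, z, v} \<subseteq> X" "distinct [x, y, z, v]" for x y z v
      using Rint[of x y z v] that by auto
    show "card (R x y \<inter> R x z) = 1" if "{x, y, z} \<subseteq> X" "distinct [x, y, z]" for x y z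
    proof -
      have "{x, y} \<inter> {x, z} = {x}" using that by auto
      thus ?thesis using Rint[of x y x z] that by (auto simp: doubleton_eq_iff)
    qed
    show "R x y = R y x" for x y by (simp add: R_def Isym)
  qed (use cP X5 in auto)
  then obtain y1 y2 A B Cc D E F where y: "{y1, y2} = {x1, x2}" and P6: "distinct [A, B, Cc, D, E, F]" "P = {A, B, Cc, D, E, F}"
    and T: "R y1 y2 = {A, B, Cc}" "R y1 x3 = {A, D, F}" "R y1 x4 = {Cc, E, F}" "R y1 x5 = {B, D, E}"
    "R y2 x3 = {B, E, F}" "R y2 x4 = {A, D, E}" "R y2 x5 = {Cc, D, F}"
    "R x3 x4 = {B, Cc, D}" "R x3 x5 = {A, Cc, E}" "R x4 x5 = {A, B, F}" by metis
  have Xy: "X = {y1, y2, x3, x4, x5}" "distinct [y1, y2, x3, x4, x5]" using X5 y by (auto simp: doubleton_eq_iff)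
  have cwI: "cw (I x y) = {w, I x y, p0, x, y} \<union> R x y" if xy: "x \<in> X" "y \<in> X" "x \<noteq> y" for x y
  proof -
    note Ixy = I[OF xy]
    have "cw (I x y) = (cw (I x y) \<inter> - u) \<union> (cw (I x y) \<inter> u)" by auto
    also have "cw (I x y) \<inter> u = insert p0 ((cw (I x y) \<inter> X) \<union> (cw (I x y) \<inter> P))"
      using cw(4)[of "I x y"] Ixy upart by auto
    finally show ?thesis using cw(2)[of "I x y"] Ixy IX[OF xy] by (auto simp: R_def)
  qed
  have cwi0: "cw i0 = {w, i0, p0} \<union> X" using cw(2)[OF i0] cw(4)[OF i0] p0 by (auto simp: X_def)
  define Is where "Is = [I y1 y2, I y1 x3, I y1 x4, I y1 x5, I y2 x3, I y2 x4, I y2 x5, I x3 x4, I x3 x5, I x4 x5]"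
  have dIs: "distinct Is"
  proof -
    have "map (\<lambda>i. cw i \<inter> X) Is = [{y1, y2}, {y1, x3}, {y1, x4}, {y1, x5}, {y2, x3}, {y2, x4}, {y2, x5}, {x3, x4}, {x3, x5}, {x4, x5}]"
      unfolding Is_def list.map using Xy(2) by (intro arg_cong2[where f = Cons] IX refl) (simp_all add: Xy(1))
    moreover have "distinct [{y1, y2}, {y1, x3}, {y1, x4}, {y1, x5}, {y2, x3}, {y2, x4}, {y2, x5}, {x3, x4}, {x3, x5}, {x4, x5}]"
      using Xy(2) by (simp add: doubleton_eq_iff)
    ultimately show ?thesis by (metis distinct_map)
  qed
  have Isu: "set Is \<subseteq> - u - {w, i0}"
    using I Xy unfolding Is_def by auto
  have cu: "- u = {w, i0} \<union> set Is"
  proof (rule card_subset_eq[symmetric])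
    show "{w, i0} \<union> set Is \<subseteq> - u" using Isu w i0 by auto
    have "card ({w, i0} \<union> set Is) = card {w, i0} + card (set Is)" by (rule card_Un_disjoint) (use Isu in auto)
    also have "card (set Is) = 10" using distinct_card[OF dIs] by (simp add: Is_def)
    finally show "card ({w, i0} \<union> set Is) = card (- u)" using u' i0 by auto
  qed simp
  \<comment> \<open>List positions are the labels. The dodecad \<open>u\<close> occupies 0 to 5, 12,
    13, 16, 17, 19 and 23, with \<open>p0\<close> at the fixed position 23; the point
    \<open>w\<close> is at 21.\<close>
  define ls where "ls = [y1, y2, x3, x4, A, Cc, I y1 x4, I y2 x5, I y2 x3, i0, I x3 x5, I x4 x5, x5, B, I y2 x4, I x3 x4, F, D, I y1 x5, E, I y1 y2, w, I y1 x3, p0]"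
  define lab where "lab = (!) ls"
  have dls: "distinct ls"
  proof -
    have "distinct ([p0, y1, y2, x3, x4, x5, A, B, Cc, D, E, F] @ [w, i0] @ Is)"
    proof -
      have "distinct [p0, y1, y2, x3, x4, x5, A, B, Cc, D, E, F]" using Xy P6 Xu by (auto simp: P_def)
      moreover have "set [p0, y1, y2, x3, x4, x5, A, B, Cc, D, E, F] = u" using upart Xy P6 by auto
      ultimately show ?thesis using dIs Isu i0 w by auto
    qed
    hence "distinct [p0, y1, y2, x3, x4, x5, A, B, Cc, D, E, F, w, i0, I y1 y2, I y1 x3, I y1 x4, I y1 x5, I y2 x3, I y2 x4, I y2 x5, I x3 x4, I x3 x5, I x4 x5]" by (simp only: Is_def append.simps)
    moreover have "mset ls = mset [p0, y1, y2, x3, x4, x5, A, B, Cc, D, E, F, w, i0, I y1 y2, I y1 x3, I y1 x4, I y1 x5, I y2 x3, I y2 x4, I y2 x5, I x3 x4, I x3 x5, I x4 x5]" by (simp add: ls_def)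
    ultimately show ?thesis using mset_eq_imp_distinct_iff by blast
  qed
  have sls: "set ls = UNIV"
    by (rule card_subset_eq) (use distinct_card[OF dls] card24 in \<open>simp_all add: ls_def\<close>)
  have bij: "bij_betw lab {..<24} UNIV"
    unfolding lab_def
  proof (rule bij_betw_nth[OF dls])
    show "{..<24} = {..<length ls}" by (simp add: ls_def)
    show "UNIV = set ls" using sls by simp
  qed
  have W_u: "lab ` {0, 1, 2, 3, 4, 5, 12, 13, 16, 17, 19, 23} = u"
    unfolding lab_def ls_def using upart Xy(1) P6(2) by auto
  have W_i0: "lab ` {0, 1, 2, 3, 9, 12, 21, 23} = cw i0"
    unfolding lab_def ls_def cwi0 Xy(1) by auto
  have W_12: "lab ` {0, 1, 4, 5, 13, 20, 21, 23} = cw (I y1 y2)"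
  proof -
    have "cw (I y1 y2) = {w, I y1 y2, p0, y1, y2} \<union> R y1 y2" by (rule cwI) (use Xy in auto)
    thus ?thesis unfolding lab_def ls_def T by auto
  qed
  have W_13: "lab ` {0, 2, 4, 16, 17, 21, 22, 23} = cw (I y1 x3)"
  proof -
    have "cw (I y1 x3) = {w, I y1 x3, p0, y1, x3} \<union> R y1 x3" by (rule cwI) (use Xy in auto)
    thus ?thesis unfolding lab_def ls_def T by auto
  qed
  have W_14: "lab ` {0, 3, 5, 6, 16, 19, 21, 23} = cw (I y1 x4)"
  proof -
    have "cw (I y1 x4) = {w, I y1 x4, p0, y1, x4} \<union> R y1 x4" by (rule cwI) (use Xy in auto)
    thus ?thesis unfolding lab_def ls_def T by auto
  qed
  have W_15: "lab ` {0, 12, 13, 17, 18, 19, 21, 23} = cw (I y1 x5)"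
  proof -
    have "cw (I y1 x5) = {w, I y1 x5, p0, y1, x5} \<union> R y1 x5" by (rule cwI) (use Xy in auto)
    thus ?thesis unfolding lab_def ls_def T by auto
  qed
  have W_23: "lab ` {1, 2, 8, 13, 16, 19, 21, 23} = cw (I y2 x3)"
  proof -
    have "cw (I y2 x3) = {w, I y2 x3, p0, y2, x3} \<union> R y2 x3" by (rule cwI) (use Xy in auto)
    thus ?thesis unfolding lab_def ls_def T by auto
  qed
  have W_24: "lab ` {1, 3, 4, 14, 17, 19, 21, 23} = cw (I y2 x4)"
  proof -
    have "cw (I y2 x4) = {w, I y2 x4, p0, y2, x4} \<union> R y2 x4" by (rule cwI) (use Xy in auto)
    thus ?thesis unfolding lab_def ls_def T by auto
  qed
  have W_25: "lab ` {1, 5, 7, 12, 16, 17, 21, 23} = cw (I y2 x5)"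
  proof -
    have "cw (I y2 x5) = {w, I y2 x5, p0, y2, x5} \<union> R y2 x5" by (rule cwI) (use Xy in auto)
    thus ?thesis unfolding lab_def ls_def T by auto
  qed
  have W_34: "lab ` {2, 3, 5, 13, 15, 17, 21, 23} = cw (I x3 x4)"
  proof -
    have "cw (I x3 x4) = {w, I x3 x4, p0, x3, x4} \<union> R x3 x4" by (rule cwI) (use Xy in auto)
    thus ?thesis unfolding lab_def ls_def T by auto
  qed
  have W_35: "lab ` {2, 4, 5, 10, 12, 19, 21, 23} = cw (I x3 x5)"
  proof -
    have "cw (I x3 x5) = {w, I x3 x5, p0, x3, x5} \<union> R x3 x5" by (rule cwI) (use Xy in auto)
    thus ?thesis unfolding lab_def ls_def T by auto
  qed
  have W_45: "lab ` {3, 4, 11, 12, 13, 16, 21, 23} = cw (I x4 x5)"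
  proof -
    have "cw (I x4 x5) = {w, I x4 x5, p0, x4, x5} \<union> R x4 x5" by (rule cwI) (use Xy in auto)
    thus ?thesis unfolding lab_def ls_def T by auto
  qed
  have inC: "lab ` {0, 1, 2, 3, 4, 5, 12, 13, 16, 17, 19, 23} \<in> C" "lab ` {0, 1, 2, 3, 9, 12, 21, 23} \<in> C"
    "lab ` {0, 1, 4, 5, 13, 20, 21, 23} \<in> C" "lab ` {0, 2, 4, 16, 17, 21, 22, 23} \<in> C"
    "lab ` {0, 3, 5, 6, 16, 19, 21, 23} \<in> C" "lab ` {0, 12, 13, 17, 18, 19, 21, 23} \<in> C"
    "lab ` {1, 2, 8, 13, 16, 19, 21, 23} \<in> C" "lab ` {1, 3, 4, 14, 17, 19, 21, 23} \<in> C"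
    "lab ` {1, 5, 7, 12, 16, 17, 21, 23} \<in> C" "lab ` {2, 3, 5, 13, 15, 17, 21, 23} \<in> C"
    "lab ` {2, 4, 5, 10, 12, 19, 21, 23} \<in> C" "lab ` {3, 4, 11, 12, 13, 16, 21, 23} \<in> C"
    unfolding W_u W_i0 W_12 W_13 W_14 W_15 W_23 W_24 W_25 W_34 W_35 W_45 using u(1) cw(1) i0 I Xy by auto
  show ?thesis
  proof (rule that[OF bij])
    fix Q :: "'n set \<Rightarrow> bool"
    assume Q0: "Q {}" and Qs: "\<And>c d. c \<in> C \<Longrightarrow> d \<in> C \<Longrightarrow> Q c \<Longrightarrow> Q d \<Longrightarrow> Q (sdiff c d)"
      and Qg: "Q (lab ` {0, 1, 2, 3, 4, 5, 12, 13, 16, 17, 19, 23})" "Q (lab ` {0, 1, 2, 3, 9, 12, 21, 23})"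
        "Q (lab ` {0, 1, 4, 5, 13, 20, 21, 23})" "Q (lab ` {0, 2, 4, 16, 17, 21, 22, 23})"
        "Q (lab ` {0, 3, 5, 6, 16, 19, 21, 23})" "Q (lab ` {0, 12, 13, 17, 18, 19, 21, 23})"
        "Q (lab ` {1, 2, 8, 13, 16, 19, 21, 23})" "Q (lab ` {1, 3, 4, 14, 17, 19, 21, 23})"
        "Q (lab ` {1, 5, 7, 12, 16, 17, 21, 23})" "Q (lab ` {2, 3, 5, 13, 15, 17, 21, 23})"
        "Q (lab ` {2, 4, 5, 10, 12, 19, 21, 23})" "Q (lab ` {3, 4, 11, 12, 13, 16, 21, 23})"
    have Qu: "Q u" and Qi0: "Q (cw i0)" using Qg(1,2) W_u W_i0 by simp_all
    have QI: "Q (cw i)" if "i \<in> set Is" for i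
      using that Qg(3-12)[unfolded W_12 W_13 W_14 W_15 W_23 W_24 W_25 W_34 W_35 W_45] unfolding Is_def by auto
    have Qcw: "Q (cw i)" if "i \<notin> u" "i \<noteq> w" for i
      using that cu QI Qi0 by auto
    \<comment> \<open>Adding \<open>cw i\<close> removes the point \<open>i\<close> and changes no
      other point outside \<open>u\<close> except \<open>w\<close>. Once nothing but
      \<open>w\<close> can be left there, even intersection with \<open>- u\<close> excludes it, and
      a word inside the dodecad is empty or \<open>u\<close>.\<close>
    have "Q c" if "c \<in> C" for c
      using that
    proof (induction "card (c \<inter> - u - {w})" arbitrary: c rule: less_induct)
      case less
      show ?case
      proof (cases "c \<inter> - u - {w} = {}")
        case True
        have "even (card (c \<inter> - u))" by (rule golay_even_Int[OF less.prems u'(1)])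
        moreover have "c \<inter> - u = {} \<or> c \<inter> - u = {w}" using True by auto
        ultimately have "c \<subseteq> u" by auto
        thus ?thesis using golay_in_dodecad[OF C card24 u less.prems] Q0 Qu by blast
      next
        case False
        then obtain i where i: "i \<in> c" "i \<notin> u" "i \<noteq> w" by auto
        define d where "d = sdiff c (cw i)"
        have dC: "d \<in> C" unfolding d_def by (rule cl(1)[OF less.prems cw(1)[OF i(2,3)]])
        have "d \<inter> - u - {w} = (c \<inter> - u - {w}) - {i}" using cw(2)[OF i(2,3)] i unfolding d_def sdiff_def by blast
        moreover have "i \<in> c \<inter> - u - {w}" using i by blast
        ultimately have "card (d \<inter> - u - {w}) < card (c \<inter> - u - {w})" by (metis card_Diff1_less finite)
        hence "Q d" by (rule less.hyps[OF _ dC])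
        hence "Q (sdiff d (cw i))" by (rule Qs[OF dC cw(1)[OF i(2,3)] _ Qcw[OF i(2,3)]])
        moreover have "sdiff d (cw i) = c" by (auto simp: d_def sdiff_def)
        ultimately show ?thesis by simp
      qed
    qed
    thus "\<forall>c\<in>C. Q c" by blast
  next
    show "lab ` {0, 1, 2, 3, 4, 5, 12, 13, 16, 17, 19, 23} \<in> C" "lab ` {0, 1, 2, 3, 9, 12, 21, 23} \<in> C"
      "lab ` {0, 1, 4, 5, 13, 20, 21, 23} \<in> C" "lab ` {0, 2, 4, 16, 17, 21, 22, 23} \<in> C"
      "lab ` {0, 3, 5, 6, 16, 19, 21, 23} \<in> C" "lab ` {0, 12, 13, 17, 18, 19, 21, 23} \<in> C"
      "lab ` {1, 2, 8, 13, 16, 19, 21, 23} \<in> C" "lab ` {1, 3, 4, 14, 17, 19, 21, 23} \<in> C"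
      "lab ` {1, 5, 7, 12, 16, 17, 21, 23} \<in> C" "lab ` {2, 3, 5, 13, 15, 17, 21, 23} \<in> C"
      "lab ` {2, 4, 5, 10, 12, 19, 21, 23} \<in> C" "lab ` {3, 4, 11, 12, 13, 16, 21, 23} \<in> C" by (rule inC)+
  qed
qed

text \<open>Shifting labels is compatible with sums of words, so only the twelve generators need
  checking. Each shifted generator is exhibited as an explicit sum of generators.\<close>

theorem golay_cycle:
  obtains lab :: "nat \<Rightarrow> 'n" where "bij_betw lab {..<24} UNIV"
    "\<And>K. K \<subseteq> {..<24} \<Longrightarrow> lab ` K \<in> C \<Longrightarrow> lab ` nx ` K \<in> C"
proof -
  obtain lab :: "nat \<Rightarrow> 'n" where bij: "bij_betw lab {..<24} UNIV"
    and span: "\<And>Q. Q {} \<Longrightarrow> (\<And>c d. c \<in> C \<Longrightarrow> d \<in> C \<Longrightarrow> Q c \<Longrightarrow> Q d \<Longrightarrow> Q (sdiff c d)) \<Longrightarrow>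
       Q (lab ` {0, 1, 2, 3, 4, 5, 12, 13, 16, 17, 19, 23}) \<Longrightarrow>
         Q (lab ` {0, 1, 2, 3, 9, 12, 21, 23}) \<Longrightarrow> Q (lab ` {0, 1, 4, 5, 13, 20, 21, 23}) \<Longrightarrow>
         Q (lab ` {0, 2, 4, 16, 17, 21, 22, 23}) \<Longrightarrow> Q (lab ` {0, 3, 5, 6, 16, 19, 21, 23}) \<Longrightarrow>
         Q (lab ` {0, 12, 13, 17, 18, 19, 21, 23}) \<Longrightarrow>
         Q (lab ` {1, 2, 8, 13, 16, 19, 21, 23}) \<Longrightarrow> Q (lab ` {1, 3, 4, 14, 17, 19, 21, 23}) \<Longrightarrow>
         Q (lab ` {1, 5, 7, 12, 16, 17, 21, 23}) \<Longrightarrow> Q (lab ` {2, 3, 5, 13, 15, 17, 21, 23}) \<Longrightarrow>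
         Q (lab ` {2, 4, 5, 10, 12, 19, 21, 23}) \<Longrightarrow>
         Q (lab ` {3, 4, 11, 12, 13, 16, 21, 23}) \<Longrightarrow> (\<forall>c\<in>C. Q c)"
    and gen: "lab ` {0, 1, 2, 3, 4, 5, 12, 13, 16, 17, 19, 23} \<in> C" "lab ` {0, 1, 2, 3, 9, 12, 21, 23} \<in> C"
      "lab ` {0, 1, 4, 5, 13, 20, 21, 23} \<in> C" "lab ` {0, 2, 4, 16, 17, 21, 22, 23} \<in> C"
      "lab ` {0, 3, 5, 6, 16, 19, 21, 23} \<in> C" "lab ` {0, 12, 13, 17, 18, 19, 21, 23} \<in> C"
      "lab ` {1, 2, 8, 13, 16, 19, 21, 23} \<in> C" "lab ` {1, 3, 4, 14, 17, 19, 21, 23} \<in> C"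
      "lab ` {1, 5, 7, 12, 16, 17, 21, 23} \<in> C" "lab ` {2, 3, 5, 13, 15, 17, 21, 23} \<in> C"
      "lab ` {2, 4, 5, 10, 12, 19, 21, 23} \<in> C" "lab ` {3, 4, 11, 12, 13, 16, 21, 23} \<in> C"
    using golay_labelled by blast
  have inj: "inj_on lab {..<24}" using bij by (simp add: bij_betw_def)
  have nxlt: "nx ` K \<subseteq> {..<24}" if "K \<subseteq> {..<24}" for K using that by (auto simp: nx_def)
  have injnx: "inj_on nx {..<24}"
  proof (rule inj_onI)
    fix i j assume "i \<in> {..<24::nat}" "j \<in> {..<24::nat}" "nx i = nx j"
    thus "i = j" unfolding nx_def by (auto split: if_splits simp: mod_Suc)
  qed
  have inj2: "inj_on (lab \<circ> nx) {..<24}" using comp_inj_on[OF injnx inj_on_subset[OF inj nxlt[of "{..<24}"]]] by simp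
  define pre where "pre = (\<lambda>c. {k \<in> {..<24}. lab k \<in> c})"
  have pre_lab: "pre (lab ` K) = K" if "K \<subseteq> {..<24}" for K
    using that inj by (auto simp: pre_def inj_on_def)
  have im_sdiff: "f ` sdiff a b = sdiff (f ` a) (f ` b)" if "inj_on f {..<24}" "a \<subseteq> {..<24}" "b \<subseteq> {..<24}"
    for f :: "nat \<Rightarrow> 'n" and a b
    unfolding sdiff_def using that by (simp add: image_Un inj_on_image_set_diff[of f "{..<24}"] subset_insertI2 Diff_subset[THEN subset_trans])
  define G where "G = (\<lambda>K. K \<subseteq> {..<24} \<and> lab ` K \<in> C)"
  have Gs: "G (sdiff K K')" if "G K" "G K'" for K K'
    using that im_sdiff[OF inj, of K K'] golay_sdiff[OF C card24, of "lab ` K"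
      "lab ` K'"] unfolding G_def by (auto simp: sdiff_def)
  have G0: "G {0, 1, 2, 3, 4, 5, 12, 13, 16, 17, 19, 23}" unfolding G_def using gen(1) by simp
  have G1: "G {0, 1, 2, 3, 9, 12, 21, 23}" unfolding G_def using gen(2) by simp
  have G2: "G {0, 1, 4, 5, 13, 20, 21, 23}" unfolding G_def using gen(3) by simp
  have G3: "G {0, 2, 4, 16, 17, 21, 22, 23}" unfolding G_def using gen(4) by simp
  have G4: "G {0, 3, 5, 6, 16, 19, 21, 23}" unfolding G_def using gen(5) by simp
  have G5: "G {0, 12, 13, 17, 18, 19, 21, 23}" unfolding G_def using gen(6) by simp
  have G6: "G {1, 2, 8, 13, 16, 19, 21, 23}" unfolding G_def using gen(7) by simp
  have G7: "G {1, 3, 4, 14, 17, 19, 21, 23}" unfolding G_def using gen(8) by simp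
  have G8: "G {1, 5, 7, 12, 16, 17, 21, 23}" unfolding G_def using gen(9) by simp
  have G9: "G {2, 3, 5, 13, 15, 17, 21, 23}" unfolding G_def using gen(10) by simp
  have G10: "G {2, 4, 5, 10, 12, 19, 21, 23}" unfolding G_def using gen(11) by simp
  have G11: "G {3, 4, 11, 12, 13, 16, 21, 23}" unfolding G_def using gen(12) by simp
  have N0: "lab ` nx ` {0, 1, 2, 3, 4, 5, 12, 13, 16, 17, 19, 23} \<in> C"
  proof -
    have "nx ` {0, 1, 2, 3, 4, 5, 12, 13, 16, 17, 19, 23} = sdiff {0, 1, 2, 3, 4, 5, 12, 13, 16, 17, 19, 23} (sdiff {0, 1, 4, 5, 13, 20, 21, 23} (sdiff {0, 3, 5, 6, 16, 19, 21, 23} (sdiff {0, 12, 13, 17, 18, 19, 21, 23} {1, 3, 4, 14, 17, 19, 21, 23})))"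
      by (rule subset_antisym; simp add: nx_def sdiff_def insert_Diff_if)
    moreover have "G (sdiff {0, 1, 2, 3, 4, 5, 12, 13, 16, 17, 19, 23} (sdiff {0, 1, 4, 5, 13, 20, 21, 23} (sdiff {0, 3, 5, 6, 16, 19, 21, 23} (sdiff {0, 12, 13, 17, 18, 19, 21, 23} {1, 3, 4, 14, 17, 19, 21, 23}))))" by (intro Gs G0 G2 G4 G5 G7)
    ultimately show ?thesis by (simp add: G_def)
  qed
  have N1: "lab ` nx ` {0, 1, 2, 3, 9, 12, 21, 23} \<in> C"
  proof -
    have "nx ` {0, 1, 2, 3, 9, 12, 21, 23} = sdiff {0, 1, 2, 3, 4, 5, 12, 13, 16, 17, 19, 23} (sdiff {0, 2, 4, 16, 17, 21, 22, 23} {2, 4, 5, 10, 12, 19, 21, 23})"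
      by (rule subset_antisym; simp add: nx_def sdiff_def insert_Diff_if)
    moreover have "G (sdiff {0, 1, 2, 3, 4, 5, 12, 13, 16, 17, 19, 23} (sdiff {0, 2, 4, 16, 17, 21, 22, 23} {2, 4, 5, 10, 12, 19, 21, 23}))" by (intro Gs G0 G3 G10)
    ultimately show ?thesis by (simp add: G_def)
  qed
  have N2: "lab ` nx ` {0, 1, 4, 5, 13, 20, 21, 23} \<in> C"
  proof -
    have "nx ` {0, 1, 4, 5, 13, 20, 21, 23} = sdiff {0, 2, 4, 16, 17, 21, 22, 23} (sdiff {0, 3, 5, 6, 16, 19, 21, 23} {1, 3, 4, 14, 17, 19, 21, 23})"
      by (rule subset_antisym; simp add: nx_def sdiff_def insert_Diff_if)
    moreover have "G (sdiff {0, 2, 4, 16, 17, 21, 22, 23} (sdiff {0, 3, 5, 6, 16, 19, 21, 23} {1, 3, 4, 14, 17, 19, 21, 23}))" by (intro Gs G3 G4 G7)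
    ultimately show ?thesis by (simp add: G_def)
  qed
  have N3: "lab ` nx ` {0, 2, 4, 16, 17, 21, 22, 23} \<in> C"
  proof -
    have "nx ` {0, 2, 4, 16, 17, 21, 22, 23} = sdiff {0, 1, 2, 3, 4, 5, 12, 13, 16, 17, 19, 23} (sdiff {0, 2, 4, 16, 17, 21, 22, 23} {0, 12, 13, 17, 18, 19, 21, 23})"
      by (rule subset_antisym; simp add: nx_def sdiff_def insert_Diff_if)
    moreover have "G (sdiff {0, 1, 2, 3, 4, 5, 12, 13, 16, 17, 19, 23} (sdiff {0, 2, 4, 16, 17, 21, 22, 23} {0, 12, 13, 17, 18, 19, 21, 23}))" by (intro Gs G0 G3 G5)
    ultimately show ?thesis by (simp add: G_def)
  qed
  have N4: "lab ` nx ` {0, 3, 5, 6, 16, 19, 21, 23} \<in> C"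
  proof -
    have "nx ` {0, 3, 5, 6, 16, 19, 21, 23} = sdiff {0, 1, 2, 3, 4, 5, 12, 13, 16, 17, 19, 23} (sdiff {0, 1, 4, 5, 13, 20, 21, 23} (sdiff {0, 2, 4, 16, 17, 21, 22, 23} (sdiff {0, 3, 5, 6, 16, 19, 21, 23} {1, 5, 7, 12, 16, 17, 21, 23})))"
      by (rule subset_antisym; simp add: nx_def sdiff_def insert_Diff_if)
    moreover have "G (sdiff {0, 1, 2, 3, 4, 5, 12, 13, 16, 17, 19, 23} (sdiff {0, 1, 4, 5, 13, 20, 21, 23} (sdiff {0, 2, 4, 16, 17, 21, 22, 23} (sdiff {0, 3, 5, 6, 16, 19, 21, 23} {1, 5, 7, 12, 16, 17, 21, 23}))))" by (intro Gs G0 G2 G3 G4 G8)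
    ultimately show ?thesis by (simp add: G_def)
  qed
  have N5: "lab ` nx ` {0, 12, 13, 17, 18, 19, 21, 23} \<in> C"
  proof -
    have "nx ` {0, 12, 13, 17, 18, 19, 21, 23} = sdiff {0, 1, 2, 3, 4, 5, 12, 13, 16, 17, 19, 23} (sdiff {0, 1, 4, 5, 13, 20, 21, 23} (sdiff {0, 2, 4, 16, 17, 21, 22, 23} (sdiff {0, 12, 13, 17, 18, 19, 21, 23} {1, 3, 4, 14, 17, 19, 21, 23})))"
      by (rule subset_antisym; simp add: nx_def sdiff_def insert_Diff_if)
    moreover have "G (sdiff {0, 1, 2, 3, 4, 5, 12, 13, 16, 17, 19, 23} (sdiff {0, 1, 4, 5, 13, 20, 21, 23} (sdiff {0, 2, 4, 16, 17, 21, 22, 23} (sdiff {0, 12, 13, 17, 18, 19, 21, 23} {1, 3, 4, 14, 17, 19, 21, 23}))))" by (intro Gs G0 G2 G3 G5 G7)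
    ultimately show ?thesis by (simp add: G_def)
  qed
  have N6: "lab ` nx ` {1, 2, 8, 13, 16, 19, 21, 23} \<in> C"
  proof -
    have "nx ` {1, 2, 8, 13, 16, 19, 21, 23} = sdiff {0, 1, 2, 3, 4, 5, 12, 13, 16, 17, 19, 23} (sdiff {0, 1, 2, 3, 9, 12, 21, 23} (sdiff {0, 1, 4, 5, 13, 20, 21, 23} (sdiff {0, 2, 4, 16, 17, 21, 22, 23} {1, 3, 4, 14, 17, 19, 21, 23})))"
      by (rule subset_antisym; simp add: nx_def sdiff_def insert_Diff_if)
    moreover have "G (sdiff {0, 1, 2, 3, 4, 5, 12, 13, 16, 17, 19, 23} (sdiff {0, 1, 2, 3, 9, 12, 21, 23} (sdiff {0, 1, 4, 5, 13, 20, 21, 23} (sdiff {0, 2, 4, 16, 17, 21, 22, 23} {1, 3, 4, 14, 17, 19, 21, 23}))))" by (intro Gs G0 G1 G2 G3 G7)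
    ultimately show ?thesis by (simp add: G_def)
  qed
  have N7: "lab ` nx ` {1, 3, 4, 14, 17, 19, 21, 23} \<in> C"
  proof -
    have "nx ` {1, 3, 4, 14, 17, 19, 21, 23} = sdiff {0, 1, 2, 3, 4, 5, 12, 13, 16, 17, 19, 23} (sdiff {0, 1, 4, 5, 13, 20, 21, 23} (sdiff {0, 2, 4, 16, 17, 21, 22, 23} (sdiff {0, 12, 13, 17, 18, 19, 21, 23} {2, 3, 5, 13, 15, 17, 21, 23})))"
      by (rule subset_antisym; simp add: nx_def sdiff_def insert_Diff_if)
    moreover have "G (sdiff {0, 1, 2, 3, 4, 5, 12, 13, 16, 17, 19, 23} (sdiff {0, 1, 4, 5, 13, 20, 21, 23} (sdiff {0, 2, 4, 16, 17, 21, 22, 23} (sdiff {0, 12, 13, 17, 18, 19, 21, 23} {2, 3, 5, 13, 15, 17, 21, 23}))))" by (intro Gs G0 G2 G3 G5 G9)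
    ultimately show ?thesis by (simp add: G_def)
  qed
  have N8: "lab ` nx ` {1, 5, 7, 12, 16, 17, 21, 23} \<in> C"
  proof -
    have "nx ` {1, 5, 7, 12, 16, 17, 21, 23} = sdiff {0, 1, 2, 3, 4, 5, 12, 13, 16, 17, 19, 23} (sdiff {0, 2, 4, 16, 17, 21, 22, 23} (sdiff {0, 3, 5, 6, 16, 19, 21, 23} (sdiff {0, 12, 13, 17, 18, 19, 21, 23} {1, 2, 8, 13, 16, 19, 21, 23})))"
      by (rule subset_antisym; simp add: nx_def sdiff_def insert_Diff_if)
    moreover have "G (sdiff {0, 1, 2, 3, 4, 5, 12, 13, 16, 17, 19, 23} (sdiff {0, 2, 4, 16, 17, 21, 22, 23} (sdiff {0, 3, 5, 6, 16, 19, 21, 23} (sdiff {0, 12, 13, 17, 18, 19, 21, 23} {1, 2, 8, 13, 16, 19, 21, 23}))))" by (intro Gs G0 G3 G4 G5 G6)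
    ultimately show ?thesis by (simp add: G_def)
  qed
  have N9: "lab ` nx ` {2, 3, 5, 13, 15, 17, 21, 23} \<in> C"
  proof -
    have "nx ` {2, 3, 5, 13, 15, 17, 21, 23} = sdiff {0, 1, 2, 3, 4, 5, 12, 13, 16, 17, 19, 23} (sdiff {0, 2, 4, 16, 17, 21, 22, 23} (sdiff {0, 3, 5, 6, 16, 19, 21, 23} (sdiff {0, 12, 13, 17, 18, 19, 21, 23} {1, 3, 4, 14, 17, 19, 21, 23})))"
      by (rule subset_antisym; simp add: nx_def sdiff_def insert_Diff_if)
    moreover have "G (sdiff {0, 1, 2, 3, 4, 5, 12, 13, 16, 17, 19, 23} (sdiff {0, 2, 4, 16, 17, 21, 22, 23} (sdiff {0, 3, 5, 6, 16, 19, 21, 23} (sdiff {0, 12, 13, 17, 18, 19, 21, 23} {1, 3, 4, 14, 17, 19, 21, 23}))))" by (intro Gs G0 G3 G4 G5 G7)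
    ultimately show ?thesis by (simp add: G_def)
  qed
  have N10: "lab ` nx ` {2, 4, 5, 10, 12, 19, 21, 23} \<in> C"
  proof -
    have "nx ` {2, 4, 5, 10, 12, 19, 21, 23} = sdiff {0, 1, 2, 3, 4, 5, 12, 13, 16, 17, 19, 23} (sdiff {0, 1, 4, 5, 13, 20, 21, 23} (sdiff {0, 2, 4, 16, 17, 21, 22, 23} (sdiff {0, 3, 5, 6, 16, 19, 21, 23} {3, 4, 11, 12, 13, 16, 21, 23})))"
      by (rule subset_antisym; simp add: nx_def sdiff_def insert_Diff_if)
    moreover have "G (sdiff {0, 1, 2, 3, 4, 5, 12, 13, 16, 17, 19, 23} (sdiff {0, 1, 4, 5, 13, 20, 21, 23} (sdiff {0, 2, 4, 16, 17, 21, 22, 23} (sdiff {0, 3, 5, 6, 16, 19, 21, 23} {3, 4, 11, 12, 13, 16, 21, 23}))))" by (intro Gs G0 G2 G3 G4 G11)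
    ultimately show ?thesis by (simp add: G_def)
  qed
  have N11: "lab ` nx ` {3, 4, 11, 12, 13, 16, 21, 23} \<in> C"
  proof -
    have "nx ` {3, 4, 11, 12, 13, 16, 21, 23} = sdiff {0, 1, 2, 3, 4, 5, 12, 13, 16, 17, 19, 23} (sdiff {0, 2, 4, 16, 17, 21, 22, 23} {1, 3, 4, 14, 17, 19, 21, 23})"
      by (rule subset_antisym; simp add: nx_def sdiff_def insert_Diff_if)
    moreover have "G (sdiff {0, 1, 2, 3, 4, 5, 12, 13, 16, 17, 19, 23} (sdiff {0, 2, 4, 16, 17, 21, 22, 23} {1, 3, 4, 14, 17, 19, 21, 23}))" by (intro Gs G0 G3 G7)
    ultimately show ?thesis by (simp add: G_def)
  qed
  define Q where "Q = (\<lambda>c. lab ` nx ` pre c \<in> C)"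
  have Qgen: "Q (lab ` K)" if "K \<subseteq> {..<24}" "lab ` nx ` K \<in> C" for K using that by (simp add: Q_def pre_lab)
  have "\<forall>c\<in>C. Q c"
  proof (rule span)
    show "Q {}" using golay_empty[OF C card24] by (simp add: Q_def pre_def)
    fix c d assume cd: "c \<in> C" "d \<in> C" "Q c" "Q d"
    have "pre (sdiff c d) = sdiff (pre c) (pre d)" by (auto simp: pre_def sdiff_def)
    moreover have "(lab \<circ> nx) ` sdiff (pre c) (pre d) = sdiff ((lab \<circ> nx) ` pre c) ((lab \<circ> nx) ` pre d)"
      by (rule im_sdiff[OF inj2]) (auto simp: pre_def)
    ultimately show "Q (sdiff c d)"
      using cd golay_sdiff[OF C card24, of "lab ` nx ` pre c" "lab ` nx ` pre d"] by (simp add: Q_def image_comp)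
  qed (intro Qgen; (rule N0 | rule N1 | rule N2 | rule N3 | rule N4 | rule N5 | rule N6 | rule N7 | rule N8 | rule N9 | rule N10 | rule N11 | simp))+
  show ?thesis
  proof (rule that[OF bij])
    fix K :: "nat set" assume K: "K \<subseteq> {..<24}" "lab ` K \<in> C"
    thus "lab ` nx ` K \<in> C" using \<open>\<forall>c\<in>C. Q c\<close> by (auto simp: Q_def pre_lab)
  qed
qed

end

section \<open>An automorphism of order 23\<close>

lemma leech_qform_facts:
  assumes L: "leech_gram L"
  shows "even (bil L x x)" "bil L x x \<noteq> 2"
  using L qform_even[of L x] by (auto simp: leech_gram_def qform_bil)

lemma dotp_two_point:
  assumes "i \<noteq> j"
  shows "dotp x (\<lambda>k. if k = i then a else if k = j then b else 0) = x i * a + x j * b"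
proof -
  have "dotp x (\<lambda>k. if k = i then a else if k = j then b else 0) = (\<Sum>k\<in>{i, j}. x k * (if k = i then a else b))"
    unfolding dotp_def by (rule sum.mono_neutral_cong_right) auto
  thus ?thesis using assms by simp
qed

text \<open>The inner product with half of \<open>f i + f j\<close>, whose coordinates are 4 at
  \<open>i\<close> and \<open>j\<close>, is an integer, so 8 divides 4 times the sum of the two
  coordinates.\<close>

lemma coords_parity:
  assumes f: "is_frame L f"
  shows "even (coords L f x i) \<longleftrightarrow> even (coords L f x j)"
proof (cases "i = j")
  case False
  obtain z where z: "coords L f z = (\<lambda>k. if k = i then 4 else if k = j then 4 else 0)"
    using coords_half_sum[OF f False insertI1] unfolding mult_1_right by blast
  have "coords L f x i * 4 + coords L f x j * 4 = 8 * bil L x z"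
    using dotp_coords[OF f, of x z] dotp_two_point[OF False, of "coords L f x" 4 4] unfolding z by simp
  thus ?thesis by presburger
qed simp

text \<open>If every coordinate vector were even, \<open>4 e\<^sub>i\<close> would lie in the dual lattice, giving a vector of norm 2.\<close>

lemma normalized_frame_exists:
  assumes L: "leech_gram L"
  obtains f x0 where "is_frame L f" "\<And>i. coords L f x0 i mod 4 = 1"
proof -
  obtain f where f: "is_frame L f" using frame_exists[OF L] by blast
  have "\<exists>x i. odd (coords L f x i)"
  proof (rule ccontr)
    assume neg: "\<not> ?thesis"
    \<comment> \<open>Coordinates 4 at the index 0 only, in the shape of
      \<open>dotp_two_point\<close>; the norm is \<open>16 / 8 = 2\<close>.\<close>
    define y :: "24 \<Rightarrow> int" where "y = (\<lambda>k. if k = 0 then 4 else if k = 1 then 0 else 0)"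
    have dy: "dotp x y = x 0 * 4" for x unfolding y_def using dotp_two_point[of 0 1 x 4 0] by simp
    have "8 dvd dotp (coords L f x) y" for x
    proof -
      have "2 dvd coords L f x 0" using neg by blast
      from mult_dvd_mono[OF this dvd_refl[of 4]] show ?thesis unfolding dy by simp
    qed
    then obtain z where z: "coords L f z = y" using coords_dual[OF f L] by blast
    have "8 * bil L z z = 16" using dotp_coords[OF f, of z z] unfolding z dy by (simp add: y_def)
    thus False using leech_qform_facts(2)[OF L, of z] by simp
  qed
  then obtain x0 i0 where "odd (coords L f x0 i0)" by blast
  hence odd: "odd (coords L f x0 i)" for i using coords_parity[OF f] by blast
  \<comment> \<open>Odd coordinates are 1 or -1 modulo 4, so reversing some frame vectors makes all
    of them 1; signs do not change classes modulo \<open>2L\<close>.\<close>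
  define s where "s = (\<lambda>i. if coords L f x0 i mod 4 = 1 then 1 else - 1 :: int)"
  define f' where "f' = (\<lambda>i. s i *s f i)"
  have c': "coords L f' x i = s i * coords L f x i" for x i by (simp add: coords_def f'_def bil_scale_left)
  have "is_frame L f'"
  proof -
    have "bil L (f' i) (f' j) = (if i = j then 8 else 0)" for i j
      using f by (auto simp: is_frame_def f'_def bil_scale_left bil_scale_right s_def)
    moreover have "even (f' i $ k - f' j $ k)" for i j k
      using f by (auto simp: is_frame_def f'_def s_def)
    ultimately show ?thesis by (simp add: is_frame_def)
  qed
  moreover have "coords L f' x0 i mod 4 = 1" for i
    unfolding c' using odd[of i] by (auto simp: s_def) presburger
  ultimately show ?thesis by (rule that)
qed

text \<open>Even coordinate vectors are halved and reduced modulo 2, and recorded by their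
  supports.\<close>

definition frame_code :: "int ^24 ^24 \<Rightarrow> (24 \<Rightarrow> int ^24) \<Rightarrow> 24 set set" where
  "frame_code L f = {{i. coords L f x i mod 4 = 2} | x. \<forall>i. even (coords L f x i)}"

context
  fixes L :: "int ^24 ^24" and f x0
  assumes L: "leech_gram L" and f: "is_frame L f" and x0: "\<And>i. coords L f x0 i mod 4 = 1"
begin

abbreviation "cc \<equiv> coords L f"

lemma cc_decomp: "\<exists>y. (\<forall>i. even (cc y i)) \<and> (x = y \<or> x = x0 + y)"
proof (cases "\<forall>i. even (cc x i)")
  case False
  hence "odd (cc x i)" for i using coords_parity[OF f] by blast
  moreover have "odd (cc x0 i)" for i using x0[of i] by presburger
  ultimately have "\<forall>i. even (cc (x - x0) i)" by (simp add: coords_diff)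
  thus ?thesis by (intro exI[of _ "x - x0"]) simp
qed blast

lemma dotp_add_left: "dotp (\<lambda>i. x i + y i) z = dotp x z + dotp y z"
  by (simp add: dotp_def sum.distrib algebra_simps)

text \<open>Replacing \<open>x0\<close> by the all-ones vector changes each product by a multiple of
  \<open>4 * 2\<close>.\<close>

lemma dotp_x0:
  assumes "\<And>i. even (y i)"
  shows "8 dvd dotp (cc x0) y \<longleftrightarrow> 8 dvd (\<Sum>i\<in>UNIV. y i)"
proof -
  have "dotp (cc x0) y - (\<Sum>i\<in>UNIV. y i) = (\<Sum>i\<in>UNIV. (cc x0 i - 1) * y i)"
    unfolding dotp_def sum_subtractf[symmetric] by (simp add: algebra_simps)
  moreover have "8 dvd (\<Sum>i\<in>UNIV. (cc x0 i - 1) * y i)"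
  proof (rule dvd_sum)
    fix i
    have "4 dvd cc x0 i - 1" using x0[of i] by presburger
    from mult_dvd_mono[OF this assms[of i]] show "8 dvd (cc x0 i - 1) * y i" by simp
  qed
  ultimately show ?thesis by (metis dvd_add_right_iff diff_add_cancel)
qed

lemma cc_sum_even: "(\<And>i. even (cc x i)) \<Longrightarrow> 8 dvd (\<Sum>i\<in>UNIV. cc x i)"
  using dotp_x0[of "cc x"] dotp_coords[OF f, of x0 x] by simp

text \<open>Every lattice vector is even or differs from \<open>x0\<close> by an even one, so
  self-duality leaves only the inner products with even vectors and with \<open>x0\<close>; the
  latter is controlled by the coordinate sum.\<close>

lemma lattice_memI:
  assumes ev: "\<And>i. even (y i)" and sum: "8 dvd (\<Sum>i\<in>UNIV. y i)"
    and orth: "\<And>x. (\<And>i. even (cc x i)) \<Longrightarrow> 8 dvd dotp (cc x) y"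
  shows "\<exists>z. cc z = y"
proof (rule coords_dual[OF f L])
  fix x
  obtain x' where x': "\<forall>i. even (cc x' i)" "x = x' \<or> x = x0 + x'" using cc_decomp by blast
  thus "8 dvd dotp (cc x) y" using orth[of x'] dotp_x0[OF ev] sum by (auto simp: coords_add dotp_add_left)
qed

lemma lattice_mem_4:
  assumes y4: "\<And>i. 4 dvd y i" and sum: "8 dvd (\<Sum>i\<in>UNIV. y i)"
  shows "\<exists>z. cc z = y"
proof (rule lattice_memI[OF _ sum])
  show "even (y i)" for i using y4[of i] by presburger
  show "8 dvd dotp (cc x) y" if "\<And>i. even (cc x i)" for x
    unfolding dotp_def by (rule dvd_sum) (use mult_dvd_mono[OF that y4] in simp)
qed

text \<open>Each product is 4 times the product of the halves, and that is odd exactly where both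
  coordinates are 2 modulo 4.\<close>

lemma even_coords_dotp:
  assumes "\<And>i. even (x i)" "\<And>i. even (y i)"
  shows "8 dvd dotp x y \<longleftrightarrow> even (card ({i::24. x i mod 4 = 2} \<inter> {i. y i mod 4 = 2}))"
proof -
  have p: "4 * (x i div 2 * (y i div 2)) = x i * y i" for i
    using assms(1)[of i] assms(2)[of i] by auto
  have "dotp x y = 4 * (\<Sum>i\<in>UNIV. x i div 2 * (y i div 2))"
    unfolding dotp_def sum_distrib_left p ..
  hence "8 dvd dotp x y \<longleftrightarrow> even (\<Sum>i\<in>UNIV. x i div 2 * (y i div 2))"
    by presburger
  also have "\<dots> \<longleftrightarrow> even (card {i\<in>UNIV. odd (x i div 2 * (y i div 2))})"
    by (rule even_sum_iff) simp
  also have "{i\<in>UNIV. odd (x i div 2 * (y i div 2))} = {i. x i mod 4 = 2} \<inter> {i. y i mod 4 = 2}"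
  proof -
    have "odd (a div 2) \<longleftrightarrow> a mod 4 = 2" if "even a" for a :: int using that by presburger
    thus ?thesis using assms by auto
  qed
  finally show ?thesis .
qed

text \<open>Self-duality lifts a word orthogonal to the code to a vector with entries 2 on it; the
  sign at \<open>i0\<close> is left open to make the coordinate sum divisible by 8.\<close>

lemma frame_code_lift:
  assumes d: "\<And>c. c \<in> frame_code L f \<Longrightarrow> even (card (d \<inter> c))" and i0: "i0 \<in> d"
  shows "\<exists>z. cc z i0 \<in> {2, - 2} \<and> (\<forall>i. i \<noteq> i0 \<longrightarrow> cc z i = (if i \<in> d then 2 else 0))"
proof -
  \<comment> \<open>The word of \<open>x0 + x0\<close>. It makes \<open>card d\<close> even, so
    \<open>2 * card d\<close> is 0 or 4 modulo 8, and changing one entry from 2 to -2 corrects the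
    second case.\<close>
  have "UNIV \<in> frame_code L f"
  proof -
    have double: "(a + a) mod 4 = 2 \<and> even (a + a)" if "a mod 4 = 1" for a :: int using that by presburger
    have "cc (x0 + x0) i mod 4 = 2 \<and> even (cc (x0 + x0) i)" for i
      unfolding coords_add by (rule double[OF x0])
    thus ?thesis unfolding frame_code_def by (intro CollectI exI[of _ "x0 + x0"]) auto
  qed
  hence "even (card d)" using d[of UNIV] by simp
  define e where "e = (if 4 dvd card d then 2 else - 2 :: int)"
  define y where "y = (\<lambda>i. if i = i0 then e else if i \<in> d then 2 else 0)"
  have "(\<Sum>i\<in>UNIV. y i) = (\<Sum>i\<in>UNIV. (if i \<in> d then 2 else 0) + (if i = i0 then e - 2 else 0))"
    by (rule sum.cong) (use i0 in \<open>auto simp: y_def\<close>)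
  also have "\<dots> = 2 * int (card d) + (e - 2)"
    unfolding sum.distrib by (simp add: sum.If_cases)
  finally have sum: "8 dvd (\<Sum>i\<in>UNIV. y i)"
    using \<open>even (card d)\<close> unfolding e_def by (auto, presburger+)
  have ev: "even (y i)" for i by (simp add: y_def e_def)
  have set: "{i. y i mod 4 = 2} = d" using i0 by (auto simp: y_def e_def)
  have "\<exists>z. cc z = y"
  proof (rule lattice_memI[OF ev sum])
    fix x assume x: "\<And>i. even (cc x i)"
    hence "{i. cc x i mod 4 = 2} \<in> frame_code L f" unfolding frame_code_def by blast
    from d[OF this] show "8 dvd dotp (cc x) y"
      unfolding even_coords_dotp[OF x ev] set by (simp add: Int_commute)
  qed
  then obtain z where "cc z = y" by blast
  thus ?thesis by (intro exI[of _ z]) (simp add: y_def e_def)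
qed

text \<open>Integrality of inner products makes code words orthogonal, and
  \<open>frame_code_lift\<close> gives the converse. The lift of a word \<open>c\<close> has norm
  \<open>card c / 2\<close>, which is even and not 2; this is the weight condition.\<close>

lemma frame_code_golay: "golay_code (frame_code L f)"
proof -
  let ?C = "frame_code L f"
  have orth: "even (card (c \<inter> d))" if cd: "c \<in> ?C" "d \<in> ?C" for c d
  proof -
    obtain x y where xy: "\<forall>i. even (cc x i)" "c = {i. cc x i mod 4 = 2}" "\<forall>i. even (cc y i)" "d = {i. cc y i mod 4 = 2}"
      using cd unfolding frame_code_def by blast
    thus ?thesis using even_coords_dotp[of "cc x" "cc y"] dotp_coords[OF f, of x y] by simp
  qed
  have sd: "d \<in> ?C" if d: "\<And>c. c \<in> ?C \<Longrightarrow> even (card (d \<inter> c))" for d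
  proof (cases "d = {}")
    case True
    have "cc 0 i = 0" for i using coords_diff[of L f 0 0] by simp
    thus ?thesis unfolding True frame_code_def by (intro CollectI exI[of _ 0]) simp
  next
    case False
    then obtain i0 where "i0 \<in> d" by blast
    from frame_code_lift[OF d this] obtain z where z: "cc z i0 \<in> {2, - 2}" "\<And>i. i \<noteq> i0 \<Longrightarrow> cc z i = (if i \<in> d then 2 else 0)" by blast
    have "even (cc z i)" "cc z i mod 4 = 2 \<longleftrightarrow> i \<in> d" for i
      using z \<open>i0 \<in> d\<close> by (cases "i = i0"; auto)+
    thus ?thesis unfolding frame_code_def by (intro CollectI exI[of _ z]) auto
  qed
  have w: "4 dvd card c \<and> card c \<noteq> 4" if c: "c \<in> ?C" for c
  proof (cases "c = {}")
    case False
    then obtain i0 where i0: "i0 \<in> c" by blast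
    from frame_code_lift[of c i0] obtain z where z: "cc z i0 \<in> {2, - 2}" "\<And>i. i \<noteq> i0 \<Longrightarrow> cc z i = (if i \<in> c then 2 else 0)"
      using orth c i0 by blast
    have "cc z i * cc z i = (if i \<in> c then 4 else 0)" for i using z i0 by (cases "i = i0") auto
    hence "dotp (cc z) (cc z) = 4 * int (card c)" unfolding dotp_def by (simp add: sum.If_cases)
    hence "int (card c) = 2 * bil L z z" using dotp_coords[OF f, of z z] by simp
    thus ?thesis using leech_qform_facts[OF L, of z] by (auto elim!: evenE) presburger+
  qed simp
  show ?thesis unfolding golay_code_def
  proof (intro conjI allI iffI)
    fix c
    show "\<forall>d\<in>?C. even (card (c \<inter> d))" if "c \<in> ?C" using orth that by blast
    show "c \<in> ?C" if "\<forall>d\<in>?C. even (card (c \<inter> d))" using sd that by blast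
    show "\<forall>c\<in>?C. 4 dvd card c \<and> card c \<noteq> 4" using w by blast
  qed
qed

text \<open>With coordinates \<open>1 + 4 * u i\<close>, evenness of the norm of \<open>x0\<close>
  forces the sum of the \<open>u i\<close> to be odd.\<close>

lemma sum_cc_x0: "(\<Sum>i\<in>UNIV. cc x0 i) mod 8 = 4"
proof -
  define u where "u = (\<lambda>i. cc x0 i div 4)"
  have c: "cc x0 i = 1 + 4 * u i" for i using x0[of i] unfolding u_def by presburger
  have "8 * bil L x0 x0 = (\<Sum>i\<in>UNIV. 1 + 8 * u i + 16 * (u i * u i))"
    unfolding dotp_coords[OF f, symmetric] dotp_def by (rule sum.cong) (simp_all add: c algebra_simps)
  also have "\<dots> = 24 + 8 * (\<Sum>i\<in>UNIV. u i) + 16 * (\<Sum>i\<in>UNIV. u i * u i)"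
    by (simp add: sum.distrib sum_distrib_left)
  finally have "odd (\<Sum>i\<in>UNIV. u i)" using leech_qform_facts(1)[OF L, of x0] by presburger
  moreover have "(\<Sum>i\<in>UNIV. cc x0 i) = 24 + 4 * (\<Sum>i\<in>UNIV. u i)"
    by (simp add: c sum.distrib sum_distrib_left)
  ultimately show ?thesis by presburger
qed

lemma lattice_mem_odd:
  assumes y: "\<And>i. y i mod 4 = 1" and s: "(\<Sum>i\<in>UNIV. y i) mod 8 = 4"
  shows "\<exists>z. cc z = y"
proof -
  have "\<exists>z. cc z = (\<lambda>i. y i - cc x0 i)"
  proof (rule lattice_mem_4)
    show "4 dvd y i - cc x0 i" for i using y[of i] x0[of i] by presburger
    show "8 dvd (\<Sum>i\<in>UNIV. y i - cc x0 i)" unfolding sum_subtractf using s sum_cc_x0 by presburger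
  qed
  then obtain z where "cc z = (\<lambda>i. y i - cc x0 i)" by blast
  hence "cc (z + x0) = y" by (simp add: coords_add)
  thus ?thesis by blast
qed

text \<open>A permuted even vector has the same support modulo 4 as some lattice vector, by
  \<open>code\<close>, and the same coordinate sum as before, so the difference falls under
  \<open>lattice_mem_4\<close>. The permuted \<open>x0\<close> keeps its residues and its sum, so
  \<open>lattice_mem_odd\<close> applies.\<close>

lemma lattice_permute:
  assumes \<pi>: "bij \<pi>" and code: "\<And>c. c \<in> frame_code L f \<Longrightarrow> \<pi> ` c \<in> frame_code L f"
  shows "\<exists>z. \<forall>i. cc z (\<pi> i) = cc x i"
proof -
  have perm_sum: "(\<Sum>i\<in>UNIV. g (inv \<pi> i)) = (\<Sum>i\<in>UNIV. g i)" for g :: "24 \<Rightarrow> int"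
    by (rule sum.reindex_bij_betw[OF bij_imp_bij_inv[OF \<pi>]])
  have ip: "inv \<pi> (\<pi> i) = i" for i using \<pi> by (simp add: bij_is_inj)
  have pi: "\<pi> (inv \<pi> i) = i" for i using \<pi> by (simp add: bij_is_surj surj_f_inv_f)
  have even_case: "\<exists>z. cc z = (\<lambda>i. cc x (inv \<pi> i))" if x: "\<And>i. even (cc x i)" for x
  proof -
    have "{i. cc x i mod 4 = 2} \<in> frame_code L f" unfolding frame_code_def using x by blast
    from code[OF this] obtain y where y: "\<And>i. even (cc y i)" "\<pi> ` {i. cc x i mod 4 = 2} = {i. cc y i mod 4 = 2}"
      by (auto simp: frame_code_def)
    have same: "cc x (inv \<pi> i) mod 4 = 2 \<longleftrightarrow> cc y i mod 4 = 2" for i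
    proof -
      have "i \<in> \<pi> ` {i. cc x i mod 4 = 2} \<longleftrightarrow> cc x (inv \<pi> i) mod 4 = 2"
      proof
        assume "i \<in> \<pi> ` {i. cc x i mod 4 = 2}"
        then obtain j where "i = \<pi> j" "cc x j mod 4 = 2" by blast
        thus "cc x (inv \<pi> i) mod 4 = 2" by (simp add: ip)
      next
        assume "cc x (inv \<pi> i) mod 4 = 2"
        thus "i \<in> \<pi> ` {i. cc x i mod 4 = 2}" by (intro image_eqI[of _ _ "inv \<pi> i"]) (simp_all add: pi)
      qed
      thus ?thesis unfolding y(2) by simp
    qed
    have "\<exists>z. cc z = (\<lambda>i. cc x (inv \<pi> i) - cc y i)"
    proof (rule lattice_mem_4)
      show "4 dvd cc x (inv \<pi> i) - cc y i" for i using same[of i] x[of "inv \<pi> i"] y(1)[of i] by presburger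
      show "8 dvd (\<Sum>i\<in>UNIV. cc x (inv \<pi> i) - cc y i)"
        unfolding sum_subtractf perm_sum[of "cc x"] using cc_sum_even[OF x] cc_sum_even[OF y(1)] by (rule dvd_diff)
    qed
    then obtain z where "cc z = (\<lambda>i. cc x (inv \<pi> i) - cc y i)" by blast
    hence "cc (z + y) = (\<lambda>i. cc x (inv \<pi> i))" by (simp add: coords_add)
    thus ?thesis by blast
  qed
  obtain z0 where z0: "cc z0 = (\<lambda>i. cc x0 (inv \<pi> i))"
    using lattice_mem_odd[of "\<lambda>i. cc x0 (inv \<pi> i)"] x0 sum_cc_x0 unfolding perm_sum[of "cc x0"] by blast
  obtain x' where x': "\<forall>i. even (cc x' i)" "x = x' \<or> x = x0 + x'" using cc_decomp by blast
  obtain z' where z': "cc z' = (\<lambda>i. cc x' (inv \<pi> i))" using even_case[of x'] x'(1) by blast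
  show ?thesis using x'(2)
  proof
    assume "x = x'"
    thus ?thesis using z' ip by (intro exI[of _ z']) simp
  next
    assume "x = x0 + x'"
    thus ?thesis using z' z0 ip by (intro exI[of _ "z0 + z'"]) (simp add: coords_add)
  qed
qed

end

lemma nx_eq: "k < 24 \<Longrightarrow> nx k = (if k = 23 then 23 else if k = 22 then 0 else k + 1)"
proof -
  assume "k < 24"
  then consider "k < 22" | "k = 22" | "k = 23" by linarith
  thus ?thesis by cases (simp_all add: nx_def)
qed

lemma nx_funpow: "k < 23 \<Longrightarrow> (nx ^^ n) k = (k + n) mod 23"
proof (induction n)
  case (Suc n)
  have "(k + n) mod 23 \<noteq> 23" using mod_less_divisor[of 23 "k + n"] by linarith
  thus ?case using Suc by (simp add: nx_def mod_Suc_eq)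
qed simp

text \<open>The fixed lattice consists of the vectors with coordinate \<open>5k - 3m\<close> at the fixed point and \<open>k + m\<close> on the 23-cycle.\<close>

theorem leech_order_23:
  assumes L: "leech_gram L"
  obtains \<sigma> :: "int ^24 \<Rightarrow> int ^24" and \<phi> :: "int \<Rightarrow> int \<Rightarrow> int ^24"
  where "\<And>x y. bil L (\<sigma> x) (\<sigma> y) = bil L x y" "\<And>x. (\<sigma> ^^ 23) x = x"
    "\<And>x. \<sigma> x = x \<longleftrightarrow> (\<exists>m k. x = \<phi> m k)"
    "\<And>m k m' k'. \<phi> m k = \<phi> m' k' \<Longrightarrow> m = m' \<and> k = k'"
    "\<And>m k m' k'. bil L (\<phi> m k) (\<phi> m' k') = 4 * m * m' + m * k' + k * m' + 6 * k * k'"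
proof -
  obtain f x0 where f: "is_frame L f" and x0: "\<And>i. coords L f x0 i mod 4 = 1"
    using normalized_frame_exists[OF L] by blast
  let ?c = "coords L f"
  let ?C = "frame_code L f"
  have C: "golay_code ?C" by (rule frame_code_golay[OF L f x0])
  obtain lab where lab: "bij_betw lab {..<24} (UNIV :: 24 set)"
    and labC: "\<And>K. K \<subseteq> {..<24} \<Longrightarrow> lab ` K \<in> ?C \<Longrightarrow> lab ` nx ` K \<in> ?C"
    using golay_cycle[OF C] by auto
  define idx where "idx = the_inv_into {..<24} lab"
  have idx: "idx (lab k) = k" if "k < 24" for k
    unfolding idx_def by (rule the_inv_into_f_f) (use lab that in \<open>auto simp: bij_betw_def\<close>)
  have labidx: "lab (idx i) = i" "idx i < 24" for i
    using f_the_inv_into_f_bij_betw[OF lab, of i] the_inv_into_into[of lab "{..<24}" i "{..<24}"] lab by (auto simp: idx_def bij_betw_def)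
  have nx24: "nx k < 24" if "k < 24" for k using nx_eq[OF that] that by (simp split: if_splits)
  define \<pi> where "\<pi> = (\<lambda>i. lab (nx (idx i)))"
  have nxinj: "k = l" if "nx k = nx l" "k < 24" "l < 24" for k l
  proof -
    from nx_eq[OF that(2)] nx_eq[OF that(3)] that show ?thesis by (simp split: if_splits)
  qed
  have "inj \<pi>"
  proof (rule injI)
    fix i j assume "\<pi> i = \<pi> j"
    hence "nx (idx i) = nx (idx j)" using idx[OF nx24[OF labidx(2)]] unfolding \<pi>_def by metis
    hence "idx i = idx j" using nxinj labidx(2) by blast
    thus "i = j" using labidx(1) by metis
  qed
  hence bij: "bij \<pi>" by (simp add: bij_def finite_UNIV_inj_surj)
  have code: "\<pi> ` c \<in> ?C" if "c \<in> ?C" for c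
  proof -
    define K where "K = {k \<in> {..<24}. lab k \<in> c}"
    have "lab ` K = c" using labidx by (auto simp: K_def image_iff) (metis labidx)
    moreover have "\<pi> ` c = lab ` nx ` K"
      unfolding \<open>lab ` K = c\<close>[symmetric] \<pi>_def image_image by (rule image_cong) (auto simp: K_def idx)
    ultimately show ?thesis using labC[of K] that by (auto simp: K_def)
  qed
  have "\<forall>x. \<exists>z. \<forall>i. ?c z (\<pi> i) = ?c x i" using lattice_permute[OF L f x0 bij code] by blast
  then obtain \<sigma> where \<sigma>: "\<And>x i. ?c (\<sigma> x) (\<pi> i) = ?c x i" by metis
  have iso: "bil L (\<sigma> x) (\<sigma> y) = bil L x y" for x y
  proof -
    have "dotp (?c (\<sigma> x)) (?c (\<sigma> y)) = (\<Sum>i\<in>UNIV. ?c (\<sigma> x) (\<pi> i) * ?c (\<sigma> y) (\<pi> i))"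
      unfolding dotp_def by (rule sum.reindex_bij_betw[OF bij, symmetric])
    hence "dotp (?c (\<sigma> x)) (?c (\<sigma> y)) = dotp (?c x) (?c y)" by (simp add: \<sigma> dotp_def)
    thus ?thesis by (simp add: dotp_coords[OF f])
  qed
  have \<sigma>n: "?c ((\<sigma> ^^ n) x) ((\<pi> ^^ n) i) = ?c x i" for n x i
    by (induction n) (simp_all add: \<sigma>)
  have \<pi>n: "(\<pi> ^^ n) (lab k) = lab ((nx ^^ n) k) \<and> (nx ^^ n) k < 24" if "k < 24" for n k
    by (induction n) (use that in \<open>auto simp: \<pi>_def idx nx24\<close>)
  have "(nx ^^ 23) k = k" if "k < 24" for k
  proof (cases "k = 23")
    case True
    have "(nx ^^ n) 23 = 23" for n by (induction n) (auto simp: nx_def)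
    thus ?thesis using True by simp
  next
    case False
    thus ?thesis using that nx_funpow[of k 23] by simp
  qed
  hence "(\<pi> ^^ 23) i = i" for i using \<pi>n[of "idx i" 23] labidx by simp
  hence ord: "(\<sigma> ^^ 23) x = x" for x
    using \<sigma>n[of 23 x] by (intro coords_inject[OF f]) (auto simp: fun_eq_iff)
  \<comment> \<open>\<open>v 1 0\<close> is \<open>(-3, 1, ..., 1)\<close> and \<open>v 0 1\<close>
    is \<open>(5, 1, ..., 1)\<close>, with entries 1 modulo 4 and sums 20 and 28, both 4 modulo 8.
    Their dot products 32, 8, 48 divided by 8 are the entries of \<open>2 * S_213\<close>.\<close>
  define v :: "int \<Rightarrow> int \<Rightarrow> 24 \<Rightarrow> int" where "v = (\<lambda>m k i. if i = lab 23 then 5 * k - 3 * m else k + m)"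
  have split24: "(\<Sum>i\<in>UNIV. if i = lab 23 then a else b) = a + 23 * b" for a b :: int
    by (simp add: sum.If_cases Compl_eq_Diff_UNIV card_Diff_singleton)
  have lin: "?c (m *s y + k *s z) = (\<lambda>i. m * ?c y i + k * ?c z i)" for m k y z
    by (simp add: coords_add coords_def bil_add_right bil_scale_right)
  have "\<exists>z. ?c z = v 1 0"
  proof (rule lattice_mem_odd[OF L f x0])
    show "v 1 0 i mod 4 = 1" for i by (simp add: v_def)
    show "(\<Sum>i\<in>UNIV. v 1 0 i) mod 8 = 4" unfolding v_def split24 by simp
  qed
  then obtain z1 where z1: "?c z1 = v 1 0" by blast
  have "\<exists>z. ?c z = v 0 1"
  proof (rule lattice_mem_odd[OF L f x0])
    show "v 0 1 i mod 4 = 1" for i by (simp add: v_def)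
    show "(\<Sum>i\<in>UNIV. v 0 1 i) mod 8 = 4" unfolding v_def split24 by simp
  qed
  then obtain z2 where z2: "?c z2 = v 0 1" by blast
  define \<phi> where "\<phi> = (\<lambda>m k. m *s z1 + k *s z2)"
  have c\<phi>: "?c (\<phi> m k) = v m k" for m k
    unfolding \<phi>_def lin z1 z2 by (auto simp: v_def)
  have dv: "dotp (v m k) (v m' k') = (5 * k - 3 * m) * (5 * k' - 3 * m') + 23 * ((k + m) * (k' + m'))" for m k m' k'
  proof -
    have "dotp (v m k) (v m' k') = (\<Sum>i\<in>UNIV. if i = lab 23 then (5 * k - 3 * m) * (5 * k' - 3 * m') else (k + m) * (k' + m'))"
      unfolding dotp_def by (rule sum.cong) (auto simp: v_def)
    thus ?thesis by (simp only: split24)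
  qed
  have b\<phi>: "bil L (\<phi> m k) (\<phi> m' k') = 4 * m * m' + m * k' + k * m' + 6 * k * k'" for m k m' k'
    using dotp_coords[OF f, of "\<phi> m k" "\<phi> m' k'"] unfolding c\<phi> dv by (simp add: algebra_simps)
  have lab0: "lab k \<noteq> lab 23" if "k < 23" for k using idx[of k] idx[of 23] that by auto
  have \<phi>inj: "m = m' \<and> k = k'" if "\<phi> m k = \<phi> m' k'" for m k m' k'
  proof -
    have "v m k = v m' k'" using that c\<phi> by metis
    from fun_cong[OF this, of "lab 23"] fun_cong[OF this, of "lab 0"] lab0[of 0] show ?thesis by (simp add: v_def)
  qed
  have fixp: "\<sigma> x = x \<longleftrightarrow> (\<exists>m k. x = \<phi> m k)" for x
  proof
    assume fx: "\<sigma> x = x"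
    have st: "?c x (lab (nx k)) = ?c x (lab k)" if "k < 24" for k
      using \<sigma>[of x "lab k"] that unfolding fx \<pi>_def by (simp add: idx)
    have const: "?c x (lab k) = ?c x (lab 0)" if "k < 23" for k
      using that
    proof (induction k)
      case (Suc k)
      hence "nx k = Suc k" by (simp add: nx_def)
      thus ?case using Suc st[of k] by simp
    qed simp
    define a where "a = ?c x (lab 23)"
    define b where "b = ?c x (lab 0)"
    have cx: "?c x i = (if i = lab 23 then a else b)" for i
    proof (cases "idx i = 23")
      case True
      thus ?thesis using labidx[of i] by (auto simp: a_def)
    next
      case False
      hence "idx i < 23" using labidx(2)[of i] by simp
      thus ?thesis using const[of "idx i"] labidx[of i] lab0[of "idx i"] by (auto simp: b_def)
    qed
    \<comment> \<open>An integral inner product with \<open>z1\<close> makes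
      \<open>23 * b - 3 * a\<close> divisible by 8, hence also \<open>a + 3 * b\<close>. The
      quotient is \<open>k\<close>, and \<open>m = b - k\<close>.\<close>
    have "8 * bil L x z1 = (\<Sum>i\<in>UNIV. if i = lab 23 then a * (- 3) else b * 1)"
      unfolding dotp_coords[OF f, symmetric] dotp_def z1 by (rule sum.cong) (auto simp: cx v_def)
    hence "8 * bil L x z1 = a * (- 3) + 23 * (b * 1)" by (simp only: split24)
    hence "8 * bil L x z1 = 23 * b - 3 * a" by simp
    hence "a + 3 * b = 8 * (9 * b - 3 * bil L x z1 - a)" by (simp add: algebra_simps)
    then obtain k where k: "a + 3 * b = 8 * k" by blast
    have "?c x = ?c (\<phi> (b - k) k)" unfolding c\<phi> using k by (auto simp: cx v_def fun_eq_iff)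
    thus "\<exists>m k. x = \<phi> m k" using coords_inject[OF f] by blast
  next
    assume "\<exists>m k. x = \<phi> m k"
    then obtain m k where x: "x = \<phi> m k" by blast
    have "?c (\<sigma> x) (\<pi> i) = ?c x (\<pi> i)" for i
    proof -
      have "\<pi> i = lab 23 \<longleftrightarrow> i = lab 23"
      proof -
        have "\<pi> (lab 23) = lab 23" by (simp add: \<pi>_def idx nx_def)
        thus ?thesis using \<open>inj \<pi>\<close> by (metis injD)
      qed
      thus ?thesis unfolding \<sigma> x c\<phi> by (simp add: v_def)
    qed
    hence "?c (\<sigma> x) i = ?c x i" for i using bij by (metis bij_pointE)
    thus "\<sigma> x = x" by (intro coords_inject[OF f]) auto
  qed
  show ?thesis by (rule that[OF iso ord fixp \<phi>inj b\<phi>])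
qed

section \<open>Counting representations\<close>

lemma card_cong_fixpoints:
  fixes g :: "'a \<Rightarrow> 'a"
  assumes S: "finite S" "\<And>x. x \<in> S \<Longrightarrow> g x \<in> S" and p: "prime p" and gp: "\<And>x. x \<in> S \<Longrightarrow> (g ^^ p) x = x"
  shows "\<exists>k. card S = card {x \<in> S. g x = x} + p * k"
proof -
  have p0: "p > 0" using p prime_gt_0_nat by blast
  define orb where "orb = (\<lambda>x. (\<lambda>n. (g ^^ n) x) ` {..<p})"
  have inS: "(g ^^ n) x \<in> S" if "x \<in> S" for n x using that by (induction n) (auto intro: S)
  have mod: "(g ^^ n) x = (g ^^ (n mod p)) x" if x: "x \<in> S" for n x
  proof -
    have "(g ^^ (p * k)) x = x" for k
      by (induction k) (auto simp: funpow_add gp[OF x])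
    hence "(g ^^ (n mod p + p * (n div p))) x = (g ^^ (n mod p)) x" unfolding funpow_add by simp
    thus ?thesis by simp
  qed
  have orb_mem: "y \<in> orb x \<longleftrightarrow> (\<exists>n. y = (g ^^ n) x)" if "x \<in> S" for x y
    unfolding orb_def using mod[OF that] p0 by (auto simp: image_iff) (meson lessThan_iff mod_less_divisor)
  have orb_sym: "orb y = orb x" if xy: "x \<in> S" "y \<in> orb x" for x y
  proof -
    obtain n where n: "y = (g ^^ n) x" using xy orb_mem by blast
    \<comment> \<open>Moving on by \<open>n * (p - 1)\<close> steps returns to \<open>x\<close>,
      since \<open>n * p\<close> steps act as the identity; so orbits are equivalence
      classes.\<close>
    have bk: "x = (g ^^ (n * (p - 1))) y"
    proof -
      have "n * (p - 1) + n = n * p" using p0 by (cases p) auto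
      hence "(g ^^ (n * (p - 1))) y = (g ^^ (n * p)) x" unfolding n by (metis comp_apply funpow_add)
      thus ?thesis using mod[OF xy(1), of "n * p"] by simp
    qed
    have y: "y \<in> S" unfolding n by (rule inS[OF xy(1)])
    have "z \<in> orb y \<longleftrightarrow> z \<in> orb x" for z
      unfolding orb_mem[OF y] orb_mem[OF xy(1)] using n bk by (metis comp_apply funpow_add)
    thus ?thesis by blast
  qed
  define N where "N = {x \<in> S. g x \<noteq> x}"
  have card_orb: "card (orb x) = p" if x: "x \<in> N" for x
  proof -
    have xS: "x \<in> S" "g x \<noteq> x" using x by (auto simp: N_def)
    have "inj_on (\<lambda>n. (g ^^ n) x) {..<p}"
    proof (rule linorder_inj_onI)
      fix i j assume ij: "i < j" "i \<in> {..<p}" "j \<in> {..<p}"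
      show "(g ^^ i) x \<noteq> (g ^^ j) x"
      proof
        assume eq: "(g ^^ i) x = (g ^^ j) x"
        define d where "d = j - i"
        have d: "0 < d" "d < p" using ij by (auto simp: d_def)
        have "(g ^^ (p - i + i)) x = (g ^^ (p - i + j)) x" unfolding funpow_add using eq by simp
        moreover have "p - i + i = p" "p - i + j = p + d" using ij by (auto simp: d_def)
        ultimately have "(g ^^ d) x = x" using gp[OF xS(1)] mod[OF xS(1), of "p + d"] d by simp
        hence dk: "(g ^^ (d * k)) x = x" for k by (induction k) (auto simp: funpow_add)
        have "coprime d p" using d p by (metis coprime_commute prime_imp_coprime_nat nat_dvd_not_less)
        then obtain k where "[d * k = Suc 0] (mod p)" using cong_solve_coprime_nat[of d p] by auto
        hence "(d * k) mod p = 1 mod p" by (simp add: cong_def)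
        hence "(g ^^ (d * k)) x = (g ^^ 1) x" using mod[OF xS(1)] by metis
        thus False using dk xS by simp
      qed
    qed auto
    thus ?thesis unfolding orb_def by (simp add: card_image)
  qed
  have orbN: "orb x \<subseteq> N" if x: "x \<in> N" for x
  proof
    fix y assume y: "y \<in> orb x"
    have xS: "x \<in> S" using x by (simp add: N_def)
    have yS: "y \<in> S" using y inS[OF xS] by (auto simp: orb_def)
    have "g y \<noteq> y"
    proof
      assume gy: "g y = y"
      have "(g ^^ n) y = y" for n by (induction n) (auto simp: gy)
      hence "orb y \<subseteq> {y}" by (auto simp: orb_def)
      hence "card (orb y) \<le> card {y}" by (rule card_mono[rotated]) simp
      hence "card (orb y) \<le> 1" by simp
      thus False using orb_sym[OF xS y] card_orb[OF x] prime_gt_1_nat[OF p] by simp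
    qed
    thus "y \<in> N" using yS by (simp add: N_def)
  qed
  have self: "x \<in> orb x" if "x \<in> N" for x
    using orb_mem[of x x] that by (auto simp: N_def intro: exI[of _ 0])
  have finN: "finite N" using S by (simp add: N_def)
  have UN: "\<Union> (orb ` N) = N" using orbN self by blast
  have "p * card (orb ` N) = card (\<Union> (orb ` N))"
  proof (rule card_partition)
    show "finite (orb ` N)" "finite (\<Union> (orb ` N))" using finN UN by auto
    show "card c = p" if "c \<in> orb ` N" for c using that card_orb by auto
    show "c1 \<inter> c2 = {}" if c: "c1 \<in> orb ` N" "c2 \<in> orb ` N" "c1 \<noteq> c2" for c1 c2
    proof (rule ccontr)
      assume "c1 \<inter> c2 \<noteq> {}"
      then obtain z where z: "z \<in> c1" "z \<in> c2" by blast
      obtain x y where xy: "x \<in> N" "y \<in> N" "c1 = orb x" "c2 = orb y" using c by blast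
      have "x \<in> S" "y \<in> S" using xy by (auto simp: N_def)
      hence "orb z = orb x" "orb z = orb y" using orb_sym[of x z] orb_sym[of y z] z xy(3,4) by simp_all
      thus False using c xy by simp
    qed
  qed
  hence "card N = p * card (orb ` N)" using UN by simp
  moreover have "card S = card {x \<in> S. g x = x} + card N"
  proof -
    have "S = {x \<in> S. g x = x} \<union> N" by (auto simp: N_def)
    moreover have "card ({x \<in> S. g x = x} \<union> N) = card {x \<in> S. g x = x} + card N"
      by (rule card_Un_disjoint) (use S in \<open>auto simp: N_def\<close>)
    ultimately show ?thesis by simp
  qed
  ultimately show ?thesis by (intro exI[of _ "card (orb ` N)"]) simp
qed

definition col :: "int ^2 ^'n \<Rightarrow> 2 \<Rightarrow> int ^'n" where
  "col X a = (\<chi> i. X $ i $ a)"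

lemma gram_half:
  fixes L :: "int ^'n ^'n" and X :: "int ^2 ^'n"
  shows "(transpose (ratmat X) ** (\<chi> i j. (1/2) * of_int (L $ i $ j)) ** ratmat X) $ a $ b = of_int (bil L (col X a) (col X b)) / 2"
proof -
  have "(transpose (ratmat X) ** (\<chi> i j. (1/2) * of_int (L $ i $ j)) ** ratmat X) $ a $ b
    = (\<Sum>i\<in>UNIV. of_int (X $ i $ a) * (\<Sum>j\<in>UNIV. (1/2) * of_int (L $ i $ j) * of_int (X $ j $ b)))"
    unfolding matrix_mul_assoc[symmetric] by (simp add: matrix_matrix_mult_def transpose_def ratmat_def)
  also have "\<dots> = of_int (bil L (col X a) (col X b)) / 2"
    by (simp add: bil_def col_def matrix_vector_mult_def sum_distrib_left sum_divide_distrib mult_ac)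
  finally show ?thesis .
qed

lemma gram_S_213:
  fixes Y :: "int ^2 ^2"
  shows "(transpose (ratmat Y) ** S_213 ** ratmat Y) $ a $ b =
    of_int (4 * Y $ 1 $ a * Y $ 1 $ b + Y $ 1 $ a * Y $ 2 $ b + Y $ 2 $ a * Y $ 1 $ b + 6 * Y $ 2 $ a * Y $ 2 $ b) / 2"
  by (simp add: matrix_matrix_mult_def transpose_def ratmat_def S_213_def sum_2 vector_2 field_simps)

text \<open>The isometry acts on both columns of a representation at once and so permutes the
  representations of a fixed \<open>T\<close>; a representation is fixed exactly when both columns
  are.\<close>

lemma theta_coeff_cong:
  fixes L :: "int ^24 ^24"
  assumes L: "leech_gram L"
  shows "\<exists>k. lattice_theta_coeff L T = theta_coeff S_213 T + 23 * k"
proof -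
  obtain \<sigma> :: "int ^24 \<Rightarrow> int ^24" and \<phi> where
    iso: "\<And>x y. bil L (\<sigma> x) (\<sigma> y) = bil L x y" and ord: "\<And>x. (\<sigma> ^^ 23) x = x"
    and fx: "\<And>x. \<sigma> x = x \<longleftrightarrow> (\<exists>m k. x = \<phi> m k)"
    and inj: "\<And>m k m' k'. \<phi> m k = \<phi> m' k' \<Longrightarrow> m = m' \<and> k = k'"
    and b\<phi>: "\<And>m k m' k'. bil L (\<phi> m k) (\<phi> m' k') = 4 * m * m' + m * k' + k * m' + 6 * k * k'"
    using leech_order_23[OF L] by blast
  define S where "S = {X :: int ^2 ^24. \<forall>a b. of_int (bil L (col X a) (col X b)) / 2 = T $ a $ b}"
  have SL: "lattice_theta_coeff L T = card S"
    unfolding lattice_theta_coeff_def theta_coeff_def S_def vec_eq_iff[of _ T] vec_eq_iff[of "_ $ _" "T $ _"] gram_half ..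
  define mk where "mk = (\<lambda>x y :: int ^24. (\<chi> i a. if a = (1::2) then x $ i else y $ i) :: int ^2 ^24)"
  have two: "a = 1 \<or> a = 2" for a :: 2 by (rule exhaust_2)
  have col_mk: "col (mk x y) a = (if a = 1 then x else y)" for x y a
    by (simp add: col_def mk_def vec_eq_iff)
  have mk_col: "mk (col X 1) (col X 2) = X" for X :: "int ^2 ^24"
  proof -
    have "mk (col X 1) (col X 2) $ i $ a = X $ i $ a" for i a using two[of a] by (auto simp: mk_def col_def)
    thus ?thesis by (simp add: vec_eq_iff)
  qed
  \<comment> \<open>Since \<open>card\<close> is 0 on infinite sets by convention, finiteness must
    be shown. The diagonal of \<open>T\<close> confines the columns to two finite shells, or
    \<open>S\<close> is empty when a diagonal entry is not half an integer.\<close>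
  have finS: "finite S"
  proof (cases "\<exists>m n. T $ 1 $ 1 = of_int m / 2 \<and> T $ 2 $ 2 = of_int n / 2")
    case True
    then obtain m n where mn: "T $ 1 $ 1 = of_int m / 2" "T $ 2 $ 2 = of_int n / 2" by blast
    have "S \<subseteq> (\<lambda>(x, y). mk x y) ` ({x. qform L x = m} \<times> {x. qform L x = n})"
    proof
      fix X assume "X \<in> S"
      hence "of_int (bil L (col X a) (col X a)) / 2 = T $ a $ a" for a by (simp add: S_def)
      from this[of 1] this[of 2] have "rat_of_int (bil L (col X 1) (col X 1)) = of_int m" "rat_of_int (bil L (col X 2) (col X 2)) = of_int n"
        unfolding mn by simp_all
      hence "qform L (col X 1) = m" "qform L (col X 2) = n" unfolding qform_bil by (simp_all only: of_int_eq_iff)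
      thus "X \<in> (\<lambda>(x, y). mk x y) ` ({x. qform L x = m} \<times> {x. qform L x = n})"
        using mk_col[of X] by (intro image_eqI[of _ _ "(col X 1, col X 2)"]) auto
    qed
    thus ?thesis
      by (rule finite_subset) (intro finite_imageI finite_cartesian_product leech_shell_cards(1)[OF L])
  next
    case False
    have "X \<notin> S" for X
    proof
      assume "X \<in> S"
      hence "of_int (bil L (col X a) (col X a)) / 2 = T $ a $ a" for a by (simp add: S_def)
      thus False using False by metis
    qed
    hence "S = {}" by blast
    thus ?thesis by simp
  qed
  define g where "g = (\<lambda>X. mk (\<sigma> (col X 1)) (\<sigma> (col X 2)))"
  have col_g: "col (g X) a = \<sigma> (col X a)" for X a
    using two[of a] by (auto simp: g_def col_mk)
  have gS: "g X \<in> S" if "X \<in> S" for X using that by (simp add: S_def col_g iso)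
  have "col ((g ^^ n) X) a = (\<sigma> ^^ n) (col X a)" for n X a by (induction n) (auto simp: col_g)
  hence gp: "(g ^^ 23) X = X" for X using mk_col[of "(g ^^ 23) X"] mk_col[of X] by (simp add: ord)
  have "prime (23 :: nat)" by simp
  from card_cong_fixpoints[of S g, OF finS gS this gp]
  obtain k where k: "card S = card {X \<in> S. g X = X} + 23 * k" by blast
  \<comment> \<open>Each column of \<open>Y\<close> is a pair of coordinates in the fixed lattice.
    As the Gram matrix there is twice \<open>S_213\<close>, the factor 1/2 in the lattice theta
    series makes both Gram matrices equal.\<close>
  define h where "h = (\<lambda>Y :: int ^2 ^2. mk (\<phi> (Y $ 1 $ 1) (Y $ 2 $ 1)) (\<phi> (Y $ 1 $ 2) (Y $ 2 $ 2)))"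
  have col_h: "col (h Y) a = \<phi> (Y $ 1 $ a) (Y $ 2 $ a)" for Y a
    using two[of a] by (auto simp: h_def col_mk)
  have "bij_betw h {Y :: int ^2 ^2. transpose (ratmat Y) ** S_213 ** ratmat Y = T} {X \<in> S. g X = X}"
  proof (rule bij_betwI')
    fix Y Y' :: "int ^2 ^2"
    show "h Y = h Y' \<longleftrightarrow> Y = Y'"
    proof
      assume eq: "h Y = h Y'"
      have "Y $ 1 $ a = Y' $ 1 $ a \<and> Y $ 2 $ a = Y' $ 2 $ a" for a
        using col_h[of Y a] col_h[of Y' a] eq inj by metis
      thus "Y = Y'" by (simp add: vec_eq_iff forall_2)
    qed simp
  next
    fix Y :: "int ^2 ^2" assume "Y \<in> {Y. transpose (ratmat Y) ** S_213 ** ratmat Y = T}"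
    hence T: "(transpose (ratmat Y) ** S_213 ** ratmat Y) $ a $ b = T $ a $ b" for a b by simp
    have "h Y \<in> S" unfolding S_def using T unfolding gram_S_213 by (simp add: col_h b\<phi>)
    moreover have "g (h Y) = h Y"
    proof -
      have "\<sigma> (col (h Y) a) = col (h Y) a" for a unfolding fx col_h by blast
      thus ?thesis unfolding g_def by (simp add: mk_col)
    qed
    ultimately show "h Y \<in> {X \<in> S. g X = X}" by simp
  next
    fix X assume X: "X \<in> {X \<in> S. g X = X}"
    have "\<exists>m k. col X a = \<phi> m k" for a using col_g[of X a] X fx[of "col X a"] by simp
    then obtain m k where mk: "\<And>a. col X a = \<phi> (m a) (k a)" by metis
    define Y :: "int ^2 ^2" where "Y = (\<chi> i a. if i = 1 then m a else k a)"
    have Y: "Y $ 1 $ a = m a" "Y $ 2 $ a = k a" for a by (simp_all add: Y_def)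
    have hY: "h Y = X" using mk_col[of X] by (simp add: h_def Y mk)
    have "(transpose (ratmat Y) ** S_213 ** ratmat Y) $ a $ b = T $ a $ b" for a b
      using X unfolding S_def gram_S_213 by (simp add: mk b\<phi> Y)
    hence "transpose (ratmat Y) ** S_213 ** ratmat Y = T" by (simp add: vec_eq_iff)
    thus "\<exists>Y\<in>{Y. transpose (ratmat Y) ** S_213 ** ratmat Y = T}. X = h Y" using hY by blast
  qed
  hence "theta_coeff S_213 T = card {X \<in> S. g X = X}" unfolding theta_coeff_def by (rule bij_betw_same_card)
  thus ?thesis using k SL by auto
qed

lemma det_gram_S_213:
  fixes Y :: "int ^2 ^2"
  shows "det (transpose (ratmat Y) ** S_213 ** ratmat Y) = 23 * of_int ((det Y)\<^sup>2) / 4"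
proof -
  have "det (ratmat Y) = of_int (det Y)" by (simp add: det_2 ratmat_def)
  moreover have "det S_213 = 23 / 4" by (simp add: det_2 S_213_def vector_2)
  ultimately show ?thesis by (simp add: det_mul det_transpose power2_eq_square)
qed

text \<open>A represented \<open>T\<close> has \<open>det T = 23/4 (det X)\<^sup>2\<close>, and otherwise the coefficient itself
  vanishes modulo 23.\<close>

theorem theorem3p2:
  fixes L :: "int ^24 ^24"
  assumes "leech_gram L"
  shows "\<forall>T. half_integral_psd T \<longrightarrow>
           cong_Zp 23 (of_nat (theta_coeff S_213 T)) (of_nat (lattice_theta_coeff L T))
         \<and> cong_Zp 23 (det T * of_nat (lattice_theta_coeff L T)) 0"
proof (intro allI impI conjI)
  fix T :: "rat ^2 ^2" assume T: "half_integral_psd T"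
  obtain k where k: "lattice_theta_coeff L T = theta_coeff S_213 T + 23 * k" using theta_coeff_cong[OF assms] by blast
  show "cong_Zp 23 (of_nat (theta_coeff S_213 T)) (of_nat (lattice_theta_coeff L T))"
    unfolding cong_Zp_def k by (intro exI[of _ "- 23 * int k"] exI[of _ 1]) simp
  \<comment> \<open>For half-integral \<open>T\<close> the number \<open>4 * det T\<close> is an
    integer, and the denominator 4 is prime to 23; it remains to find the factor 23 in
    \<open>d\<close> or in the coefficient.\<close>
  obtain d where d: "det T = of_int d / 4"
  proof -
    have "T $ 1 $ 1 \<in> \<int>" "T $ 2 $ 2 \<in> \<int>" "2 * T $ 1 $ 2 \<in> \<int>" "2 * T $ 2 $ 1 \<in> \<int>" using T by (auto simp: half_integral_psd_def)
    hence "4 * (T $ 1 $ 1 * T $ 2 $ 2) \<in> \<int>" "(2 * T $ 1 $ 2) * (2 * T $ 2 $ 1) \<in> \<int>"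
      using Ints_mult[of "T $ 1 $ 1" "T $ 2 $ 2"] Ints_mult[of 4 "T $ 1 $ 1 * T $ 2 $ 2"] Ints_mult[of "2 * T $ 1 $ 2" "2 * T $ 2 $ 1"]
      by simp_all
    hence "4 * (T $ 1 $ 1 * T $ 2 $ 2) - (2 * T $ 1 $ 2) * (2 * T $ 2 $ 1) \<in> \<int>" by (rule Ints_diff)
    then obtain d where "4 * (T $ 1 $ 1 * T $ 2 $ 2) - (2 * T $ 1 $ 2) * (2 * T $ 2 $ 1) = of_int d" by (elim Ints_cases)
    hence "det T = of_int d / 4" by (simp add: det_2)
    thus ?thesis by (rule that)
  qed
  have "23 dvd d * int (lattice_theta_coeff L T)"
  proof (cases "theta_coeff S_213 T = 0")
    case True
    thus ?thesis by (simp add: k)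
  next
    case False
    hence "{X :: int ^2 ^2. transpose (ratmat X) ** S_213 ** ratmat X = T} \<noteq> {}" unfolding theta_coeff_def by (metis card.empty)
    then obtain X :: "int ^2 ^2" where "transpose (ratmat X) ** S_213 ** ratmat X = T" by blast
    hence "rat_of_int d = of_int (23 * (det X)\<^sup>2)" using det_gram_S_213[of X] d by simp
    hence "d = 23 * (det X)\<^sup>2" by (simp only: of_int_eq_iff)
    thus ?thesis by simp
  qed
  thus "cong_Zp 23 (det T * of_nat (lattice_theta_coeff L T)) 0"
    unfolding cong_Zp_def d by (intro exI[of _ "d * int (lattice_theta_coeff L T)"] exI[of _ 4]) simp
qed

end
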